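(* Let $(\mathbf{u},\mathbf{H})$ be a smooth solution on $\mathbb{R}^3$ of the stationary magneto-hydrodynamics system $$\operatorname{div}\mathbf{u}=0,\qquad \mathbf{u}\cdot\nabla\mathbf{u}-\Delta\mathbf{u}+\nabla p=\mathbf{H}\cdot\nabla\mathbf{H},\qquad \operatorname{div}\mathbf{H}=0,\qquad \mathbf{u}\cdot\nabla\mathbf{H}-\mathbf{H}\cdot\nabla\mathbf{u}=\Delta\mathbf{H},$$ with $\mathbf{u},\mathbf{H}\in BMO^{-1}(\mathbb{R}^3)$. If additionally $\mathbf{u},\mathbf{H}\in L^{6}(\mathbb{R}^3)$, then $\mathbf{u}\equiv 0$ and $\mathbf{H}\equiv 0$.
   Context: Here $\mathbf{u},\mathbf{H}:\mathbb{R}^3\to\mathbb{R}^3$ are vector fields (fluid velocity and magnetic field) and $p:\mathbb{R}^3\to\mathbb{R}$ is the scalar pressure; $(\mathbf{u},\mathbf{H})$ is a smooth solution if the fields are smooth and the equations hold pointwise on $\mathbb{R}^3$ with some smooth pressure $p$. The notation $(\mathbf{a}\cdot\nabla\mathbf{b})_i=\sum_j a_j\,\partial_j b_i$ is used. Definition of $BMO^{-1}$: a vector field $\mathbf{f}$ on $\mathbb{R}^3$ belongs to $BMO^{-1}(\mathbb{R}^3)$ if there exists a skew-symmetric tensor field $d=(d_{ij})_{i,j=1}^3\in BMO(\mathbb{R}^3)$ such that $\mathbf{f}=\operatorname{div} d$, i.e. $f_i=\sum_{j}\partial_j d_{ij}$ for $i=1,2,3$ (in the sense of distributions). Here $BMO(\mathbb{R}^3)$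 is the usual space of functions of bounded mean oscillation. *)

theory Defs
  imports "HOL-Analysis.Analysis"
begin

section \<open>Differential operators and smoothness\<close>

definition partial_deriv :: "'n::finite \<Rightarrow> (real^'n \<Rightarrow> real) \<Rightarrow> real^'n \<Rightarrow> real" where
  "partial_deriv j f x = deriv (\<lambda>t. f (x + t *\<^sub>R axis j 1)) 0"

text \<open>\<open>deriv\<close> is unspecified at points of non-differentiability; existence of derivatives is
  always secured separately by the smoothness predicates below.\<close>

primrec C_k :: "nat \<Rightarrow> (real^'n::finite \<Rightarrow> real) \<Rightarrow> bool" where
  "C_k 0 f \<longleftrightarrow> continuous_on UNIV f"
| "C_k (Suc k) f \<longleftrightarrow> f differentiable_on UNIV \<and> (\<forall>j. C_k k (partial_deriv j f))"

definition smooth :: "(real^'n::finite \<Rightarrow> real) \<Rightarrow> bool" where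
  "smooth f \<longleftrightarrow> (\<forall>k. C_k k f)"

definition smooth_field :: "(real^'n::finite \<Rightarrow> real^'m::finite) \<Rightarrow> bool" where
  "smooth_field v \<longleftrightarrow> (\<forall>i. smooth (\<lambda>x. v x $ i))"

definition gradient :: "(real^'n::finite \<Rightarrow> real) \<Rightarrow> real^'n \<Rightarrow> real^'n" where
  "gradient f x = (\<chi> i. partial_deriv i f x)"

definition divergence :: "(real^'n::finite \<Rightarrow> real^'n) \<Rightarrow> real^'n \<Rightarrow> real" where
  "divergence v x = (\<Sum>j\<in>UNIV. partial_deriv j (\<lambda>y. v y $ j) x)"

definition laplacian :: "(real^'n::finite \<Rightarrow> real^'m::finite) \<Rightarrow> real^'n \<Rightarrow> real^'m" where
  "laplacian v x = (\<chi> i. \<Sum>j\<in>UNIV. partial_deriv j (partial_deriv j (\<lambda>y. v y $ i)) x)"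

text \<open>\<open>advect a b\<close> is the field \<open>a \<cdot> \<nabla> b\<close>.\<close>

definition advect :: "(real^'n::finite \<Rightarrow> real^'n) \<Rightarrow> (real^'n \<Rightarrow> real^'m::finite) \<Rightarrow> real^'n \<Rightarrow> real^'m" where
  "advect a b x = (\<chi> i. \<Sum>j\<in>UNIV. a x $ j * partial_deriv j (\<lambda>y. b y $ i) x)"


section \<open>Function spaces\<close>

definition mem_Lp :: "real \<Rightarrow> ('a::euclidean_space \<Rightarrow> 'b::euclidean_space) \<Rightarrow> bool" where
  "mem_Lp p f \<longleftrightarrow> f \<in> borel_measurable lebesgue \<and> integrable lebesgue (\<lambda>x. norm (f x) powr p)"

definition locally_integrable :: "('a::euclidean_space \<Rightarrow> real) \<Rightarrow> bool" where
  "locally_integrable f \<longleftrightarrow> (\<forall>K. compact K \<longrightarrow> set_integrable lebesgue K f)"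

definition set_mean :: "'a::euclidean_space set \<Rightarrow> ('a \<Rightarrow> real) \<Rightarrow> real" where
  "set_mean A f = (LINT y:A|lebesgue. f y) / measure lebesgue A"

definition BMO :: "('a::euclidean_space \<Rightarrow> real) \<Rightarrow> bool" where
  "BMO f \<longleftrightarrow> locally_integrable f \<and>
     (\<exists>C. \<forall>x. \<forall>r>0. set_mean (ball x r) (\<lambda>y. \<bar>f y - set_mean (ball x r) f\<bar>) \<le> C)"

definition test_function :: "(real^'n::finite \<Rightarrow> real) \<Rightarrow> bool" where
  "test_function \<phi> \<longleftrightarrow> smooth \<phi> \<and> compact (closure {x. \<phi> x \<noteq> 0})"

text \<open>\<open>f = div d\<close> in the sense of distributions, where \<open>(div d)\<^sub>i = \<Sum>\<^sub>j \<partial>\<^sub>j d\<^sub>i\<^sub>j\<close>. Only meaningful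
  for locally integrable \<open>f\<close> and \<open>d\<close>.\<close>

definition is_weak_div :: "(real^'n::finite \<Rightarrow> real^'n) \<Rightarrow> (real^'n \<Rightarrow> real^'n^'n) \<Rightarrow> bool" where
  "is_weak_div f d \<longleftrightarrow> (\<forall>i. \<forall>\<phi>. test_function \<phi> \<longrightarrow>
     (LINT x|lebesgue. f x $ i * \<phi> x)
       = - (\<Sum>j\<in>UNIV. LINT x|lebesgue. d x $ i $ j * partial_deriv j \<phi> x))"

text \<open>The elements of \<open>BMO\<^sup>-\<^sup>1\<close> that are given by locally integrable fields. Skew-symmetry is
  required of the chosen representative \<open>d\<close> at every point, which is no loss of generality, since
  \<open>d\<close> may be changed on a null set.\<close>

definition BMO_inv :: "(real^'n::finite \<Rightarrow> real^'n) \<Rightarrow> bool" where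
  "BMO_inv f \<longleftrightarrow> (\<forall>i. locally_integrable (\<lambda>x. f x $ i)) \<and>
     (\<exists>d. (\<forall>x i j. d x $ i $ j = - (d x $ j $ i)) \<and>
          (\<forall>i j. BMO (\<lambda>x. d x $ i $ j)) \<and> is_weak_div f d)"


section \<open>The stationary magneto-hydrodynamics system\<close>

definition stationary_MHD ::
  "(real^3 \<Rightarrow> real^3) \<Rightarrow> (real^3 \<Rightarrow> real^3) \<Rightarrow> (real^3 \<Rightarrow> real) \<Rightarrow> bool" where
  "stationary_MHD u H p \<longleftrightarrow> (\<forall>x.
     divergence u x = 0 \<and>
     advect u u x - laplacian u x + gradient p x = advect H H x \<and>
     divergence H x = 0 \<and>
     advect u H x - advect H u x = laplacian H x)"

definition smooth_MHD_solution :: "(real^3 \<Rightarrow> real^3) \<Rightarrow> (real^3 \<Rightarrow> real^3) \<Rightarrow> bool" where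
  "smooth_MHD_solution u H \<longleftrightarrow>
     smooth_field u \<and> smooth_field H \<and> (\<exists>p. smooth p \<and> stationary_MHD u H p)"

end

theory Submission
  imports Defs "HOL-Computational_Algebra.Polynomial"
begin

text \<open>Let \<open>E(R)\<close> be the integral of \<open>\<bar>\<nabla>u\<bar>\<^sup>2 + \<bar>\<nabla>H\<bar>\<^sup>2\<close> and \<open>X\<^sub>k(R)\<close> that of the \<open>k\<close>-th powers of \<open>u\<close> and \<open>H\<close>
  over the ball of radius \<open>R\<close>. Two inequalities are played against each other.

  Local energy inequality. A test field that is divergence-free and compactly supported, namely the divergence of
  a localized skew-symmetric tensor built from the Newtonian potential of a cutoff of \<open>u\<close>, eliminates the
  pressure, with errors that need only the \<open>L\<^sup>2\<close> bound of the Hessian by the Laplacian. This gives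
  \<open>E(R) \<le> C (X\<^sub>2(8R) / R\<^sup>2 + s X\<^sub>4(8R) + X\<^sub>2(8R) / (s R\<^sup>2))\<close> for all \<open>s > 0\<close>, whence a growth
  \<open>X\<^sub>4(R) \<le> K R\<^sup>b\<close> implies \<open>E(R) \<le> K' R\<^sup>c\<close> with \<open>c = 3b/4 - 1/4\<close>.

  Improved interpolation. For a field in \<open>BMO\<^sup>-\<^sup>1\<close> the averages at scale \<open>t\<close> are bounded by \<open>C / t\<close>, since the
  mean of \<open>d\<close> over the ball may be subtracted; no John--Nirenberg inequality is needed. Together with the
  Poincare inequality for averages this bounds \<open>l\<^sup>4 \<bar>{\<bar>u\<bar> > l}\<bar>\<close> by \<open>E(2R)\<close>, and summing over dyadic levels, with
  \<open>L\<^sup>6\<close> for the large values, yields \<open>X\<^sub>4(R) \<le> C (1 / R + (1 + log R) E(2R))\<close>.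

  Starting from \<open>X\<^sub>4(R) \<le> C R\<close>, which follows from \<open>L\<^sup>6\<close>, finitely many iterations give \<open>E(R) \<longlongrightarrow> 0\<close>. As \<open>E\<close> is
  increasing, it vanishes, so \<open>u\<close> and \<open>H\<close> are constant and, being in \<open>L\<^sup>6\<close>, zero.\<close>

section \<open>Partial derivatives\<close>

text \<open>Energy estimates with L^6 alone stop short: the flux through the shell of radius R is
  1/R times an integral of cubic terms, which Hoelder bounds by R^(3/2), so E(R) = O(R^(1/2)) is all
  they give. The extra information has to lower the growth of X_4 itself. The exponent c comes from
  optimizing: with X_2 of order R^(3/2) X_4^(1/2), the best s yields X_4^(3/4) R^(-1/4). The power
  3/4 makes the loop converge, because the improved interpolation feeds E back into X_4 linearly up
  to the logarithm: b -> 3b/4 - 1/4 is a contraction with fixed point -1, and c is negative as soon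
  as b < 1/3.

  The pressure is merely some smooth function; nothing is known about its size at infinity, so it
  cannot be recovered from a Poisson equation and then estimated. The natural test field, a cutoff
  of u, is not solenoidal, and the correction that makes it so must be estimated without losing
  derivatives of u. This works because div (phi u) = grad phi . u for solenoidal u. The kernel is
  regularized to keep every integrand smooth; the limit is taken only after the identities are
  established.\<close>

abbreviation pd :: "'n::finite \<Rightarrow> (real^'n \<Rightarrow> real) \<Rightarrow> real^'n \<Rightarrow> real" where
  "pd \<equiv> partial_deriv"

abbreviation lap :: "(real^'n::finite \<Rightarrow> real) \<Rightarrow> real^'n \<Rightarrow> real" where
  "lap f x \<equiv> \<Sum>j\<in>UNIV. pd j (pd j f) x"

abbreviation dvg :: "('n::finite \<Rightarrow> real^'n \<Rightarrow> real) \<Rightarrow> real^'n \<Rightarrow> real" where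
  "dvg v x \<equiv> \<Sum>j\<in>UNIV. pd j (v j) x"

text \<open>\<open>pd\<close> is built on \<open>deriv\<close> and carries no information at a point
  of non-differentiability. This ties it to the Frechet derivative; together with
  \<open>partial_derivI\<close> it lets the product, chain and affine rules for \<open>pd\<close> be
  read off the rules for \<open>has_derivative\<close>.\<close>

lemma has_derivative_partials:
  fixes f :: "real^'n::finite \<Rightarrow> real"
  assumes "f differentiable (at x)"
  shows "(f has_derivative (\<lambda>h. \<Sum>j\<in>UNIV. h $ j * pd j f x)) (at x)"
proof -
  obtain D where D: "(f has_derivative D) (at x)"
    using assms by (auto simp: differentiable_def)
  interpret D: bounded_linear D by (rule has_derivative_bounded_linear[OF D])
  have pd: "pd j f x = D (axis j 1)" for j
  proof -
    have "((\<lambda>t. x + t *\<^sub>R axis j 1) has_derivative (\<lambda>t. t *\<^sub>R axis j (1::real))) (at (0::real))"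
      by (auto intro!: derivative_eq_intros)
    from has_derivative_compose[OF this, of f D] D
    have "((\<lambda>t. f (x + t *\<^sub>R axis j 1)) has_derivative (\<lambda>t. D (t *\<^sub>R axis j 1))) (at 0)"
      by simp
    then have "((\<lambda>t. f (x + t *\<^sub>R axis j 1)) has_real_derivative D (axis j 1)) (at 0)"
      by (simp add: has_field_derivative_def D.scaleR mult_commute_abs)
    then show ?thesis
      unfolding partial_deriv_def by (rule DERIV_imp_deriv)
  qed
  have "D h = (\<Sum>j\<in>UNIV. h $ j * pd j f x)" for h
  proof -
    have "D h = D (\<Sum>j\<in>UNIV. h $ j *\<^sub>R axis j 1)"
      by (simp add: basis_expansion scalar_mult_eq_scaleR[symmetric])
    also have "\<dots> = (\<Sum>j\<in>UNIV. h $ j * D (axis j 1))"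
      by (simp add: D.sum D.scaleR)
    finally show ?thesis by (simp add: pd)
  qed
  then have "D = (\<lambda>h. \<Sum>j\<in>UNIV. h $ j * pd j f x)" by blast
  with D show ?thesis by simp
qed

lemma partial_derivI:
  assumes "(f has_derivative D) (at x)"
  shows "pd j f x = D (axis j 1)"
proof -
  interpret D: bounded_linear D by (rule has_derivative_bounded_linear[OF assms])
  have "(f has_derivative (\<lambda>h. \<Sum>j\<in>UNIV. h $ j * pd j f x)) (at x)"
    using assms by (intro has_derivative_partials) (auto simp: differentiable_def)
  then have "D = (\<lambda>h. \<Sum>j\<in>UNIV. h $ j * pd j f x)"
    using assms has_derivative_unique by blast
  then show ?thesis
    by (simp add: axis_def if_distrib if_distribR cong: if_cong)
qed

lemma sum_axis: "(\<Sum>k\<in>UNIV. axis j (1::real) $ k * c k) = (c j :: real)"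
  by (simp add: axis_def if_distrib if_distribR cong: if_cong)

lemma has_real_derivative_line:
  fixes f :: "real^'n::finite \<Rightarrow> real"
  assumes "f differentiable (at (x + t *\<^sub>R h))"
  shows "((\<lambda>t. f (x + t *\<^sub>R h)) has_real_derivative
     (\<Sum>j\<in>UNIV. h $ j * pd j f (x + t *\<^sub>R h))) (at t)"
proof -
  have "((\<lambda>t. x + t *\<^sub>R h) has_derivative (\<lambda>t. t *\<^sub>R h)) (at t)"
    by (auto intro!: derivative_eq_intros)
  from has_derivative_compose[OF this has_derivative_partials[OF assms]]
  show ?thesis
    unfolding has_field_derivative_def
    by (rule has_derivative_eq_rhs) (auto simp: sum_distrib_left sum_distrib_right mult_ac)
qed

lemma has_real_derivative_axis:
  fixes f :: "real^'n::finite \<Rightarrow> real"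
  assumes "f differentiable (at (x + t *\<^sub>R axis j 1))"
  shows "((\<lambda>t. f (x + t *\<^sub>R axis j 1)) has_real_derivative
     pd j f (x + t *\<^sub>R axis j 1)) (at t)"
  using has_real_derivative_line[OF assms]
  by (simp add: axis_def if_distrib if_distribR cong: if_cong)

section \<open>Calculus of smooth functions\<close>

lemma differentiable_onD': "f differentiable_on UNIV \<Longrightarrow> f differentiable (at x)"
  by (simp add: differentiable_on_def)

lemma partial_deriv_const: "pd j (\<lambda>x. c) = (\<lambda>x. 0)"
  by (rule ext) (simp add: partial_deriv_def)

lemma partial_deriv_add:
  assumes "f differentiable_on UNIV" "g differentiable_on UNIV"
  shows "pd j (\<lambda>x. f x + g x) = (\<lambda>x. pd j f x + pd j g x)"
proof
  fix x
  note d = assms[THEN differentiable_onD', of x, THEN has_derivative_partials]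
  from partial_derivI[OF has_derivative_add[OF d]]
  show "pd j (\<lambda>x. f x + g x) x = pd j f x + pd j g x" by (simp add: sum_axis)
qed

lemma partial_deriv_mult:
  assumes "f differentiable_on UNIV" "g differentiable_on UNIV"
  shows "pd j (\<lambda>x. f x * g x) = (\<lambda>x. pd j f x * g x + f x * pd j g x)"
proof
  fix x
  note d = assms[THEN differentiable_onD', of x, THEN has_derivative_partials]
  from partial_derivI[OF has_derivative_mult[OF d], of j]
  show "pd j (\<lambda>x. f x * g x) x = pd j f x * g x + f x * pd j g x" by (simp add: sum_axis)
qed

lemma partial_deriv_chain:
  assumes "\<And>s. (g has_real_derivative g' s) (at s)" "f differentiable_on UNIV"
  shows "pd j (\<lambda>x. g (f x)) = (\<lambda>x. g' (f x) * pd j f x)"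
proof
  fix x
  note d = assms(2)[THEN differentiable_onD', of x, THEN has_derivative_partials]
  have "((\<lambda>x. g (f x)) has_derivative (\<lambda>h. g' (f x) * (\<Sum>j\<in>UNIV. h $ j * pd j f x))) (at x)"
    using has_derivative_compose[OF d, of g "\<lambda>h. g' (f x) * h"] assms(1)
    by (simp add: has_field_derivative_def)
  from partial_derivI[OF this, of j]
  show "pd j (\<lambda>x. g (f x)) x = g' (f x) * pd j f x" by (simp add: sum_axis)
qed

lemma partial_deriv_affine:
  fixes f :: "real^'n::finite \<Rightarrow> real"
  assumes "f differentiable_on UNIV"
  shows "pd j (\<lambda>x. f (a + c *\<^sub>R x)) = (\<lambda>x. c * pd j f (a + c *\<^sub>R x))"
proof
  fix x
  note d = assms[THEN differentiable_onD', of "a + c *\<^sub>R x", THEN has_derivative_partials]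
  have "((\<lambda>x. a + c *\<^sub>R x) has_derivative (\<lambda>h. c *\<^sub>R h)) (at x)"
    by (auto intro!: derivative_eq_intros)
  from partial_derivI[OF has_derivative_compose[OF this d], of j]
  show "pd j (\<lambda>x. f (a + c *\<^sub>R x)) x = c * pd j f (a + c *\<^sub>R x)"
    by (simp add: sum_axis sum_distrib_left[symmetric] mult.assoc)
qed

lemma partial_deriv_component:
  "pd j (\<lambda>x::real^'n::finite. x $ i) = (\<lambda>x. if i = j then 1 else 0)"
proof
  fix x :: "real^'n"
  have "((\<lambda>x. x $ i) has_derivative (\<lambda>x. x $ i)) (at x)"
    by (intro bounded_linear_imp_has_derivative bounded_linear_vec_nth)
  from partial_derivI[OF this, of j] show "pd j (\<lambda>x. x $ i) x = (if i = j then 1 else 0)"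
    by (simp add: axis_def)
qed

lemma differentiable_comp_at:
  "g differentiable (at x) \<Longrightarrow> f differentiable (at (g x)) \<Longrightarrow> (\<lambda>x. f (g x)) differentiable (at x)"
  unfolding differentiable_def using has_derivative_compose by blast

lemma C_k_Suc_imp: "C_k (Suc k) f \<Longrightarrow> C_k k f"
proof (induction k arbitrary: f)
  case 0 then show ?case by (auto intro: differentiable_imp_continuous_on)
qed auto

lemma C_k_const [simp]: "C_k k (\<lambda>x. c)"
  by (induction k arbitrary: c) (auto simp: partial_deriv_const)

lemma C_k_component: "C_k k (\<lambda>x. x $ i)"
  by (cases k) (auto simp: partial_deriv_component intro!: continuous_intros
     bounded_linear_imp_differentiable_on bounded_linear_vec_nth)

lemma C_k_add: "C_k k f \<Longrightarrow> C_k k g \<Longrightarrow> C_k k (\<lambda>x. f x + g x)"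
  by (induction k arbitrary: f g)
     (auto simp: partial_deriv_add intro!: continuous_intros differentiable_on_add)

lemma C_k_mult: "C_k k f \<Longrightarrow> C_k k g \<Longrightarrow> C_k k (\<lambda>x. f x * g x)"
proof (induction k arbitrary: f g)
  case 0 then show ?case by (auto intro!: continuous_intros)
next
  case (Suc k)
  have "C_k k f" "C_k k g" using Suc.prems C_k_Suc_imp by blast+
  with Suc show ?case
    by (auto simp: partial_deriv_mult intro!: differentiable_on_mult C_k_add)
qed

lemma C_k_affine: "C_k k f \<Longrightarrow> C_k k (\<lambda>x. f (a + c *\<^sub>R x))"
proof (induction k arbitrary: f)
  case 0 
  then show ?case by (auto intro!: continuous_intros continuous_on_compose2[of UNIV f])
next
  case (Suc k)
  have "(\<lambda>x. f (a + c *\<^sub>R x)) differentiable_on UNIV"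
    unfolding differentiable_on_def
  proof safe
    fix x
    have "(\<lambda>x. a + c *\<^sub>R x) differentiable (at x)" by (intro derivative_intros)
    moreover have "f differentiable (at (a + c *\<^sub>R x))" using Suc.prems by (simp add: differentiable_on_def)
    ultimately show "(\<lambda>x. f (a + c *\<^sub>R x)) differentiable (at x)"
      by (rule differentiable_comp_at)
  qed
  with Suc show ?case by (auto simp: partial_deriv_affine intro!: C_k_mult)
qed

lemma C_k_sum: "(\<And>i. i \<in> I \<Longrightarrow> C_k k (f i)) \<Longrightarrow> C_k k (\<lambda>x. \<Sum>i\<in>I. f i x)"
  by (induction I rule: infinite_finite_induct) (auto intro: C_k_add)

lemma C_k_inverse:
  assumes "\<And>x. f x \<noteq> 0"
  shows "C_k k f \<Longrightarrow> C_k k (\<lambda>x. inverse (f x))"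
proof (induction k)
  case 0 then show ?case using assms by (auto intro!: continuous_intros)
next
  case (Suc k)
  have d: "f differentiable_on UNIV" using Suc.prems by simp
  have "pd j (\<lambda>x. inverse (f x)) = (\<lambda>x. - 1 * (inverse (f x) * inverse (f x) * pd j f x))" for j
  proof
    fix x
    note dx = d[THEN differentiable_onD', of x, THEN has_derivative_partials]
    have "((\<lambda>x. inverse (f x)) has_derivative (\<lambda>h. - (inverse (f x) * (\<Sum>j\<in>UNIV. h $ j * pd j f x) * inverse (f x)))) (at x)"
      by (rule Deriv.has_derivative_inverse[OF assms dx])
    from partial_derivI[OF this, of j]
    show "pd j (\<lambda>x. inverse (f x)) x = - 1 * (inverse (f x) * inverse (f x) * pd j f x)"
      by (simp add: sum_axis)
  qed
  moreover have "C_k k (\<lambda>x. - 1 * (inverse (f x) * inverse (f x) * pd j f x))" for j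
    using Suc C_k_Suc_imp by (intro C_k_mult C_k_const) auto
  moreover have "(\<lambda>x. inverse (f x)) differentiable_on UNIV"
    using d assms by (simp add: differentiable_on_inverse)
  ultimately show ?case by (simp del: mult_minus1)
qed

text \<open>The outer function comes with the whole sequence of its derivatives, since
  differentiating \<open>G n (f x)\<close> leads to \<open>G (Suc n) (f x)\<close> and the induction
  on \<open>k\<close> has to be free in \<open>n\<close>. The sequence used below is
  \<open>flat (flat_poly n)\<close>.\<close>

lemma C_k_chain:
  assumes "\<And>n s. (G n has_real_derivative G (Suc n) s) (at s)"
  shows "C_k k f \<Longrightarrow> C_k k (\<lambda>x. G n (f x))"
proof (induction k arbitrary: n)
  case 0
  have "continuous_on UNIV (G n)" using assms DERIV_continuous_on by blast
  then show ?case using 0 by (auto intro: continuous_on_compose2)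
next
  case (Suc k)
  have d: "f differentiable_on UNIV" using Suc.prems by simp
  have "(\<lambda>x. G n (f x)) differentiable_on UNIV"
    unfolding differentiable_on_def
  proof safe
    fix x
    have "G n differentiable (at (f x))"
      using assms[of n] by (meson field_differentiable_def field_differentiable_imp_differentiable)
    with differentiable_onD'[OF d, of x] show "(\<lambda>x. G n (f x)) differentiable (at x)"
      by (rule differentiable_comp_at)
  qed
  moreover have "C_k k (\<lambda>x. G (Suc n) (f x))" using Suc C_k_Suc_imp by blast
  ultimately show ?case using Suc.prems
    by (auto simp: partial_deriv_chain[OF assms d] intro!: C_k_mult)
qed

lemma smooth_const [simp, intro]: "smooth (\<lambda>x. c)" by (simp add: smooth_def)
lemma smooth_component [intro]: "smooth (\<lambda>x. x $ i)" by (simp add: smooth_def C_k_component)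
lemma smooth_add [intro]: "smooth f \<Longrightarrow> smooth g \<Longrightarrow> smooth (\<lambda>x. f x + g x)"
  by (simp add: smooth_def C_k_add)
lemma smooth_mult [intro]: "smooth f \<Longrightarrow> smooth g \<Longrightarrow> smooth (\<lambda>x. f x * g x)"
  by (simp add: smooth_def C_k_mult)
lemma smooth_minus [intro]: "smooth f \<Longrightarrow> smooth (\<lambda>x. - f x)"
  using smooth_mult[of "\<lambda>_. -1" f] by simp
lemma smooth_diff [intro]: "smooth f \<Longrightarrow> smooth g \<Longrightarrow> smooth (\<lambda>x. f x - g x)"
  using smooth_add[of f "\<lambda>x. - g x"] by auto
lemma smooth_sum [intro]: "(\<And>i. i \<in> I \<Longrightarrow> smooth (f i)) \<Longrightarrow> smooth (\<lambda>x. \<Sum>i\<in>I. f i x)"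
  by (simp add: smooth_def C_k_sum)
lemma smooth_power [intro]: "smooth f \<Longrightarrow> smooth (\<lambda>x. f x ^ n)"
  by (induction n) auto
lemma smooth_affine: "smooth f \<Longrightarrow> smooth (\<lambda>x. f (a + c *\<^sub>R x))"
  by (simp add: smooth_def C_k_affine)
lemma smooth_pd [intro]: "smooth f \<Longrightarrow> smooth (pd j f)"
  unfolding smooth_def by (meson C_k.simps(2))
lemma smooth_inverse: "smooth f \<Longrightarrow> (\<And>x. f x \<noteq> 0) \<Longrightarrow> smooth (\<lambda>x. inverse (f x))"
  by (simp add: smooth_def C_k_inverse)
lemma smooth_differentiable: "smooth f \<Longrightarrow> f differentiable_on UNIV"
  unfolding smooth_def by (meson C_k.simps(2))
lemma smooth_continuous: "smooth f \<Longrightarrow> continuous_on A f"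
  unfolding smooth_def using C_k.simps(1) continuous_on_subset by blast

lemma smooth_measurable [measurable_dest]: "smooth f \<Longrightarrow> f \<in> borel_measurable borel"
  using borel_measurable_continuous_onI smooth_continuous by blast

lemma smooth_differentiable_at: "smooth f \<Longrightarrow> f differentiable (at x)"
  using smooth_differentiable by (rule differentiable_onD')

lemma pd_add: "smooth f \<Longrightarrow> smooth g \<Longrightarrow>
  pd j (\<lambda>x. f x + g x) = (\<lambda>x. pd j f x + pd j g x)"
  by (simp add: partial_deriv_add smooth_differentiable)
lemma pd_mult: "smooth f \<Longrightarrow> smooth g \<Longrightarrow>
  pd j (\<lambda>x. f x * g x) = (\<lambda>x. pd j f x * g x + f x * pd j g x)"
  by (simp add: partial_deriv_mult smooth_differentiable)
lemma pd_cmult: "smooth f \<Longrightarrow> pd j (\<lambda>x. c * f x) = (\<lambda>x. c * pd j f x)"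
  by (subst pd_mult) (auto simp: partial_deriv_const)
lemma pd_minus: "smooth f \<Longrightarrow> pd j (\<lambda>x. - f x) = (\<lambda>x. - pd j f x)"
  using pd_cmult[of f j "-1"] by simp
lemma pd_diff: "smooth f \<Longrightarrow> smooth g \<Longrightarrow>
  pd j (\<lambda>x. f x - g x) = (\<lambda>x. pd j f x - pd j g x)"
  using pd_add[of f "\<lambda>x. - g x" j] by (auto simp: pd_minus)
lemma pd_sum: "(\<And>i. i \<in> I \<Longrightarrow> smooth (f i)) \<Longrightarrow>
  pd j (\<lambda>x. \<Sum>i\<in>I. f i x) = (\<lambda>x. \<Sum>i\<in>I. pd j (f i) x)"
proof (induction I rule: infinite_finite_induct)
  case (insert i I)
  then show ?case using pd_add[of "f i" "\<lambda>x. \<Sum>i\<in>I. f i x"] by (auto simp: smooth_sum)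
qed (auto simp: partial_deriv_const)

text \<open>The second difference over a square of side \<open>h\<close> does not depend on the
  order of the two directions, and two applications of the mean value theorem turn it into
  \<open>h * h\<close> times a mixed derivative at a point within \<open>2 * h\<close> of
  \<open>x\<close>. Doing this in both orders and letting \<open>h\<close> tend to 0 identifies the
  two derivatives by continuity.\<close>

lemma partial_deriv_commute:
  fixes f :: "real^'n::finite \<Rightarrow> real"
  assumes "smooth f"
  shows "pd i (pd j f) = pd j (pd i f)"
proof
  fix x
  have key: "\<exists>y. norm (y - x) \<le> 2 * h \<and>
     f (x + h *\<^sub>R axis i 1 + h *\<^sub>R axis j 1) - f (x + h *\<^sub>R axis i 1) - f (x + h *\<^sub>R axis j 1) + f x
       = h * h * pd i (pd j f) y"
    if h: "h > 0" for h i j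
  proof -
    define g where "g t = f (x + h *\<^sub>R axis i 1 + t *\<^sub>R axis j 1) - f (x + t *\<^sub>R axis j 1)" for t
    define g' where "g' t = pd j f (x + h *\<^sub>R axis i 1 + t *\<^sub>R axis j 1) - pd j f (x + t *\<^sub>R axis j 1)" for t
    have "(g has_real_derivative g' t) (at t)" for t
      unfolding g_def g'_def
      by (intro DERIV_diff has_real_derivative_axis smooth_differentiable_at assms)
    from MVT2[of 0 h g g', OF h] this obtain t where t: "0 < t" "t < h" "g h - g 0 = h * g' t"
      by auto
    define k where "k s = pd j f (x + t *\<^sub>R axis j 1 + s *\<^sub>R axis i 1)" for s
    have "(k has_real_derivative pd i (pd j f) (x + t *\<^sub>R axis j 1 + s *\<^sub>R axis i 1)) (at s)" for s
      unfolding k_def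
      by (intro has_real_derivative_axis smooth_differentiable_at smooth_pd assms)
    from MVT2[of 0 h k "\<lambda>s. pd i (pd j f) (x + t *\<^sub>R axis j 1 + s *\<^sub>R axis i 1)", OF h] this
    obtain s where s: "0 < s" "s < h" 
      "k h - k 0 = h * pd i (pd j f) (x + t *\<^sub>R axis j 1 + s *\<^sub>R axis i 1)"
      by auto
    have "k h - k 0 = g' t" by (simp add: k_def g'_def algebra_simps)
    moreover have "norm (t *\<^sub>R axis j (1::real) + s *\<^sub>R axis i (1::real) :: real^'n) \<le> 2 * h"
      using t s by (intro norm_triangle_le) auto
    ultimately show ?thesis using t s
      by (intro exI[of _ "x + t *\<^sub>R axis j 1 + s *\<^sub>R axis i 1"]) (auto simp: g_def algebra_simps)
  qed
  have "\<exists>Y. \<forall>n. norm (Y n - x) \<le> 2 * inverse (real (Suc n)) \<and>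
     f (x + inverse (real (Suc n)) *\<^sub>R axis i 1 + inverse (real (Suc n)) *\<^sub>R axis j 1) - f (x + inverse (real (Suc n)) *\<^sub>R axis i 1)
      - f (x + inverse (real (Suc n)) *\<^sub>R axis j 1) + f x
       = inverse (real (Suc n)) * inverse (real (Suc n)) * pd i (pd j f) (Y n)" for i j
    by (intro choice allI key) auto
  note ex = this
  obtain Y where Y: "\<And>n. norm (Y n - x) \<le> 2 * inverse (real (Suc n))"
    "\<And>n. f (x + inverse (real (Suc n)) *\<^sub>R axis i 1 + inverse (real (Suc n)) *\<^sub>R axis j 1) - f (x + inverse (real (Suc n)) *\<^sub>R axis i 1)
      - f (x + inverse (real (Suc n)) *\<^sub>R axis j 1) + f x
       = inverse (real (Suc n)) * inverse (real (Suc n)) * pd i (pd j f) (Y n)"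
    using ex[of i j] by blast
  obtain Z where Z: "\<And>n. norm (Z n - x) \<le> 2 * inverse (real (Suc n))"
    "\<And>n. f (x + inverse (real (Suc n)) *\<^sub>R axis j 1 + inverse (real (Suc n)) *\<^sub>R axis i 1) - f (x + inverse (real (Suc n)) *\<^sub>R axis j 1)
      - f (x + inverse (real (Suc n)) *\<^sub>R axis i 1) + f x
       = inverse (real (Suc n)) * inverse (real (Suc n)) * pd j (pd i f) (Z n)"
    using ex[of j i] by blast
  have lim0: "(\<lambda>n. 2 * inverse (real (Suc n))) \<longlonglongrightarrow> 0"
    using tendsto_mult_right_zero[OF LIMSEQ_inverse_real_of_nat] .
  have lim: "W \<longlonglongrightarrow> x" if "\<And>n. norm (W n - x) \<le> 2 * inverse (real (Suc n))" for W
    by (rule LIM_zero_cancel, rule Lim_null_comparison[OF _ lim0]) (use that in auto)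
  have "pd i (pd j f) (Y n) = pd j (pd i f) (Z n)" for n
  proof -
    have "inverse (real (Suc n)) * inverse (real (Suc n)) * pd i (pd j f) (Y n)
      = inverse (real (Suc n)) * inverse (real (Suc n)) * pd j (pd i f) (Z n)"
      using Y(2)[of n] Z(2)[of n] by (simp add: algebra_simps)
    then show ?thesis by simp
  qed
  moreover have cont: "isCont (pd i (pd j f)) x" for i j
    using smooth_continuous[of "pd i (pd j f)" UNIV] assms
    by (auto simp: continuous_on_eq_continuous_at)
  moreover have "(\<lambda>n. pd i (pd j f) (Y n)) \<longlonglongrightarrow> pd i (pd j f) x"
    by (rule isCont_tendsto_compose[OF cont lim[OF Y(1)]])
  moreover have "(\<lambda>n. pd j (pd i f) (Z n)) \<longlonglongrightarrow> pd j (pd i f) x"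
    by (rule isCont_tendsto_compose[OF cont lim[OF Z(1)]])
  ultimately show "pd i (pd j f) x = pd j (pd i f) x"
    using LIMSEQ_unique by fastforce
qed

section \<open>Integration over the whole space\<close>

lemma nn_integral_affine:
  fixes f :: "'a::euclidean_space \<Rightarrow> ennreal" and c :: real
  assumes [measurable]: "f \<in> borel_measurable borel" and c: "c \<noteq> 0"
  shows "(\<integral>\<^sup>+x. f x \<partial>lborel) = ennreal (\<bar>c\<bar>^DIM('a)) * (\<integral>\<^sup>+x. f (t + c *\<^sub>R x) \<partial>lborel)"
  by (subst lborel_affine[OF c, of t])
     (simp add: nn_integral_density nn_integral_distr nn_integral_cmult)

lemma integral_affine:
  fixes f :: "'a::euclidean_space \<Rightarrow> real" and c :: real
  assumes [measurable]: "f \<in> borel_measurable borel" and c: "c \<noteq> 0"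
  shows "(LBINT x. f x) = \<bar>c\<bar>^DIM('a) * (LBINT x. f (t + c *\<^sub>R x))"
proof -
  have "(LBINT x. f x) = (\<integral>x. f x \<partial>(density (distr lborel borel (\<lambda>x. t + c *\<^sub>R x)) (\<lambda>_. ennreal (\<bar>c\<bar>^DIM('a)))))"
    using lborel_affine[OF c, of t] by simp
  also have "\<dots> = (\<integral>x. \<bar>c\<bar>^DIM('a) * f x \<partial>(distr lborel borel (\<lambda>x. t + c *\<^sub>R x)))"
    by (subst integral_density) auto
  also have "\<dots> = (LBINT x. \<bar>c\<bar>^DIM('a) * f (t + c *\<^sub>R x))"
    by (subst integral_distr) auto
  finally show ?thesis by simp
qed

lemma integrable_affine:
  fixes f :: "'a::euclidean_space \<Rightarrow> real" and c :: real
  assumes f: "integrable lborel f" and c: "c \<noteq> 0"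
  shows "integrable lborel (\<lambda>x. f (t + c *\<^sub>R x))"
proof -
  have [measurable]: "f \<in> borel_measurable borel" using f by auto
  show ?thesis using f unfolding integrable_iff_bounded
    by (subst (asm) nn_integral_affine[where c=c and t=t]) (auto simp: ennreal_mult_less_top c)
qed

section \<open>Functions vanishing outside a ball, and integration by parts\<close>

definition supported :: "real \<Rightarrow> ('a::real_normed_vector \<Rightarrow> real) \<Rightarrow> bool" where
  "supported r f \<longleftrightarrow> (\<forall>x. norm x > r \<longrightarrow> f x = 0)"

lemma supportedD: "supported r f \<Longrightarrow> norm x > r \<Longrightarrow> f x = 0"
  by (simp add: supported_def)
lemma supported_mono: "supported r f \<Longrightarrow> r \<le> s \<Longrightarrow> supported s f"
  by (simp add: supported_def)
lemma supported_add [intro]: "supported r f \<Longrightarrow> supported r g \<Longrightarrow> supported r (\<lambda>x. f x + g x)"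
  by (simp add: supported_def)
lemma supported_diff [intro]: "supported r f \<Longrightarrow> supported r g \<Longrightarrow> supported r (\<lambda>x. f x - g x)"
  by (simp add: supported_def)
lemma supported_minus [intro]: "supported r f \<Longrightarrow> supported r (\<lambda>x. - f x)"
  by (simp add: supported_def)
lemma supported_mult_left [intro]: "supported r f \<Longrightarrow> supported r (\<lambda>x. f x * g x)"
  by (simp add: supported_def)
lemma supported_mult_right [intro]: "supported r g \<Longrightarrow> supported r (\<lambda>x. f x * g x)"
  by (simp add: supported_def)
lemma supported_sum [intro]: "(\<And>i. i \<in> I \<Longrightarrow> supported r (f i)) \<Longrightarrow> supported r (\<lambda>x. \<Sum>i\<in>I. f i x)"
  by (simp add: supported_def)
lemma partial_deriv_eq_0_on_open:
  assumes "open S" "x \<in> S" "\<And>y. y \<in> S \<Longrightarrow> f y = c"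
  shows "pd j f x = 0"
proof -
  have "((\<lambda>_. c) has_derivative (\<lambda>_. 0)) (at x)" by simp
  then have "(f has_derivative (\<lambda>_. 0)) (at x)"
    by (rule has_derivative_transform_within_open[OF _ assms(1,2)]) (use assms(3) in auto)
  from partial_derivI[OF this] show ?thesis by simp
qed

lemma supported_pd [intro]:
  assumes "supported r f"
  shows "supported r (pd j f)"
  unfolding supported_def
proof safe
  fix x :: "real^'a" assume "norm x > r"
  then show "pd j f x = 0"
    by (intro partial_deriv_eq_0_on_open[of "- cball 0 r" x f 0])
       (use assms in \<open>auto simp: supported_def open_Compl\<close>)
qed
lemma continuous_supported_bounded:
  fixes f :: "'a::euclidean_space \<Rightarrow> real"
  assumes "continuous_on UNIV f" "supported r f"
  obtains B where "B \<ge> 0" "\<And>x. \<bar>f x\<bar> \<le> B"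
proof -
  have "compact (f ` cball 0 r)"
    by (intro compact_continuous_image continuous_on_subset[OF assms(1)]) auto
  then obtain B where B: "\<And>x. x \<in> cball 0 r \<Longrightarrow> \<bar>f x\<bar> \<le> B"
    using compact_imp_bounded bounded_iff by (metis imageI real_norm_def)
  have "\<bar>f x\<bar> \<le> max B 0" for x
    using B[of x] assms(2) by (cases "norm x \<le> r") (auto simp: supported_def)
  then show ?thesis using that[of "max B 0"] by auto
qed

lemma integrable_indicator_cball:
  fixes f :: "'a::euclidean_space \<Rightarrow> real"
  assumes "continuous_on UNIV f"
  shows "integrable lborel (\<lambda>x. indicator (cball a r) x * f x)"
proof -
  have "continuous_on (cball a r) f" by (rule continuous_on_subset[OF assms]) auto
  from borel_integrable_compact[OF compact_cball this] show ?thesis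
    by simp
qed

lemma integrable_supported:
  fixes f :: "'a::euclidean_space \<Rightarrow> real"
  assumes "continuous_on UNIV f" "supported r f"
  shows "integrable lborel f"
proof -
  have "f = (\<lambda>x. indicator (cball 0 r) x * f x)"
    using assms(2) by (auto simp: supported_def fun_eq_iff indicator_def)
  then show ?thesis using integrable_indicator_cball[OF assms(1)] by metis
qed

lemma integrable_smooth_supported: "smooth f \<Longrightarrow> supported r f \<Longrightarrow> integrable lborel f"
  by (blast intro: integrable_supported smooth_continuous)

text \<open>Difference quotients integrate to zero by translation invariance. The mean value theorem
  bounds them by the supremum of the derivative, and step lengths of at most 1 keep them inside the
  ball of radius \<open>r + 1\<close>, so dominated convergence passes to the derivative.\<close>

lemma integral_partial_deriv_eq_0:
  fixes f :: "real^'n::finite \<Rightarrow> real"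
  assumes f: "smooth f" and r: "supported r f"
  shows "(LBINT x. pd j f x) = 0"
proof -
  have [measurable]: "f \<in> borel_measurable borel" "pd j f \<in> borel_measurable borel"
    using f by (auto intro: smooth_measurable)
  obtain B where B: "B \<ge> 0" "\<And>x. \<bar>pd j f x\<bar> \<le> B"
    using continuous_supported_bounded[of "pd j f" r] f r smooth_continuous by blast
  define t where "t n = inverse (real (Suc n))" for n
  have t: "t n > 0" "t n \<le> 1" for n by (auto simp: t_def divide_simps)
  define s where "s n x = (f (x + t n *\<^sub>R axis j 1) - f x) / t n" for n x
  have lim: "(\<lambda>n. s n x) \<longlonglongrightarrow> pd j f x" for x
  proof -
    have "((\<lambda>t. f (x + t *\<^sub>R axis j 1)) has_real_derivative pd j f x) (at 0)"
      using has_real_derivative_axis[of f x 0 j] f by (auto intro: smooth_differentiable_at)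
    then have *: "((\<lambda>h. (f (x + h *\<^sub>R axis j 1) - f x) / h) \<longlongrightarrow> pd j f x) (at 0)"
      by (simp add: DERIV_def)
    have "filterlim t (at 0) sequentially"
      unfolding filterlim_at t_def using LIMSEQ_inverse_real_of_nat by auto
    from filterlim_compose[OF * this] show ?thesis by (simp add: s_def)
  qed
  have bd: "norm (s n x) \<le> indicator (cball 0 (r + 1)) x * B" for n x
  proof (cases "norm x \<le> r + 1")
    case True
    have "\<exists>z>0. z < t n \<and> f (x + t n *\<^sub>R axis j 1) - f (x + 0 *\<^sub>R axis j 1) = (t n - 0) * pd j f (x + z *\<^sub>R axis j 1)"
      by (intro MVT2 t has_real_derivative_axis smooth_differentiable_at f)
    then obtain z where "f (x + t n *\<^sub>R axis j 1) - f x = t n * pd j f (x + z *\<^sub>R axis j 1)" by auto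
    then have "s n x = pd j f (x + z *\<^sub>R axis j 1)" using t[of n] by (simp add: s_def)
    with B True show ?thesis by simp
  next
    case False
    have "norm x \<le> norm (x + t n *\<^sub>R axis j 1) + norm (t n *\<^sub>R axis j (1::real))"
      by (metis add_diff_cancel_right' norm_triangle_ineq4)
    moreover have "norm (t n *\<^sub>R axis j (1::real)) \<le> 1" using t[of n] by simp
    ultimately have "norm (x + t n *\<^sub>R axis j 1) > r" using False by linarith
    with False r have "s n x = 0" by (simp add: s_def supported_def)
    then show ?thesis using B by simp
  qed
  have s0: "(LBINT x. s n x) = 0" for n
  proof -
    have i: "integrable lborel f" using f r by (rule integrable_smooth_supported)
    have i2: "integrable lborel (\<lambda>x. f (x + t n *\<^sub>R axis j 1))"
      using integrable_affine[OF i, of 1 "t n *\<^sub>R axis j 1"] by (simp add: add.commute)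
    have "(LBINT x. f (x + t n *\<^sub>R axis j 1)) = (LBINT x. f x)"
      using integral_affine[of f 1 "t n *\<^sub>R axis j 1"] by (simp add: add.commute)
    then show ?thesis unfolding s_def using i i2 by simp
  qed
  have "(\<lambda>n. LBINT x. s n x) \<longlonglongrightarrow> (LBINT x. pd j f x)"
  proof (rule integral_dominated_convergence[where w="\<lambda>x. indicator (cball 0 (r + 1)) x * B"])
    show "integrable lborel (\<lambda>x. indicator (cball 0 (r + 1)) x * B)"
      by (rule integrable_indicator_cball) auto
    show "s n \<in> borel_measurable lborel" for n unfolding s_def by measurable
  qed (use lim bd in auto)
  then show ?thesis by (simp add: s0 LIMSEQ_const_iff)
qed

lemma integral_by_parts:
  fixes f g :: "real^'n::finite \<Rightarrow> real"
  assumes f: "smooth f" and g: "smooth g" and r: "supported r g"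
  shows "(LBINT x. pd j f x * g x) = - (LBINT x. f x * pd j g x)"
proof -
  have "(LBINT x. pd j (\<lambda>x. f x * g x) x) = 0"
    using f g r by (intro integral_partial_deriv_eq_0) auto
  moreover have "integrable lborel (\<lambda>x. pd j f x * g x)" "integrable lborel (\<lambda>x. f x * pd j g x)"
    using f g r by (auto intro!: integrable_smooth_supported[of _ r])
  ultimately show ?thesis using f g by (simp add: pd_mult)
qed

section \<open>Cutoff functions\<close>

text \<open>The exponent \<open>k\<close> is free so that the induction on the polynomial can shift
  it: splitting off the constant coefficient leaves a shorter polynomial with one more factor
  \<open>x\<close>.\<close>

lemma tendsto_poly_exp_minus: "((\<lambda>x::real. x ^ k * poly p x * exp (- x)) \<longlongrightarrow> 0) at_top"
proof (induction p arbitrary: k)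
  case 0 then show ?case by simp
next
  case (pCons a p)
  have "((\<lambda>x::real. a * (x ^ k / exp x) + x ^ Suc k * poly p x * exp (- x)) \<longlongrightarrow> a * 0 + 0) at_top"
    by (intro tendsto_intros pCons.IH tendsto_power_div_exp_0)
  moreover have "(\<lambda>x::real. a * (x ^ k / exp x) + x ^ Suc k * poly p x * exp (- x))
      = (\<lambda>x. x ^ k * poly (pCons a p) x * exp (- x))"
    by (rule ext) (simp add: exp_minus field_simps)
  ultimately show ?case by simp
qed

text \<open>The classical flat function exp(-1/s), extended by zero, with a polynomial factor in 1/s
  that makes the family closed under differentiation.\<close>

definition flat :: "real poly \<Rightarrow> real \<Rightarrow> real" where
  "flat p s = (if s > 0 then poly p (1 / s) * exp (- (1 / s)) else 0)"

text \<open>Differentiating \<open>p (1 / s) * exp (- 1 / s)\<close> replaces \<open>p\<close> by \<open>X\<^sup>2 (p - p')\<close>.\<close>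

primrec flat_poly :: "nat \<Rightarrow> real poly" where
  "flat_poly 0 = 1"
| "flat_poly (Suc n) = [:0, 0, 1:] * (flat_poly n - pderiv (flat_poly n))"

lemma flat_deriv: "(flat p has_real_derivative flat ([:0, 0, 1:] * (p - pderiv p)) s) (at s)"
proof -
  consider "s > 0" | "s < 0" | "s = 0" by linarith
  then show ?thesis
  proof cases
    case 1
    have "((\<lambda>s. poly p (1 / s) * exp (- (1 / s))) has_real_derivative flat ([:0, 0, 1:] * (p - pderiv p)) s) (at s)"
      using 1 by (auto intro!: derivative_eq_intros DERIV_chain2[OF poly_DERIV] simp: flat_def field_simps power2_eq_square)
    then show ?thesis
      by (rule has_field_derivative_transform_within_open[of _ _ _ "{0<..}"]) (use 1 in \<open>auto simp: flat_def\<close>)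
  next
    case 2
    have "((\<lambda>s. 0) has_real_derivative 0) (at s)" by simp
    then have "(flat p has_real_derivative 0) (at s)"
      by (rule has_field_derivative_transform_within_open[of _ _ _ "{..<0}"]) (use 2 in \<open>auto simp: flat_def\<close>)
    then show ?thesis using 2 by (simp add: flat_def)
  next
    \<comment> \<open>At the origin the right-hand difference quotient is
      \<open>flat p h / h\<close>; in the variable x = 1/h it becomes x p(x) exp(-x), which tends to
      0. From the left the quotient is identically 0.\<close>
    case 3
    have "((\<lambda>x::real. x ^ 1 * poly p x * exp (- x)) \<longlongrightarrow> 0) at_top" by (rule tendsto_poly_exp_minus)
    from filterlim_compose[OF this filterlim_inverse_at_top_right]
    have "((\<lambda>h. inverse h * poly p (inverse h) * exp (- inverse h)) \<longlongrightarrow> 0) (at_right 0)" by simp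
    then have R: "((\<lambda>h. flat p h / h) \<longlongrightarrow> 0) (at_right 0)"
      by (rule Lim_transform_eventually)
         (auto simp: eventually_at_filter flat_def field_simps intro!: always_eventually)
    have L: "((\<lambda>h. flat p h / h) \<longlongrightarrow> 0) (at_left 0)"
      by (rule Lim_transform_eventually[OF tendsto_const])
         (auto simp: eventually_at_filter flat_def intro!: always_eventually)
    have "((\<lambda>h. flat p h / h) \<longlongrightarrow> 0) (at 0)"
      using L R by (rule filterlim_split_at)
    then show ?thesis using 3 by (simp add: DERIV_def flat_def)
  qed
qed

lemma smooth_flat:
  assumes "smooth f"
  shows "smooth (\<lambda>x. flat 1 (f x))"
proof -
  have "C_k k (\<lambda>x. flat (flat_poly 0) (f x))" for k
    using C_k_chain[of "\<lambda>n. flat (flat_poly n)" k f 0] flat_deriv assms by (simp add: smooth_def)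
  then show ?thesis by (simp add: smooth_def)
qed

lemma flat_1: "flat 1 s = (if s > 0 then exp (- (1 / s)) else 0)" by (simp add: flat_def)

text \<open>This is A / (A + B) with A positive exactly for |x| < b and B positive exactly for |x| >
  a (for positive radii), so the denominator cannot vanish when a < b. The norm enters squared to
  keep the function smooth at the origin.\<close>

definition cutoff :: "real \<Rightarrow> real \<Rightarrow> real^'n::finite \<Rightarrow> real" where
  "cutoff a b x = flat 1 (b\<^sup>2 - (norm x)\<^sup>2) * inverse (flat 1 (b\<^sup>2 - (norm x)\<^sup>2) + flat 1 ((norm x)\<^sup>2 - a\<^sup>2))"

lemma norm_sq_sum: "(norm (x::real^'n::finite))\<^sup>2 = (\<Sum>i\<in>UNIV. (x $ i)\<^sup>2)"
  by (simp add: norm_vec_def L2_set_def sum_nonneg)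

lemma smooth_norm_sq: "smooth (\<lambda>x::real^'n::finite. (norm x)\<^sup>2)"
  unfolding norm_sq_sum by (intro smooth_sum smooth_power smooth_component)

lemma cutoff_den_pos:
  assumes "0 < a" "a < b"
  shows "flat 1 (b\<^sup>2 - t) + flat 1 (t - a\<^sup>2) > 0"
proof -
  have "a\<^sup>2 < b\<^sup>2" using assms by (intro power_strict_mono) auto
  then show ?thesis by (auto simp: flat_1 add_pos_pos)
qed

lemma smooth_cutoff: "0 < a \<Longrightarrow> a < b \<Longrightarrow> smooth (cutoff a b)"
  unfolding cutoff_def[abs_def]
  by (intro smooth_mult smooth_inverse smooth_add smooth_flat smooth_diff smooth_norm_sq smooth_const)
     (metis cutoff_den_pos less_irrefl)

lemma cutoff_bounds: "0 \<le> cutoff a b x" "cutoff a b x \<le> 1"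
proof -
  have nn: "flat 1 t \<ge> 0" for t by (simp add: flat_1)
  have "0 \<le> A * inverse (A + B) \<and> A * inverse (A + B) \<le> 1" if "A \<ge> 0" "B \<ge> 0" for A B :: real
    using that by (cases "A + B = 0") (auto simp: field_simps)
  from this[OF nn nn] show "0 \<le> cutoff a b x" "cutoff a b x \<le> 1" by (auto simp: cutoff_def)
qed

lemma cutoff_eq_1: "0 < a \<Longrightarrow> a < b \<Longrightarrow> norm x \<le> a \<Longrightarrow> cutoff a b x = 1"
proof -
  assume *: "0 < a" "a < b" "norm x \<le> a"
  then have "(norm x)\<^sup>2 \<le> a\<^sup>2" "a\<^sup>2 < b\<^sup>2" by (auto intro: power_mono power_strict_mono)
  then show ?thesis by (simp add: cutoff_def flat_1)
qed

lemma supported_cutoff: "0 < b \<Longrightarrow> supported b (cutoff a b)"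
  unfolding supported_def
proof safe
  fix x :: "real^'a" assume "0 < b" "b < norm x"
  then have "b\<^sup>2 < (norm x)\<^sup>2" by (auto intro: power_strict_mono)
  then show "cutoff a b x = 0" by (simp add: cutoff_def flat_1)
qed

lemma partial_deriv_cutoff_eq_0:
  assumes "0 < a" "a < b" "norm x < a"
  shows "pd j (cutoff a b) x = 0"
  by (rule partial_deriv_eq_0_on_open[of "ball 0 a" _ _ 1]) (use assms in \<open>auto intro: cutoff_eq_1\<close>)

lemma test_function_supported:
  assumes "smooth \<phi>" "supported r \<phi>"
  shows "test_function \<phi>"
proof -
  have "closure {x. \<phi> x \<noteq> 0} \<subseteq> cball 0 r"
    using assms(2) by (intro closure_minimal) (auto simp: supported_def not_less[symmetric])
  then have "bounded (closure {x. \<phi> x \<noteq> 0})" using bounded_subset bounded_cball by blast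
  then show ?thesis using assms(1) by (simp add: test_function_def compact_eq_bounded_closed)
qed

section \<open>Convolution and the Newtonian kernel\<close>

definition conv :: "('a::euclidean_space \<Rightarrow> real) \<Rightarrow> ('a \<Rightarrow> real) \<Rightarrow> 'a \<Rightarrow> real" where
  "conv K f x = (LBINT y. K (x - y) * f y)"

lemma smooth_shift: "smooth f \<Longrightarrow> smooth (\<lambda>y. f (x - y))"
  using smooth_affine[of f x "-1"] by simp

lemma pd_shift: "smooth f \<Longrightarrow> pd j (\<lambda>y. f (x - y)) = (\<lambda>y. - pd j f (x - y))"
  using partial_deriv_affine[of f j x "-1"] by (simp add: smooth_differentiable)

lemma continuous_on_shift: "continuous_on UNIV f \<Longrightarrow> continuous_on UNIV (\<lambda>y. f (x - y))"
  for f :: "'a::real_normed_vector \<Rightarrow> real"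
  by (rule continuous_on_compose2[of UNIV f]) (auto intro: continuous_intros)

lemma integrable_conv:
  assumes "continuous_on UNIV K" "continuous_on UNIV f" "supported r f"
  shows "integrable lborel (\<lambda>y. K (x - y) * f y)"
  using assms by (intro integrable_supported[of _ r] continuous_intros continuous_on_shift) auto

text \<open>Differentiation under the integral sign. The support of \<open>f\<close> confines the
  integral to a box, where \<open>leibniz_rule\<close> applies; that rule wants the derivative in
  \<open>x\<close> as a bounded linear functional depending continuously on both variables, which is
  \<open>fx\<close>.\<close>

lemma conv_has_derivative:
  fixes K :: "real^'n::finite \<Rightarrow> real"
  assumes K: "smooth K" and f: "continuous_on UNIV f" "supported r f"
  shows "conv K f differentiable (at x)"
    and "pd j (conv K f) x = conv (pd j K) f x"
proof -
  obtain a where a: "cball 0 r \<subseteq> cbox (- a) (a :: real^'n)"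
    using bounded_subset_cbox_symmetric[OF bounded_cball] by blast
  have eq: "(LBINT y. L (x - y) * f y) = integral (cbox (-a) a) (\<lambda>y. L (x - y) * f y)"
    if "continuous_on UNIV L" for L :: "real^'n \<Rightarrow> real" and x
  proof -
    have "continuous_on (cbox (-a) a) (\<lambda>y. L (x - y) * f y)"
      using that f by (intro continuous_intros continuous_on_subset[OF continuous_on_shift] continuous_on_subset[OF f(1)]) auto
    from borel_integrable_compact[OF compact_cbox this]
    have "set_integrable lborel (cbox (-a) a) (\<lambda>y. L (x - y) * f y)"
      by (simp add: set_integrable_def)
    from set_borel_integral_eq_integral(2)[OF this]
    have "integral (cbox (-a) a) (\<lambda>y. L (x - y) * f y) = (LINT y:cbox (-a) a|lborel. L (x - y) * f y)"
      by simp
    also have "\<dots> = (LBINT y. L (x - y) * f y)"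
      unfolding set_lebesgue_integral_def
    proof (rule Bochner_Integration.integral_cong[OF refl])
      fix y
      show "indicat_real (cbox (-a) a) y *\<^sub>R (L (x - y) * f y) = L (x - y) * f y"
        using f(2) a by (cases "norm y > r") (auto simp: supported_def indicator_def subset_iff)
    qed
    finally show ?thesis by simp
  qed
  define fx where "fx x y = (\<Sum>j\<in>UNIV. (pd j K (x - y) * f y) *\<^sub>R blinfun_inner_left (axis j (1::real)))" for x y
  have fx_apply: "blinfun_apply (fx x y) h = (\<Sum>j\<in>UNIV. h $ j * pd j K (x - y)) * f y" for x y and h :: "real^'n"
    by (simp add: fx_def blinfun.sum_left blinfun.scaleR_left inner_axis inner_commute sum_distrib_left sum_distrib_right mult_ac)
  have "((\<lambda>x. integral (cbox (-a) a) (\<lambda>y. K (x - y) * f y)) has_derivative integral (cbox (-a) a) (fx x)) (at x within UNIV)"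
  proof (rule leibniz_rule)
    fix x y :: "real^'n"
    have "((\<lambda>x. x - y) has_derivative (\<lambda>h. h)) (at x)" by (auto intro!: derivative_eq_intros)
    from has_derivative_compose[OF this, of K "\<lambda>h. \<Sum>j\<in>UNIV. h $ j * pd j K (x - y)"]
      has_derivative_partials[OF smooth_differentiable_at[OF K], of "x - y"]
    have "((\<lambda>x. K (x - y)) has_derivative (\<lambda>h. \<Sum>j\<in>UNIV. h $ j * pd j K (x - y))) (at x)" by simp
    then show "((\<lambda>x. K (x - y) * f y) has_derivative blinfun_apply (fx x y)) (at x within UNIV)"
      unfolding fx_apply[abs_def] by (rule has_derivative_mult_left)
    show "(\<lambda>y. K (x - y) * f y) integrable_on cbox (-a) a"
      using f smooth_continuous[OF K]
      by (intro integrable_continuous continuous_intros continuous_on_subset[OF continuous_on_shift] continuous_on_subset[OF f(1)]) auto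
  next
    have "continuous_on (UNIV \<times> cbox (-a) a) (\<lambda>p. fx (fst p) (snd p))"
      unfolding fx_def
      by (intro continuous_intros continuous_on_compose2[OF smooth_continuous[of "pd _ K" UNIV]]
            continuous_on_compose2[OF f(1)] smooth_pd K) auto
    then show "continuous_on (UNIV \<times> cbox (-a) a) (\<lambda>(x, y). fx x y)" by (simp add: split_beta)
  qed auto
  then have D: "(conv K f has_derivative integral (cbox (-a) a) (fx x)) (at x)"
    unfolding conv_def[abs_def] eq[OF smooth_continuous[OF K]] .
  then show "conv K f differentiable (at x)" by (auto simp: differentiable_def)
  have cfx: "continuous_on (cbox (-a) a) (fx x)"
    unfolding fx_def
    by (intro continuous_intros continuous_on_compose2[OF smooth_continuous[of "pd _ K" UNIV]]
            continuous_on_compose2[OF f(1)] smooth_pd K) auto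
  have "pd j (conv K f) x = blinfun_apply (integral (cbox (-a) a) (fx x)) (axis j 1)"
    by (rule partial_derivI[OF D])
  also have "\<dots> = integral (cbox (-a) a) (\<lambda>y. blinfun_apply (fx x y) (axis j 1))"
    using integral_linear[OF integrable_continuous[OF cfx] blinfun.bounded_linear_left, of "axis j 1"]
    by (simp add: o_def)
  also have "\<dots> = conv (pd j K) f x"
    unfolding conv_def by (subst eq) (auto intro: smooth_continuous smooth_pd K simp: fx_apply sum_axis)
  finally show "pd j (conv K f) x = conv (pd j K) f x" .
qed

lemma partial_deriv_conv:
  fixes K :: "real^'n::finite \<Rightarrow> real"
  assumes "smooth K" "continuous_on UNIV f" "supported r f"
  shows "pd j (conv K f) = conv (pd j K) f"
  using conv_has_derivative(2)[OF assms] by blast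

text \<open>Every derivative falls on the kernel, so the induction runs over all smooth
  \<open>K\<close> while \<open>f\<close> stays fixed and is only continuous.\<close>

lemma smooth_conv:
  fixes K :: "real^'n::finite \<Rightarrow> real"
  assumes "smooth K" "continuous_on UNIV f" "supported r f"
  shows "smooth (conv K f)"
proof -
  have "smooth K \<Longrightarrow> C_k k (conv K f)" for k
  proof (induction k arbitrary: K)
    case 0
    have "conv K f differentiable_on UNIV"
      using conv_has_derivative(1)[OF 0 assms(2,3)] by (simp add: differentiable_on_def)
    then show ?case by (simp add: differentiable_imp_continuous_on)
  next
    case (Suc k)
    then show ?case using conv_has_derivative(1)[OF Suc.prems assms(2,3)]
      by (auto simp: partial_deriv_conv[OF Suc.prems assms(2,3)] differentiable_on_def)
  qed
  with assms show ?thesis by (simp add: smooth_def)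
qed

lemma conv_partial_deriv:
  fixes K :: "real^'n::finite \<Rightarrow> real"
  assumes K: "smooth K" and f: "smooth f" "supported r f"
  shows "conv (pd j K) f = conv K (pd j f)"
proof
  fix x
  have "(LBINT y. pd j (\<lambda>y. K (x - y)) y * f y) = - (LBINT y. K (x - y) * pd j f y)"
    by (rule integral_by_parts[OF smooth_shift[OF K] f])
  then show "conv (pd j K) f x = conv K (pd j f) x"
    by (simp add: conv_def pd_shift[OF K])
qed

lemma partial_deriv_conv2:
  fixes K :: "real^'n::finite \<Rightarrow> real"
  assumes "smooth K" "smooth f" "supported r f"
  shows "pd j (conv K f) = conv K (pd j f)"
  using partial_deriv_conv[OF assms(1) smooth_continuous[OF assms(2)] assms(3)] conv_partial_deriv[OF assms] by simp

lemma conv_sum_kernel: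
  assumes "\<And>i. i \<in> I \<Longrightarrow> continuous_on UNIV (K i)" "continuous_on UNIV f" "supported r f"
  shows "conv (\<lambda>z. \<Sum>i\<in>I. K i z) f x = (\<Sum>i\<in>I. conv (K i) f x)"
  unfolding conv_def sum_distrib_right
  by (rule Bochner_Integration.integral_sum) (use assms in \<open>auto intro: integrable_conv\<close>)

lemma conv_sum:
  assumes "\<And>i. i \<in> I \<Longrightarrow> continuous_on UNIV (f i)" "\<And>i. i \<in> I \<Longrightarrow> supported r (f i)" "continuous_on UNIV K"
  shows "conv K (\<lambda>z. \<Sum>i\<in>I. f i z) x = (\<Sum>i\<in>I. conv K (f i) x)"
  unfolding conv_def sum_distrib_left
  by (rule Bochner_Integration.integral_sum) (use assms in \<open>auto intro: integrable_conv\<close>)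

text \<open>\<open>rk e\<close> regularizes \<open>1 / \<bar>z\<bar>\<close>. In dimension three its Laplacian is an approximate identity up to the sign and
  the factor \<open>kap\<close>; the value \<open>kap = 4 \<pi>\<close> is never needed.\<close>

definition rk :: "real \<Rightarrow> real^'n::finite \<Rightarrow> real" where
  "rk e z = inverse (sqrt ((norm z)\<^sup>2 + e\<^sup>2))"

lemma rk_pos: "e > 0 \<Longrightarrow> rk e z > 0"
  by (simp add: rk_def add_nonneg_pos)

lemma rk_sq: "e > 0 \<Longrightarrow> (rk e z)\<^sup>2 * ((norm z)\<^sup>2 + e\<^sup>2) = 1"
proof -
  assume "e > 0"
  then have "(norm z)\<^sup>2 + e\<^sup>2 > 0" by (simp add: add_nonneg_pos)
  then have "inverse ((norm z)\<^sup>2 + e\<^sup>2) * ((norm z)\<^sup>2 + e\<^sup>2) = 1" by (intro left_inverse) linarith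
  then show ?thesis by (simp add: rk_def power_inverse)
qed

lemma rk_has_derivative:
  assumes "e > 0"
  shows "(rk e has_derivative (\<lambda>h. - ((z \<bullet> h) * rk e z ^ 3))) (at z)"
proof -
  have pos: "z \<bullet> z + e\<^sup>2 > 0" using assms by (simp add: add_nonneg_pos)
  have "((\<lambda>z. inverse (sqrt (z \<bullet> z + e\<^sup>2))) has_derivative
     (\<lambda>h. - (inverse (sqrt (z \<bullet> z + e\<^sup>2)) * ((z \<bullet> h + h \<bullet> z) * (inverse (sqrt (z \<bullet> z + e\<^sup>2)) / 2)) * inverse (sqrt (z \<bullet> z + e\<^sup>2))))) (at z)"
    using pos by (auto intro!: derivative_eq_intros simp: field_simps)
  then show ?thesis
    by (simp add: rk_def[abs_def] power2_norm_eq_inner inner_commute power3_eq_cube mult_ac)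
qed

lemma partial_deriv_rk: "e > 0 \<Longrightarrow> pd j (rk e) = (\<lambda>z. - (z $ j * rk e z ^ 3))"
  using partial_derivI[OF rk_has_derivative] by (fastforce simp: inner_axis)

text \<open>The partial derivatives of \<open>rk e\<close> are polynomials in the coordinates and in
  \<open>rk e\<close> itself, so \<open>C_k k\<close> of \<open>rk e\<close> bootstraps to the next
  order.\<close>

lemma smooth_rk:
  assumes "e > 0" shows "smooth (rk e :: real^'n::finite \<Rightarrow> real)"
proof -
  have d: "(rk e :: real^'n \<Rightarrow> real) differentiable_on UNIV"
    using rk_has_derivative[OF assms] by (auto simp: differentiable_on_def differentiable_def)
  have "C_k k (rk e :: real^'n \<Rightarrow> real)" for k
  proof (induction k)
    case 0 show ?case by (simp add: differentiable_imp_continuous_on[OF d])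
  next
    case (Suc k)
    have "C_k k (\<lambda>z::real^'n. (- 1 * z $ j) * (rk e z * rk e z * rk e z))" for j
      by (intro C_k_mult C_k_const C_k_component Suc.IH)
    then show ?case using d by (simp add: partial_deriv_rk[OF assms] power3_eq_cube)
  qed
  then show ?thesis by (simp add: smooth_def)
qed

lemma pd_power: "smooth f \<Longrightarrow> pd j (\<lambda>x. f x ^ n) = (\<lambda>x. real n * f x ^ (n - 1) * pd j f x)"
  by (rule partial_deriv_chain) (auto intro!: derivative_eq_intros smooth_differentiable)

lemma partial_deriv2_rk:
  assumes "e > 0"
  shows "pd k (pd j (rk e)) =
    (\<lambda>z. - ((if j = k then 1 else 0) * rk e z ^ 3) + 3 * (z $ j * z $ k * rk e z ^ 5))"
proof -
  have s: "smooth (\<lambda>z. rk e z ^ 3)" using smooth_rk[OF assms] by (rule smooth_power)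
  have "pd k (\<lambda>z. - (z $ j * rk e z ^ 3)) =
     (\<lambda>z. - ((if j = k then 1 else 0) * rk e z ^ 3 + z $ j * (real 3 * rk e z ^ (3 - 1) * (- (z $ k * rk e z ^ 3)))))"
    by (simp only: pd_minus[OF smooth_mult[OF smooth_component s]] pd_mult[OF smooth_component s]
         partial_deriv_component pd_power[OF smooth_rk[OF assms]] partial_deriv_rk[OF assms])
  then show ?thesis unfolding partial_deriv_rk[OF assms]
    by (simp add: fun_eq_iff algebra_simps flip: power_add)
qed

lemma partial_deriv3_rk:
  assumes "e > 0"
  shows "pd l (pd k (pd j (rk e))) =
    (\<lambda>z. 3 * (((if j = k then 1 else 0) * z $ l + (if j = l then 1 else 0) * z $ k + (if k = l then 1 else 0) * z $ j) * rk e z ^ 5)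
        - 15 * (z $ j * z $ k * z $ l * rk e z ^ 7))"
proof -
  have s: "smooth (\<lambda>z. rk e z ^ n)" for n using smooth_rk[OF assms] by (rule smooth_power)
  have "pd l (\<lambda>z. - ((if j = k then 1 else 0) * rk e z ^ 3) + 3 * (z $ j * z $ k * rk e z ^ 5)) =
     (\<lambda>z. - ((if j = k then 1 else 0) * (real 3 * rk e z ^ (3 - 1) * (- (z $ l * rk e z ^ 3))))
       + 3 * (((if j = l then 1 else 0) * z $ k + z $ j * (if k = l then 1 else 0)) * rk e z ^ 5
         + z $ j * z $ k * (real 5 * rk e z ^ (5 - 1) * (- (z $ l * rk e z ^ 3)))))"
  proof -
    have s1: "smooth (\<lambda>z. (if j = k then 1 else 0) * rk e z ^ 3)" by (intro smooth_mult smooth_const s)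
    have s2: "smooth (\<lambda>z::real^'a. z $ j * z $ k)" by (intro smooth_mult smooth_component)
    have s3: "smooth (\<lambda>z. z $ j * z $ k * rk e z ^ 5)" by (intro smooth_mult smooth_component s)
    show ?thesis
      by (simp only: pd_add[OF smooth_minus[OF s1] smooth_mult[OF smooth_const s3]] pd_minus[OF s1]
           pd_cmult[OF s] pd_cmult[OF s3] pd_mult[OF s2 s] pd_mult[OF smooth_component smooth_component]
           partial_deriv_component pd_power[OF smooth_rk[OF assms]] partial_deriv_rk[OF assms])
  qed
  then show ?thesis unfolding partial_deriv2_rk[OF assms]
    by (simp add: fun_eq_iff algebra_simps flip: power_add)
qed

text \<open>With r = \<open>rk e z\<close>, taking the trace gives -3 r^3 + 3 |z|^2 r^5, where the
  first 3 is the dimension. Inserting 1 = r^2 (|z|^2 + e^2) into the first term cancels everything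
  except a multiple of e^2: the regularized form of the harmonicity of 1/|z|.\<close>

lemma laplacian_rk:
  fixes z :: "real^3"
  assumes "e > 0"
  shows "lap (rk e) z = - (3 * e\<^sup>2 * rk e z ^ 5)"
proof -
  have "lap (rk e) z
     = - 3 * rk e z ^ 3 + 3 * (norm z)\<^sup>2 * rk e z ^ 5"
    unfolding norm_sq_sum sum_3 by (simp add: partial_deriv2_rk[OF assms] power2_eq_square algebra_simps)
  also have "rk e z ^ 3 = rk e z ^ 3 * ((rk e z)\<^sup>2 * ((norm z)\<^sup>2 + e\<^sup>2))"
    by (simp only: rk_sq[OF assms] mult_1_right)
  also have "- 3 * \<dots> + 3 * (norm z)\<^sup>2 * rk e z ^ 5 = - (3 * e\<^sup>2 * rk e z ^ 5)"
    by (simp add: algebra_simps flip: power_add)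
  finally show ?thesis .
qed

text \<open>The bounds are uniform in \<open>e\<close>, so they survive the limit. For |z| at least
  1, both r and the products \<open>c i\<close> = z_i r are at most 1 in modulus and every
  derivative is a polynomial in them; the third derivatives have the largest sum of coefficients, 3
  + 3 + 3 + 15 = 24.\<close>

lemma rk_derivative_bounds:
  assumes e: "e > 0" and z: "norm z \<ge> 1"
  shows "\<bar>pd j (rk e) z\<bar> \<le> 24" "\<bar>pd k (pd j (rk e)) z\<bar> \<le> 24"
    "\<bar>pd l (pd k (pd j (rk e))) z\<bar> \<le> 24"
proof -
  define r where "r = rk e z"
  have r0: "r \<ge> 0" unfolding r_def by (rule less_imp_le[OF rk_pos[OF e]])
  have rn: "r * norm z \<le> 1"
  proof -
    have "(r * norm z)\<^sup>2 \<le> r\<^sup>2 * ((norm z)\<^sup>2 + e\<^sup>2)" by (simp add: power_mult_distrib mult_left_mono)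
    also have "\<dots> = 1\<^sup>2" using rk_sq[OF e, of z] by (simp add: r_def)
    finally show ?thesis by (rule power2_le_imp_le) simp
  qed
  have r1: "r \<le> 1" using mult_left_mono[OF z r0] rn by simp
  define c where "c i = z $ i * r" for i
  have c: "\<bar>c i\<bar> \<le> 1" for i
  proof -
    have "\<bar>c i\<bar> = \<bar>z $ i\<bar> * r" using r0 by (simp add: c_def abs_mult)
    also have "\<dots> \<le> norm z * r" using r0 by (intro mult_right_mono component_le_norm_cart)
    finally show ?thesis using rn by (simp add: mult.commute)
  qed
  have p: "\<bar>r ^ n\<bar> \<le> 1" for n using r0 r1 by (simp add: power_le_one abs_of_nonneg)
  have m: "\<bar>a * b\<bar> \<le> 1" if "\<bar>a\<bar> \<le> 1" "\<bar>b\<bar> \<le> 1" for a b :: real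
    using mult_mono[OF that] by (simp add: abs_mult)
  have d: "\<bar>if P then 1 else 0 :: real\<bar> \<le> 1" for P by simp
  have "pd j (rk e) z = - (c j * r ^ 2)"
    by (simp add: partial_deriv_rk[OF e] c_def r_def power_numeral_reduce)
  moreover have "\<bar>c j * r ^ 2\<bar> \<le> 1" by (intro m c p)
  ultimately show "\<bar>pd j (rk e) z\<bar> \<le> 24" by simp
  have "pd k (pd j (rk e)) z = - ((if j = k then 1 else 0) * r ^ 3) + 3 * (c j * c k * r ^ 3)"
    by (simp add: partial_deriv2_rk[OF e] c_def r_def power_numeral_reduce mult_ac)
  moreover have "\<bar>(if j = k then 1 else 0) * r ^ 3\<bar> \<le> 1" "\<bar>c j * c k * r ^ 3\<bar> \<le> 1" by (intro m c p d)+
  ultimately show "\<bar>pd k (pd j (rk e)) z\<bar> \<le> 24" by linarith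
  have "pd l (pd k (pd j (rk e))) z =
    3 * ((if j = k then 1 else 0) * (c l * r ^ 4)) + 3 * ((if j = l then 1 else 0) * (c k * r ^ 4))
      + 3 * ((if k = l then 1 else 0) * (c j * r ^ 4)) - 15 * (c j * c k * (c l * r ^ 4))"
    by (simp add: partial_deriv3_rk[OF e] c_def r_def power_numeral_reduce algebra_simps)
  moreover have "\<bar>(if j = k then 1 else 0) * (c l * r ^ 4)\<bar> \<le> 1" "\<bar>(if j = l then 1 else 0) * (c k * r ^ 4)\<bar> \<le> 1"
    "\<bar>(if k = l then 1 else 0) * (c j * r ^ 4)\<bar> \<le> 1" "\<bar>c j * c k * (c l * r ^ 4)\<bar> \<le> 1" by (intro m c p d)+
  ultimately show "\<bar>pd l (pd k (pd j (rk e))) z\<bar> \<le> 24" by linarith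
qed

text \<open>A dyadic cover: a point whose first enclosing dyadic ball has radius 2^(k+1) carries a
  value of at most 32^(-k), while the volume of that ball grows like 8^k, which leaves a geometric
  series with ratio 1/4. Whole balls instead of shells spare the disjointness and only enlarge the
  sum.\<close>

lemma integrable_rk_power5: "integrable lborel (\<lambda>z::real^3. rk 1 z ^ 5)"
proof -
  have [measurable]: "rk 1 \<in> borel_measurable (borel :: (real^3) measure)"
    by (rule smooth_measurable[OF smooth_rk]) simp
  define a where "a k = ennreal ((1/32) ^ k)" for k :: nat
  define V where "V = unit_ball_vol 3"
  have V: "V \<ge> 0" by (simp add: V_def)
  have le: "ennreal (rk 1 z ^ 5) \<le> (\<Sum>k. a k * indicator (ball 0 (2 ^ Suc k)) z)" for z :: "real^3"
  proof -
    have "\<exists>k. norm z < 2 ^ Suc k \<and> rk 1 z ^ 5 \<le> (1/32) ^ k"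
    proof (cases "norm z < 2")
      case True
      have "(rk 1 z)\<^sup>2 * ((norm z)\<^sup>2 + 1) = 1" using rk_sq[of 1 z] by simp
      then have "(rk 1 z)\<^sup>2 \<le> 1\<^sup>2" by (smt (verit) mult_le_cancel_left1 one_power2 zero_le_power2)
      then have "rk 1 z \<le> 1" by (rule power2_le_imp_le) simp
      then have "rk 1 z ^ 5 \<le> 1" using rk_pos[of 1 z] by (intro power_le_one) auto
      then show ?thesis using True by (intro exI[of _ 0]) auto
    next
      case False
      obtain m where m: "norm z < 2 ^ m" using real_arch_pow[of 2 "norm z"] by auto
      define k where "k = (LEAST m. norm z < 2 ^ m)"
      have k: "norm z < 2 ^ k" unfolding k_def using m by (rule LeastI)
      then have "k \<noteq> 0" using False by (intro notI) simp
      then obtain k' where k': "k = Suc k'" by (cases k) auto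
      have "\<not> norm z < 2 ^ k'" using not_less_Least[of k' "\<lambda>m. norm z < 2 ^ m"] k' by (simp add: k_def)
      then have ge: "2 ^ k' \<le> norm z" by simp
      have "(2 ^ k')\<^sup>2 \<le> (norm z)\<^sup>2" by (rule power_mono[OF ge]) simp
      then have "(2 ^ k')\<^sup>2 \<le> (norm z)\<^sup>2 + 1" by linarith
      then have "(rk 1 z * 2 ^ k')\<^sup>2 \<le> (rk 1 z)\<^sup>2 * ((norm z)\<^sup>2 + 1)"
        unfolding power_mult_distrib by (rule mult_left_mono) simp
      also have "\<dots> = 1\<^sup>2" using rk_sq[of 1 z] by simp
      finally have "rk 1 z * 2 ^ k' \<le> 1" by (rule power2_le_imp_le) simp
      then have "rk 1 z \<le> (1/2) ^ k'" by (simp add: field_simps power_divide)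
      then have "rk 1 z ^ 5 \<le> ((1/2) ^ k') ^ 5" using rk_pos[of 1 z] by (intro power_mono) auto
      also have "\<dots> = (1/32) ^ k'"
        by (simp add: power_mult[symmetric] mult.commute[of k'] power_mult power_divide)
      finally show ?thesis using k k' by auto
    qed
    then obtain k where k: "norm z < 2 ^ Suc k" "rk 1 z ^ 5 \<le> (1/32) ^ k" by auto
    have "ennreal (rk 1 z ^ 5) \<le> a k * indicator (ball 0 (2 ^ Suc k)) z"
      using k by (simp add: a_def)
    also have "F k \<le> suminf F" if "\<And>i. F i \<ge> 0" for F :: "nat \<Rightarrow> ennreal"
      using sum_le_suminf[of F "{k}"] by simp
    then have "a k * indicator (ball 0 (2 ^ Suc k)) z \<le> (\<Sum>k. a k * indicator (ball 0 (2 ^ Suc k)) z)"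
      by (rule meta_mp) auto
    finally show ?thesis .
  qed
  have "(\<integral>\<^sup>+z. ennreal (rk 1 z ^ 5) \<partial>(lborel :: (real^3) measure)) \<le> (\<integral>\<^sup>+z. (\<Sum>k. a k * indicator (ball 0 (2 ^ Suc k)) z) \<partial>(lborel :: (real^3) measure))"
    by (intro nn_integral_mono le)
  also have "\<dots> = (\<Sum>k. \<integral>\<^sup>+z. a k * indicator (ball 0 (2 ^ Suc k)) z \<partial>(lborel :: (real^3) measure))"
    by (intro nn_integral_suminf borel_measurable_times_ennreal borel_measurable_indicator borel_measurable_const) auto
  also have "\<dots> = (\<Sum>k. ennreal (8 * V * (1/4) ^ k))"
  proof (rule suminf_cong)
    fix k
    have "(\<integral>\<^sup>+z. a k * indicator (ball 0 (2 ^ Suc k)) z \<partial>(lborel :: (real^3) measure)) = a k * emeasure lborel (ball (0::real^3) (2 ^ Suc k))"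
      by (subst nn_integral_cmult_indicator) auto
    also have "emeasure lborel (ball (0::real^3) (2 ^ Suc k)) = ennreal (V * (2 ^ Suc k) ^ 3)"
      by (subst emeasure_ball) (auto simp: V_def)
    also have "a k * \<dots> = ennreal ((1/32) ^ k * (V * (2 ^ Suc k) ^ 3))"
      unfolding a_def using V by (subst ennreal_mult) auto
    also have "(1/32) ^ k * (V * (2 ^ Suc k) ^ 3) = 8 * V * ((1/32) ^ k * (2 ^ k) ^ 3)"
      by (simp add: power_mult_distrib)
    also have "(1/32) ^ k * (2 ^ k) ^ 3 = ((1/4) ^ k :: real)"
      by (simp add: power_mult[symmetric] mult.commute[of k] power_mult power_mult_distrib[symmetric])
    finally show "(\<integral>\<^sup>+z. a k * indicator (ball 0 (2 ^ Suc k)) z \<partial>(lborel :: (real^3) measure)) = ennreal (8 * V * (1/4) ^ k)" .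
  qed
  also have "\<dots> = ennreal (\<Sum>k. 8 * V * (1/4) ^ k)"
    using V by (intro suminf_ennreal2 summable_mult summable_geometric) auto
  also have "\<dots> < \<infinity>" by simp
  finally have "(\<integral>\<^sup>+z. ennreal (norm (rk 1 z ^ 5)) \<partial>(lborel :: (real^3) measure)) < \<infinity>"
    by (simp only: real_norm_def abs_of_pos[OF zero_less_power[OF rk_pos[OF zero_less_one]]])
  then show ?thesis by (intro integrableI_bounded) auto
qed

lemma rk_scale: "e > 0 \<Longrightarrow> rk e (e *\<^sub>R z) = rk 1 z / e"
proof -
  assume e: "e > 0"
  have "(norm (e *\<^sub>R z))\<^sup>2 + e\<^sup>2 = e\<^sup>2 * ((norm z)\<^sup>2 + 1)" by (simp add: power_mult_distrib algebra_simps)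
  then have "rk e (e *\<^sub>R z) = inverse (sqrt (e\<^sup>2 * ((norm z)\<^sup>2 + 1)))" by (simp only: rk_def)
  then show ?thesis using e by (simp add: rk_def real_sqrt_mult divide_inverse mult.commute)
qed

definition kap :: real where "kap = (\<integral>z. 3 * rk 1 z ^ 5 \<partial>(lborel :: (real^3) measure))"

lemma kap_pos: "kap > 0"
proof -
  have c: "continuous_on UNIV (\<lambda>z::real^3. rk 1 z ^ 5)"
    by (intro smooth_continuous smooth_power smooth_rk) simp
  have i: "integrable lborel (\<lambda>z::real^3. indicator (cball 0 1) z * rk 1 z ^ 5)"
    by (rule integrable_indicator_cball[OF c])
  have "0 \<le> (\<integral>z. rk 1 z ^ 5 \<partial>(lborel :: (real^3) measure))"
    using rk_pos[of 1] by (intro integral_nonneg_AE) (auto intro: less_imp_le)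
  moreover have "(\<integral>z. rk 1 z ^ 5 \<partial>(lborel :: (real^3) measure)) \<noteq> 0"
  proof
    assume "(\<integral>z. rk 1 z ^ 5 \<partial>(lborel :: (real^3) measure)) = 0"
    then have "AE z in (lborel :: (real^3) measure). rk 1 z ^ 5 = 0"
      using integral_nonneg_eq_0_iff_AE[OF integrable_rk_power5] rk_pos[of 1] by (auto intro: less_imp_le)
    then have "AE z in (lborel :: (real^3) measure). False"
      by (rule AE_mp) (use rk_pos[of 1] in \<open>auto intro!: AE_I2 simp: less_le\<close>)
    then have "emeasure (lborel :: (real^3) measure) UNIV = 0"
      by (simp add: AE_iff_null null_sets_def)
    then show False by simp
  qed
  ultimately show ?thesis unfolding kap_def by simp
qed

text \<open>Sign and factor are chosen so that the Laplacian is \<open>bump e\<close>, a positive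
  density of total mass one concentrating at the origin as \<open>e\<close> tends to 0. Neither
  kernel has compact support; compact support of the test fields comes back only through the cutoff
  \<open>chi\<close>.\<close>

definition newton :: "real \<Rightarrow> real^3 \<Rightarrow> real" where
  "newton e z = - (1 / kap) * rk e z"

definition bump :: "real \<Rightarrow> real^3 \<Rightarrow> real" where
  "bump e z = (3 / kap) * e\<^sup>2 * rk e z ^ 5"

lemma smooth_newton: "e > 0 \<Longrightarrow> smooth (newton e)"
  unfolding newton_def[abs_def] by (intro smooth_mult smooth_const smooth_rk)

lemma smooth_bump: "e > 0 \<Longrightarrow> smooth (bump e)"
  unfolding bump_def[abs_def] by (intro smooth_mult smooth_const smooth_power smooth_rk)

lemma laplacian_newton:
  assumes "e > 0"
  shows "lap (newton e) z = bump e z"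
proof -
  have "pd j (pd j (newton e)) = (\<lambda>z. - (1/kap) * pd j (pd j (rk e)) z)" for j
    unfolding newton_def[abs_def]
    by (simp only: pd_cmult[OF smooth_rk[OF assms]] pd_cmult[OF smooth_pd[OF smooth_rk[OF assms]]])
  then show ?thesis
    using laplacian_rk[OF assms, of z] by (simp add: bump_def sum_distrib_left[symmetric] sum_negf sum_divide_distrib[symmetric])
qed

lemma laplacian_conv_newton:
  assumes "e > 0" "continuous_on UNIV f" "supported r f"
  shows "lap (conv (newton e) f) x = conv (bump e) f x"
proof -
  note s = smooth_newton[OF assms(1)]
  have "lap (conv (newton e) f) x
    = (\<Sum>j\<in>UNIV. conv (pd j (pd j (newton e))) f x)"
    using s assms by (simp add: partial_deriv_conv[of _ f r] smooth_pd)
  also have "\<dots> = conv (\<lambda>z. \<Sum>j\<in>UNIV. pd j (pd j (newton e)) z) f x"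
    by (rule conv_sum_kernel[symmetric, OF _ assms(2,3)]) (use s in \<open>auto intro!: smooth_continuous\<close>)
  finally show ?thesis by (simp add: laplacian_newton[OF assms(1)])
qed

lemma newton_derivative_bounds:
  assumes e: "e > 0" and z: "norm z \<ge> 1"
  shows "\<bar>pd j (newton e) z\<bar> \<le> 24 / kap" "\<bar>pd k (pd j (newton e)) z\<bar> \<le> 24 / kap"
    "\<bar>pd l (pd k (pd j (newton e))) z\<bar> \<le> 24 / kap"
proof -
  have eq: "pd j (newton e) = (\<lambda>z. - (1/kap) * pd j (rk e) z)"
    "pd k (pd j (newton e)) = (\<lambda>z. - (1/kap) * pd k (pd j (rk e)) z)"
    "pd l (pd k (pd j (newton e))) = (\<lambda>z. - (1/kap) * pd l (pd k (pd j (rk e))) z)"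
    unfolding newton_def[abs_def]
    by (simp_all only: pd_cmult[OF smooth_rk[OF e]] pd_cmult[OF smooth_pd[OF smooth_rk[OF e]]]
        pd_cmult[OF smooth_pd[OF smooth_pd[OF smooth_rk[OF e]]]])
  have *: "\<bar>- (1/kap) * t\<bar> \<le> 24 / kap" if "\<bar>t\<bar> \<le> 24" for t
    using that kap_pos by (simp add: abs_mult divide_right_mono)
  show "\<bar>pd j (newton e) z\<bar> \<le> 24 / kap"
    unfolding eq(1) by (intro * rk_derivative_bounds[OF e z])
  show "\<bar>pd k (pd j (newton e)) z\<bar> \<le> 24 / kap"
    unfolding eq(2) by (intro * rk_derivative_bounds[OF e z])
  show "\<bar>pd l (pd k (pd j (newton e))) z\<bar> \<le> 24 / kap"
    unfolding eq(3) by (intro * rk_derivative_bounds[OF e z])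
qed

lemma conv_bound_far:
  fixes K :: "'a::euclidean_space \<Rightarrow> real"
  assumes K: "continuous_on UNIV K" "\<And>z. norm z \<ge> d \<Longrightarrow> \<bar>K z\<bar> \<le> B"
    and f: "continuous_on UNIV f" "supported r f" and x: "norm x \<ge> r + d"
  shows "\<bar>conv K f x\<bar> \<le> B * (LBINT y. \<bar>f y\<bar>)"
proof -
  have i: "integrable lborel (\<lambda>y. \<bar>f y\<bar>)" using integrable_supported[OF f] by simp
  have "\<bar>conv K f x\<bar> \<le> (LBINT y. \<bar>K (x - y) * f y\<bar>)"
    unfolding conv_def by (rule integral_abs_bound)
  also have "\<dots> \<le> (LBINT y. B * \<bar>f y\<bar>)"
  proof (intro integral_mono integrable_mult_right i)
    show "integrable lborel (\<lambda>y. \<bar>K (x - y) * f y\<bar>)" using integrable_conv[OF K(1) f] by simp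
    show "\<bar>K (x - y) * f y\<bar> \<le> B * \<bar>f y\<bar>" for y
    proof (cases "norm y \<le> r")
      case True
      have "norm x \<le> norm (x - y) + norm y" by (metis diff_add_cancel norm_triangle_ineq)
      then have "norm (x - y) \<ge> d" using True x by linarith
      then show ?thesis using K(2) by (simp add: abs_mult mult_right_mono)
    next
      case False then show ?thesis using f(2) by (simp add: supported_def)
    qed
  qed
  finally show ?thesis by simp
qed

text \<open>The substitution y = x - e w moves \<open>e\<close> from the kernel into the argument of
  \<open>h\<close>. What remains is one fixed probability density, which gives the supremum bound at
  once and serves as the dominating function when \<open>e\<close> tends to 0.\<close>

lemma conv_bump_eq:
  assumes e: "e > 0" and h: "continuous_on UNIV h"
  shows "conv (bump e) h x = (LBINT w. (3 / kap) * rk 1 w ^ 5 * h (x - e *\<^sub>R w))"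
proof -
  have [measurable]: "h \<in> borel_measurable borel" "bump e \<in> borel_measurable borel"
    using borel_measurable_continuous_onI[OF h] smooth_measurable[OF smooth_bump[OF e]] by auto
  have "conv (bump e) h x = \<bar>- e\<bar> ^ DIM(real^3) * (LBINT w. bump e (x - (x + (- e) *\<^sub>R w)) * h (x + (- e) *\<^sub>R w))"
    unfolding conv_def using e by (intro integral_affine) auto
  also have "\<dots> = (LBINT w. e ^ 3 * (bump e (e *\<^sub>R w) * h (x - e *\<^sub>R w)))"
    using e by simp
  also have "\<dots> = (LBINT w. (3 / kap) * rk 1 w ^ 5 * h (x - e *\<^sub>R w))"
    using e by (intro Bochner_Integration.integral_cong refl) (simp add: bump_def rk_scale field_simps power_numeral_reduce)
  finally show ?thesis .
qed

lemma integral_bump1: "(\<integral>w. (3 / kap) * rk 1 w ^ 5 \<partial>(lborel :: (real^3) measure)) = 1"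
  using kap_pos by (simp add: kap_def)

lemma bump_weight_bound:
  assumes "\<bar>t\<bar> \<le> B"
  shows "\<bar>(3 / kap) * rk 1 w ^ 5 * t\<bar> \<le> (3 / kap) * rk 1 w ^ 5 * B"
proof -
  have "0 \<le> (3 / kap) * rk 1 w ^ 5"
    by (intro mult_nonneg_nonneg zero_le_power less_imp_le[OF rk_pos] divide_nonneg_pos kap_pos) auto
  then show ?thesis using assms by (simp only: abs_mult[of _ t] abs_of_nonneg mult_left_mono)
qed

lemma conv_bump_bound:
  assumes e: "e > 0" and h: "continuous_on UNIV h" "\<And>x. \<bar>h x\<bar> \<le> B"
  shows "\<bar>conv (bump e) h x\<bar> \<le> B"
proof -
  have [measurable]: "h \<in> borel_measurable borel" "rk 1 \<in> borel_measurable (borel :: (real^3) measure)"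
    using borel_measurable_continuous_onI[OF h(1)] smooth_measurable[OF smooth_rk[OF zero_less_one]] by auto
  have i: "integrable lborel (\<lambda>w::real^3. (3 / kap) * rk 1 w ^ 5 * B)"
    by (intro integrable_mult_left integrable_mult_right integrable_rk_power5)
  have b: "\<bar>(3 / kap) * rk 1 w ^ 5 * h (x - e *\<^sub>R w)\<bar> \<le> (3 / kap) * rk 1 w ^ 5 * B" for w by (intro bump_weight_bound h(2))
  have i2: "integrable lborel (\<lambda>w. (3 / kap) * rk 1 w ^ 5 * h (x - e *\<^sub>R w))"
  proof (rule Bochner_Integration.integrable_bound[OF i])
    show "AE w in lborel. norm ((3 / kap) * rk 1 w ^ 5 * h (x - e *\<^sub>R w)) \<le> norm ((3 / kap) * rk 1 w ^ 5 * B)"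
      unfolding real_norm_def by (rule AE_I2, rule order_trans[OF b abs_ge_self])
  qed auto
  have "\<bar>conv (bump e) h x\<bar> \<le> (LBINT w. \<bar>(3 / kap) * rk 1 w ^ 5 * h (x - e *\<^sub>R w)\<bar>)"
    unfolding conv_bump_eq[OF e h(1)] by (rule integral_abs_bound)
  also have "\<dots> \<le> (\<integral>w. (3 / kap) * rk 1 w ^ 5 * B \<partial>(lborel :: (real^3) measure))"
    by (intro integral_mono i integrable_abs i2 b)
  also have "\<dots> = (\<integral>w. (3 / kap) * rk 1 w ^ 5 \<partial>(lborel :: (real^3) measure)) * B"
    by (rule integral_mult_left_zero)
  also have "\<dots> = B" by (simp only: integral_bump1 mult_1)
  finally show ?thesis .
qed

lemma conv_bump_tendsto:
  assumes h: "continuous_on UNIV h" "\<And>x. \<bar>h x\<bar> \<le> B"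
    and e: "\<And>n. e n > 0" "e \<longlonglongrightarrow> 0"
  shows "(\<lambda>n. conv (bump (e n)) h x) \<longlonglongrightarrow> h x"
proof -
  have [measurable]: "h \<in> borel_measurable borel" "rk 1 \<in> borel_measurable (borel :: (real^3) measure)"
    using borel_measurable_continuous_onI[OF h(1)] smooth_measurable[OF smooth_rk[OF zero_less_one]] by auto
  have "(\<lambda>n. LBINT w. (3 / kap) * rk 1 w ^ 5 * h (x - e n *\<^sub>R w)) \<longlonglongrightarrow> (\<integral>w. (3 / kap) * rk 1 w ^ 5 * h x \<partial>(lborel :: (real^3) measure))"
  proof (rule integral_dominated_convergence[where w="\<lambda>w. (3 / kap) * rk 1 w ^ 5 * B"])
    show "integrable lborel (\<lambda>w::real^3. (3 / kap) * rk 1 w ^ 5 * B)"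
      by (intro integrable_mult_left integrable_mult_right integrable_rk_power5)
    have "(\<lambda>n. h (x - e n *\<^sub>R w)) \<longlonglongrightarrow> h x" for w
    proof (rule isCont_tendsto_compose[of x h])
      show "isCont h x" using h(1) by (simp add: continuous_on_eq_continuous_at)
      have "(\<lambda>n. x - e n *\<^sub>R w) \<longlonglongrightarrow> x - 0 *\<^sub>R w" by (intro tendsto_intros e)
      then show "(\<lambda>n. x - e n *\<^sub>R w) \<longlonglongrightarrow> x" by simp
    qed
    then show "AE w in lborel. (\<lambda>n. (3 / kap) * rk 1 w ^ 5 * h (x - e n *\<^sub>R w)) \<longlonglongrightarrow> (3 / kap) * rk 1 w ^ 5 * h x"
      by (intro AE_I2 tendsto_intros)
    show "AE w in lborel. norm ((3 / kap) * rk 1 w ^ 5 * h (x - e n *\<^sub>R w)) \<le> (3 / kap) * rk 1 w ^ 5 * B" for n unfolding real_norm_def by (intro AE_I2 bump_weight_bound h(2))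
  qed auto
  also have "(\<integral>w. (3 / kap) * rk 1 w ^ 5 * h x \<partial>(lborel :: (real^3) measure)) = (\<integral>w. (3 / kap) * rk 1 w ^ 5 \<partial>(lborel :: (real^3) measure)) * h x"
    by (rule integral_mult_left_zero)
  also have "\<dots> = h x" by (simp only: integral_bump1 mult_1)
  finally show ?thesis unfolding conv_bump_eq[OF e(1) h(1)] .
qed

section \<open>Integrals over balls centred at the origin\<close>

definition bint :: "real \<Rightarrow> ('a::euclidean_space \<Rightarrow> real) \<Rightarrow> real" where
  "bint r f = (LBINT x. indicator (cball 0 r) x * f x)"

lemma bint_mono:
  assumes "continuous_on UNIV f" "continuous_on UNIV g" "\<And>x. norm x \<le> r \<Longrightarrow> f x \<le> g x"
  shows "bint r f \<le> bint r g"
  unfolding bint_def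
  by (intro integral_mono integrable_indicator_cball assms) (auto simp: indicator_def assms(3))

lemma bint_nonneg: "(\<And>x. norm x \<le> r \<Longrightarrow> 0 \<le> f x) \<Longrightarrow> 0 \<le> bint r f"
  unfolding bint_def by (intro integral_nonneg_AE AE_I2) (auto simp: indicator_def)

lemma bint_mono_radius:
  assumes "continuous_on UNIV f" "\<And>x. 0 \<le> f x" "r \<le> s"
  shows "bint r f \<le> bint s f"
  unfolding bint_def
  by (intro integral_mono integrable_indicator_cball assms) (use assms in \<open>auto simp: indicator_def\<close>)

lemma bint_add: "continuous_on UNIV f \<Longrightarrow> continuous_on UNIV g \<Longrightarrow> bint r (\<lambda>x. f x + g x) = bint r f + bint r g"
  unfolding bint_def by (simp add: distrib_left integrable_indicator_cball)

lemma bint_cmult: "bint r (\<lambda>x. c * f x) = c * bint r f"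
  unfolding bint_def by (simp add: mult.left_commute)

lemma bint_sum: "(\<And>i. i \<in> I \<Longrightarrow> continuous_on UNIV (f i)) \<Longrightarrow> bint r (\<lambda>x. \<Sum>i\<in>I. f i x) = (\<Sum>i\<in>I. bint r (f i))"
  unfolding bint_def sum_distrib_left by (intro Bochner_Integration.integral_sum integrable_indicator_cball)

lemma integral_supported_eq_bint: "supported r f \<Longrightarrow> integral\<^sup>L lborel f = bint r f"
  unfolding bint_def
  by (intro Bochner_Integration.integral_cong refl) (auto simp: indicator_def supported_def not_le)

lemma bint_const: "r \<ge> 0 \<Longrightarrow> bint r (\<lambda>x::'a::euclidean_space. c) = c * unit_ball_vol (real DIM('a)) * r ^ DIM('a)"
  unfolding bint_def by (simp add: content_cball)

text \<open>Cauchy--Schwarz against the constant 1, obtained from the nonnegativity of the variance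
  of |f| around its mean \<open>I / V\<close>.\<close>

lemma bint_abs_square:
  fixes f :: "'a::euclidean_space \<Rightarrow> real"
  assumes f: "continuous_on UNIV f" and r: "r > 0"
  shows "(bint r (\<lambda>x. \<bar>f x\<bar>))\<^sup>2 \<le> bint r (\<lambda>x::'a. 1) * bint r (\<lambda>x. (f x)\<^sup>2)"
proof -
  define V where "V = bint r (\<lambda>x::'a. 1)"
  have V: "V > 0" unfolding V_def using r by (subst bint_const) auto
  define I where "I = bint r (\<lambda>x. \<bar>f x\<bar>)"
  have "0 \<le> bint r (\<lambda>x. (\<bar>f x\<bar> - I / V)\<^sup>2)" by (rule bint_nonneg) simp
  also have "(\<lambda>x. (\<bar>f x\<bar> - I / V)\<^sup>2) = (\<lambda>x. (f x)\<^sup>2 + ((- 2 * (I / V)) * \<bar>f x\<bar> + (I / V)\<^sup>2 * 1))"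
    by (auto simp: power2_diff fun_eq_iff)
  also have "bint r \<dots> = bint r (\<lambda>x. (f x)\<^sup>2) + ((- 2 * (I / V)) * I + (I / V)\<^sup>2 * V)"
  proof -
    have "bint r (\<lambda>x. (f x)\<^sup>2 + (c * \<bar>f x\<bar> + d * 1)) = bint r (\<lambda>x. (f x)\<^sup>2) + (c * I + d * V)" for c d
      unfolding I_def V_def bint_cmult[symmetric] by (subst bint_add | intro continuous_intros f refl)+
    then show ?thesis .
  qed
  also have "(- 2 * (I / V)) * I + (I / V)\<^sup>2 * V = - (I\<^sup>2 / V)" using V by (simp add: field_simps power2_eq_square)
  finally show ?thesis using V by (simp add: field_simps I_def[symmetric] V_def[symmetric])
qed

lemma bint_bound:
  fixes f g :: "'a::euclidean_space \<Rightarrow> real"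
  assumes "continuous_on UNIV f" "continuous_on UNIV g" "supported r g" "\<And>x. \<bar>g x\<bar> \<le> B"
  shows "\<bar>LBINT x. f x * g x\<bar> \<le> B * bint r (\<lambda>x. \<bar>f x\<bar>)"
proof -
  have "\<bar>LBINT x. f x * g x\<bar> \<le> (LBINT x. \<bar>f x * g x\<bar>)" by (rule integral_abs_bound)
  also have "\<dots> = bint r (\<lambda>x. \<bar>f x * g x\<bar>)"
    by (rule integral_supported_eq_bint) (use assms(3) in \<open>auto simp: supported_def\<close>)
  also have "\<dots> \<le> bint r (\<lambda>x. B * \<bar>f x\<bar>)"
  proof (intro bint_mono continuous_intros assms(1,2))
    show "\<bar>f x * g x\<bar> \<le> B * \<bar>f x\<bar>" for x
      using mult_right_mono[OF assms(4) abs_ge_zero, of x "f x"] by (simp add: abs_mult mult.commute)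
  qed
  finally show ?thesis by (simp add: bint_cmult)
qed

lemma integral_mult_tendsto:
  fixes w h :: "'a::euclidean_space \<Rightarrow> real"
  assumes w: "continuous_on UNIV w" "supported r w"
    and H: "\<And>n. continuous_on UNIV (H n)" "\<And>n x. \<bar>H n x\<bar> \<le> B" "\<And>x. (\<lambda>n. H n x) \<longlonglongrightarrow> h x"
    and h: "continuous_on UNIV h"
  shows "(\<lambda>n. LBINT x. w x * H n x) \<longlonglongrightarrow> (LBINT x. w x * h x)"
proof (rule integral_dominated_convergence[where w="\<lambda>x. \<bar>w x\<bar> * B"])
  have [measurable]: "w \<in> borel_measurable borel" "H n \<in> borel_measurable borel" "h \<in> borel_measurable borel" for n
    using w H h by (auto intro: borel_measurable_continuous_onI)
  show "(\<lambda>x. w x * h x) \<in> borel_measurable lborel" "(\<lambda>x. w x * H n x) \<in> borel_measurable lborel" for n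
    by auto
  show "integrable lborel (\<lambda>x. \<bar>w x\<bar> * B)"
    using integrable_supported[OF w] by (intro integrable_mult_left integrable_abs)
  show "AE x in lborel. (\<lambda>n. w x * H n x) \<longlonglongrightarrow> w x * h x"
    by (intro AE_I2 tendsto_intros H)
  show "AE x in lborel. norm (w x * H n x) \<le> \<bar>w x\<bar> * B" for n
    using H(2) by (intro AE_I2) (simp add: abs_mult mult_left_mono)
qed

lemmas smooth_rules = smooth_const smooth_component smooth_add smooth_diff smooth_minus smooth_mult
  smooth_sum smooth_power smooth_pd

section \<open>Testing with solenoidal fields\<close>

text \<open>The radii separate the localized field, which lives in |x| \<le> 2, from the region 4
  \<le> |x| \<le> 8 where \<open>chi\<close> varies. The kernel bounds ask for distance 1, so they
  are available from |x| \<ge> 3 on.\<close>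

abbreviation phi :: "real^3 \<Rightarrow> real" where "phi \<equiv> cutoff 1 2"
abbreviation chi :: "real^3 \<Rightarrow> real" where "chi \<equiv> cutoff 4 8"

lemma smooth_phi: "smooth phi" and smooth_chi: "smooth chi"
  by (auto intro: smooth_cutoff)

lemma supported_phi: "supported 2 phi" and supported_chi: "supported 8 chi"
  by (auto intro: supported_cutoff)

text \<open>The components \<open>f\<close> stand for \<open>phi u\<close>. As \<open>potrot\<close> is skew-symmetric, the compactly supported field
  \<open>testf\<close> is divergence-free, so testing with it removes the pressure. As \<open>e\<close> tends to \<open>0\<close>, \<open>testf\<close> differs from
  \<open>f\<close> by the gradient of \<open>potdiv\<close>, whose derivative is controlled in \<open>L\<^sup>2\<close>, and by terms living in the
  shell \<open>4 \<le> \<bar>x\<bar> \<le> 8\<close>, far from the support of \<open>f\<close>, where the kernel is bounded.\<close>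

locale solenoidal_test =
  fixes e :: real and f :: "3 \<Rightarrow> real^3 \<Rightarrow> real"
  assumes e: "e > 0" and f: "\<And>i. smooth (f i)" and f2: "\<And>i. supported 2 (f i)"
begin

definition pot :: "3 \<Rightarrow> real^3 \<Rightarrow> real" where "pot i = conv (newton e) (f i)"
definition potdiv :: "real^3 \<Rightarrow> real" where "potdiv x = dvg pot x"
definition potrot :: "3 \<Rightarrow> 3 \<Rightarrow> real^3 \<Rightarrow> real" where
  "potrot i j x = pd j (pot i) x - pd i (pot j) x"
definition testf :: "3 \<Rightarrow> real^3 \<Rightarrow> real" where
  "testf i x = (\<Sum>j\<in>UNIV. pd j (\<lambda>x. chi x * potrot i j x) x)"
definition shellf :: "3 \<Rightarrow> real^3 \<Rightarrow> real" where
  "shellf i x = (\<Sum>j\<in>UNIV. pd j chi x * potrot i j x)"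
text \<open>Bounds all derivatives of \<open>pot\<close> of orders one to three at |x| \<ge> 3, see
  \<open>pot_bounds\<close>; 24 / \<open>kap\<close> is the kernel bound at distance 1. It does not
  depend on \<open>e\<close>.\<close>

definition mass :: real where "mass = (24 / kap) * (\<Sum>i\<in>UNIV. LBINT y. \<bar>f i y\<bar>)"

lemma smooth_pot: "smooth (pot i)"
  unfolding pot_def by (rule smooth_conv[OF smooth_newton[OF e] smooth_continuous[OF f] f2])

lemma smooth_potdiv: "smooth potdiv"
  unfolding potdiv_def[abs_def] by (intro smooth_rules smooth_pot)

lemma smooth_potrot: "smooth (potrot i j)"
  unfolding potrot_def[abs_def] by (intro smooth_rules smooth_pot)

lemma smooth_testf: "smooth (testf i)"
  unfolding testf_def[abs_def] by (intro smooth_rules smooth_potrot smooth_chi)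

lemma smooth_shellf: "smooth (shellf i)"
  unfolding shellf_def[abs_def] by (intro smooth_rules smooth_potrot smooth_chi)

lemma supported_testf: "supported 8 (testf i)"
  unfolding testf_def[abs_def]
  by (intro supported_sum supported_pd supported_mult_left supported_chi)

lemma laplacian_pot: "lap (pot i) x = conv (bump e) (f i) x"
  unfolding pot_def by (rule laplacian_conv_newton[OF e smooth_continuous[OF f] f2])

lemma testf_divergence: "dvg testf x = 0"
proof -
  define c where "c i j x = chi x * potrot i j x" for i j x
  have sc: "smooth (c i j)" for i j unfolding c_def[abs_def] by (intro smooth_rules smooth_potrot smooth_chi)
  have anti: "c i j = (\<lambda>x. - c j i x)" for i j by (simp add: c_def[abs_def] potrot_def algebra_simps)
  have "testf i = (\<lambda>x. \<Sum>j\<in>UNIV. pd j (c i j) x)" for i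
    by (simp add: testf_def[abs_def] c_def[abs_def])
  then have "pd i (testf i) = (\<lambda>x. \<Sum>j\<in>UNIV. pd i (pd j (c i j)) x)" for i
    using sc by (simp add: pd_sum smooth_pd)
  then have eq: "dvg testf x = (\<Sum>i\<in>UNIV. \<Sum>j\<in>UNIV. pd i (pd j (c i j)) x)"
    by simp
  also have "\<dots> = (\<Sum>j\<in>UNIV. \<Sum>i\<in>UNIV. pd i (pd j (c i j)) x)" by (rule sum.swap)
  also have "\<dots> = (\<Sum>j\<in>UNIV. \<Sum>i\<in>UNIV. - pd j (pd i (c j i)) x)"
  proof (intro sum.cong refl)
    fix i j
    have "pd i (pd j (c i j)) = pd j (pd i (c i j))"
      by (rule partial_deriv_commute[OF sc])
    also have "\<dots> = (\<lambda>x. - pd j (pd i (c j i)) x)"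
      by (subst anti) (simp add: pd_minus sc smooth_pd)
    finally show "pd i (pd j (c i j)) x = - pd j (pd i (c j i)) x" by simp
  qed
  also have "\<dots> = - dvg testf x" by (simp add: eq sum_negf)
  finally show ?thesis by simp
qed

text \<open>The divergence of \<open>potrot\<close> is the Laplacian of the potential minus the
  gradient of its divergence, which is the curl-curl formula in tensor form, and the Laplacian of
  the potential is the mollified field. The terms in which the derivative hits \<open>chi\<close>
  make up \<open>shellf\<close>.\<close>

lemma testf_eq: "testf i x = chi x * conv (bump e) (f i) x - chi x * pd i potdiv x + shellf i x"
proof -
  have "(\<Sum>j\<in>UNIV. pd j (potrot i j) x) =
    lap (pot i) x - (\<Sum>j\<in>UNIV. pd j (pd i (pot j)) x)"
    unfolding potrot_def[abs_def] by (simp add: pd_diff smooth_pd smooth_pot sum_subtractf)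
  also have "(\<Sum>j\<in>UNIV. pd j (pd i (pot j)) x) = pd i potdiv x"
    unfolding potdiv_def[abs_def]
    by (simp add: pd_sum smooth_pd smooth_pot partial_deriv_commute[OF smooth_pot, of _ i])
  finally have "(\<Sum>j\<in>UNIV. pd j (potrot i j) x) = conv (bump e) (f i) x - pd i potdiv x"
    by (simp add: laplacian_pot)
  then have "chi x * (\<Sum>j\<in>UNIV. pd j (potrot i j) x) = chi x * conv (bump e) (f i) x - chi x * pd i potdiv x"
    by (simp add: right_diff_distrib)
  moreover have "testf i x = shellf i x + chi x * (\<Sum>j\<in>UNIV. pd j (potrot i j) x)"
    unfolding testf_def shellf_def
    by (simp add: pd_mult smooth_chi smooth_potrot sum.distrib sum_distrib_left)
  ultimately show ?thesis by simp
qed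

lemma smooth_conv_bump: "smooth h \<Longrightarrow> supported r h \<Longrightarrow> smooth (conv (bump e) h)"
  by (rule smooth_conv[OF smooth_bump[OF e] smooth_continuous])

text \<open>Derivatives commute with the convolution, so the mollified divergence of
  \<open>f\<close> remains. For f = phi u with u solenoidal that divergence is grad phi . u, without
  derivatives of u; hence the Hessian of \<open>potdiv\<close> will be controlled by the L^2 norm of
  u.\<close>

lemma laplacian_potdiv:
  "lap potdiv x = conv (bump e) (\<lambda>x. \<Sum>k\<in>UNIV. pd k (f k) x) x"
proof -
  have "pd j (pd j potdiv) = (\<lambda>x. \<Sum>k\<in>UNIV. pd j (pd j (pd k (pot k))) x)" for j
    unfolding potdiv_def[abs_def] by (simp add: pd_sum smooth_pd smooth_pot)
  moreover have "pd k (pot k) = conv (newton e) (pd k (f k))" for k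
    unfolding pot_def by (simp only: partial_deriv_conv2[OF smooth_newton[OF e] f f2])
  ultimately have *: "pd j (pd j potdiv) = (\<lambda>x. \<Sum>k\<in>UNIV. pd j (pd j (conv (newton e) (pd k (f k)))) x)" for j
    by simp
  have "lap potdiv x =
     (\<Sum>k\<in>UNIV. \<Sum>j\<in>UNIV. pd j (pd j (conv (newton e) (pd k (f k)))) x)"
    unfolding * by (rule sum.swap)
  also have "\<dots> = (\<Sum>k\<in>UNIV. conv (bump e) (pd k (f k)) x)"
    by (intro sum.cong refl laplacian_conv_newton[OF e smooth_continuous[OF smooth_pd[OF f]] supported_pd[OF f2]])
  also have "\<dots> = conv (bump e) (\<lambda>x. \<Sum>k\<in>UNIV. pd k (f k) x) x"
    by (rule conv_sum[symmetric, OF smooth_continuous[OF smooth_pd[OF f]] supported_pd[OF f2] smooth_continuous[OF smooth_bump[OF e]]])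
  finally show ?thesis .
qed

lemma pot_bounds:
  assumes x: "norm x \<ge> 3"
  shows "\<bar>pd j (pot i) x\<bar> \<le> mass" "\<bar>pd k (pd j (pot i)) x\<bar> \<le> mass"
    "\<bar>pd l (pd k (pd j (pot i))) x\<bar> \<le> mass"
proof -
  note s = smooth_newton[OF e] and c = smooth_continuous[OF f] and sp = smooth_pd
  have eq: "pd j (pot i) = conv (pd j (newton e)) (f i)"
    "pd k (pd j (pot i)) = conv (pd k (pd j (newton e))) (f i)"
    "pd l (pd k (pd j (pot i))) = conv (pd l (pd k (pd j (newton e)))) (f i)"
    unfolding pot_def
    by (simp_all only: partial_deriv_conv[OF s c f2] partial_deriv_conv[OF sp[OF s] c f2] partial_deriv_conv[OF sp[OF sp[OF s]] c f2])
  have x': "norm x \<ge> 2 + 1" using x by simp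
  have "(24 / kap) * (LBINT y. \<bar>f i y\<bar>) \<le> mass"
    unfolding mass_def using kap_pos
    by (intro mult_left_mono member_le_sum) (auto intro: integral_nonneg_AE less_imp_le)
  moreover have "\<bar>pd j (pot i) x\<bar> \<le> (24 / kap) * (LBINT y. \<bar>f i y\<bar>)"
    unfolding eq(1) by (rule conv_bound_far[OF smooth_continuous[OF sp[OF s]] newton_derivative_bounds(1)[OF e] c f2 x'])
  moreover have "\<bar>pd k (pd j (pot i)) x\<bar> \<le> (24 / kap) * (LBINT y. \<bar>f i y\<bar>)"
    unfolding eq(2) by (rule conv_bound_far[OF smooth_continuous[OF sp[OF sp[OF s]]] newton_derivative_bounds(2)[OF e] c f2 x'])
  moreover have "\<bar>pd l (pd k (pd j (pot i))) x\<bar> \<le> (24 / kap) * (LBINT y. \<bar>f i y\<bar>)"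
    unfolding eq(3) by (rule conv_bound_far[OF smooth_continuous[OF sp[OF sp[OF sp[OF s]]]] newton_derivative_bounds(3)[OF e] c f2 x'])
  ultimately show "\<bar>pd j (pot i) x\<bar> \<le> mass" "\<bar>pd k (pd j (pot i)) x\<bar> \<le> mass"
    "\<bar>pd l (pd k (pd j (pot i))) x\<bar> \<le> mass" by linarith+
qed

lemma mass_nonneg: "mass \<ge> 0"
  unfolding mass_def using kap_pos by (intro mult_nonneg_nonneg sum_nonneg) (auto intro: integral_nonneg_AE less_imp_le)

lemma potdiv_bounds:
  assumes x: "norm x \<ge> 3"
  shows "\<bar>pd i potdiv x\<bar> \<le> 3 * mass" "\<bar>pd j (pd i potdiv) x\<bar> \<le> 3 * mass"
proof -
  have eq: "pd i potdiv = (\<lambda>x. \<Sum>k\<in>UNIV. pd i (pd k (pot k)) x)"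
    "pd j (pd i potdiv) = (\<lambda>x. \<Sum>k\<in>UNIV. pd j (pd i (pd k (pot k))) x)"
    unfolding potdiv_def[abs_def] by (simp_all add: pd_sum smooth_pd smooth_pot)
  have *: "\<bar>\<Sum>k\<in>UNIV. t k\<bar> \<le> 3 * mass" if "\<And>k::3. \<bar>t k\<bar> \<le> mass" for t
    using that[of 1] that[of 2] that[of 3] by (simp add: sum_3)
  show "\<bar>pd i potdiv x\<bar> \<le> 3 * mass"
    unfolding eq(1) by (intro * pot_bounds[OF x])
  show "\<bar>pd j (pd i potdiv) x\<bar> \<le> 3 * mass"
    unfolding eq(2) by (intro * pot_bounds[OF x])
qed

lemma potrot_bounds:
  assumes x: "norm x \<ge> 3"
  shows "\<bar>potrot i j x\<bar> \<le> 2 * mass" "\<bar>pd k (potrot i j) x\<bar> \<le> 2 * mass"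
    "\<bar>pd l (pd k (potrot i j)) x\<bar> \<le> 2 * mass"
proof -
  have eq: "pd k (potrot i j) = (\<lambda>x. pd k (pd j (pot i)) x - pd k (pd i (pot j)) x)"
    "pd l (pd k (potrot i j)) = (\<lambda>x. pd l (pd k (pd j (pot i))) x - pd l (pd k (pd i (pot j))) x)"
    unfolding potrot_def[abs_def] by (simp_all add: pd_diff smooth_pd smooth_pot)
  have *: "\<bar>a - b\<bar> \<le> 2 * mass" if "\<bar>a\<bar> \<le> mass" "\<bar>b\<bar> \<le> mass" for a b using that by linarith
  show "\<bar>potrot i j x\<bar> \<le> 2 * mass"
    unfolding potrot_def by (intro * pot_bounds[OF x])
  show "\<bar>pd k (potrot i j) x\<bar> \<le> 2 * mass"
    unfolding eq(1) by (intro * pot_bounds[OF x])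
  show "\<bar>pd l (pd k (potrot i j)) x\<bar> \<le> 2 * mass"
    unfolding eq(2) by (intro * pot_bounds[OF x])
qed

text \<open>With \<open>W = testf - chi (bump e * f)\<close>, \<open>remf1\<close> and \<open>remf2\<close> are the parts of the gradient and the
  Laplacian of \<open>W\<close> that vanish outside the shell.\<close>

definition remf1 :: "3 \<Rightarrow> 3 \<Rightarrow> real^3 \<Rightarrow> real" where
  "remf1 i j x = - (pd j chi x * pd i potdiv x) + pd j (shellf i) x"

definition remf2 :: "3 \<Rightarrow> real^3 \<Rightarrow> real" where
  "remf2 i x = (\<Sum>j\<in>UNIV. - (2 * (pd j chi x * pd j (pd i potdiv) x)
      + pd j (pd j chi) x * pd i potdiv x) + pd j (pd j (shellf i)) x)"

lemma smooth_remf: "smooth (remf1 i j)" "smooth (remf2 i)"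
  unfolding remf1_def[abs_def] remf2_def[abs_def]
  by (intro smooth_rules smooth_chi smooth_potdiv smooth_shellf)+

lemma shellf_derivs:
  "pd j (shellf i) x = (\<Sum>k\<in>UNIV. pd j (pd k chi) x * potrot i k x + pd k chi x * pd j (potrot i k) x)"
  "pd j (pd j (shellf i)) x = (\<Sum>k\<in>UNIV. pd j (pd j (pd k chi)) x * potrot i k x
     + 2 * (pd j (pd k chi) x * pd j (potrot i k) x) + pd k chi x * pd j (pd j (potrot i k)) x)"
proof -
  have 1: "pd j (shellf i) = (\<lambda>x. \<Sum>k\<in>UNIV. pd j (pd k chi) x * potrot i k x + pd k chi x * pd j (potrot i k) x)" for j
    unfolding shellf_def[abs_def] by (simp add: pd_sum pd_mult smooth_mult smooth_pd smooth_chi smooth_potrot)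
  then show "pd j (shellf i) x = (\<Sum>k\<in>UNIV. pd j (pd k chi) x * potrot i k x + pd k chi x * pd j (potrot i k) x)" by simp
  show "pd j (pd j (shellf i)) x = (\<Sum>k\<in>UNIV. pd j (pd j (pd k chi)) x * potrot i k x
     + 2 * (pd j (pd k chi) x * pd j (potrot i k) x) + pd k chi x * pd j (pd j (potrot i k)) x)"
    unfolding 1 by (simp add: pd_sum pd_add pd_mult smooth_mult smooth_add smooth_pd smooth_chi smooth_potrot algebra_simps)
qed

lemma supported_remf: "supported 8 (remf1 i j)" "supported 8 (remf2 i)" "supported 8 (shellf i)"
proof -
  show s: "supported 8 (shellf i)" unfolding shellf_def[abs_def]
    by (intro supported_sum supported_mult_left supported_pd supported_chi)
  show "supported 8 (remf1 i j)" "supported 8 (remf2 i)" unfolding remf1_def[abs_def] remf2_def[abs_def]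
    by (intro supported_sum supported_mult_left supported_pd supported_chi supported_add supported_minus s
         supported_mult_right)+
qed

lemma chi_derivs_inner:
  assumes "norm x < 4"
  shows "pd j chi x = 0" "pd k (pd j chi) x = 0" "pd l (pd k (pd j chi)) x = 0"
proof -
  have o: "open (ball (0::real^3) 4)" and x: "x \<in> ball 0 4" using assms by auto
  have 1: "pd j chi y = 0" if "y \<in> ball 0 4" for y j
    using that by (intro partial_deriv_cutoff_eq_0) auto
  have 2: "pd k (pd j chi) y = 0" if "y \<in> ball 0 4" for y j k
    by (rule partial_deriv_eq_0_on_open[OF o that 1])
  have 3: "pd l (pd k (pd j chi)) y = 0" if "y \<in> ball 0 4" for y j k l
    by (rule partial_deriv_eq_0_on_open[OF o that 2])
  show "pd j chi x = 0" "pd k (pd j chi) x = 0" "pd l (pd k (pd j chi)) x = 0"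
    using 1 2 3 x by blast+
qed

text \<open>Each summand contains a derivative of \<open>chi\<close>, so both remainders vanish for
  |x| < 4 and elsewhere the far-field bounds apply. Counting terms in units of
  \<open>X * mass\<close>: 15 = 3 + 3 * 4 and 99 = 3 * (2 * 3 + 3 + 3 * 8).\<close>

lemma remf_bounds:
  assumes X: "\<And>j x. \<bar>pd j chi x\<bar> \<le> X" "\<And>j k x. \<bar>pd k (pd j chi) x\<bar> \<le> X"
    "\<And>j k l x. \<bar>pd l (pd k (pd j chi)) x\<bar> \<le> X"
  shows "\<bar>remf1 i j x\<bar> \<le> 15 * (X * mass)" "\<bar>remf2 i x\<bar> \<le> 99 * (X * mass)"
proof -
  have X0: "X \<ge> 0" using X(1)[of 1 0] by linarith
  have nn: "X * mass \<ge> 0" using X0 mass_nonneg by simp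
  have m: "\<bar>a * b\<bar> \<le> c * (X * mass)" if "\<bar>a\<bar> \<le> X" "\<bar>b\<bar> \<le> c * mass" for a b c
    using mult_mono[OF that] X0 by (simp add: abs_mult mult_ac)
  have s3: "\<bar>\<Sum>k\<in>UNIV. t k\<bar> \<le> 3 * c" if "\<And>k::3. \<bar>t k\<bar> \<le> c" for t and c :: real
    using that[of 1] that[of 2] that[of 3] by (simp add: sum_3)
  have "\<bar>remf1 i j x\<bar> \<le> 15 * (X * mass) \<and> \<bar>remf2 i x\<bar> \<le> 99 * (X * mass)"
  proof (cases "norm x < 4")
    case True
    then show ?thesis using nn
      by (simp add: remf1_def remf2_def shellf_derivs chi_derivs_inner)
  next
    case False
    then have x: "norm x \<ge> 3" by simp
    have s1: "\<bar>pd j (shellf i) x\<bar> \<le> 3 * (4 * (X * mass))" for j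
      unfolding shellf_derivs
    proof (rule s3)
      fix k
      have "\<bar>pd j (pd k chi) x * potrot i k x\<bar> \<le> 2 * (X * mass)"
        "\<bar>pd k chi x * pd j (potrot i k) x\<bar> \<le> 2 * (X * mass)"
        by (intro m X potrot_bounds[OF x])+
      then show "\<bar>pd j (pd k chi) x * potrot i k x + pd k chi x * pd j (potrot i k) x\<bar> \<le> 4 * (X * mass)"
        by linarith
    qed
    have s2: "\<bar>pd j chi x * pd i potdiv x\<bar> \<le> 3 * (X * mass)" for j
      by (intro m X potdiv_bounds[OF x])
    have 1: "\<bar>remf1 i j x\<bar> \<le> 15 * (X * mass)"
      using s1[of j] s2[of j] unfolding remf1_def by linarith
    have sh: "\<bar>pd j (pd j (shellf i)) x\<bar> \<le> 3 * (8 * (X * mass))" for j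
      unfolding shellf_derivs
    proof (rule s3)
      fix k
      have "\<bar>pd j (pd j (pd k chi)) x * potrot i k x\<bar> \<le> 2 * (X * mass)"
        "\<bar>pd j (pd k chi) x * pd j (potrot i k) x\<bar> \<le> 2 * (X * mass)"
        "\<bar>pd k chi x * pd j (pd j (potrot i k)) x\<bar> \<le> 2 * (X * mass)"
        by (intro m X potrot_bounds[OF x])+
      then show "\<bar>pd j (pd j (pd k chi)) x * potrot i k x
         + 2 * (pd j (pd k chi) x * pd j (potrot i k) x) + pd k chi x * pd j (pd j (potrot i k)) x\<bar> \<le> 8 * (X * mass)"
        by linarith
    qed
    have "\<bar>remf2 i x\<bar> \<le> 3 * (33 * (X * mass))"
      unfolding remf2_def
    proof (rule s3)
      fix j
      have "\<bar>pd j chi x * pd j (pd i potdiv) x\<bar> \<le> 3 * (X * mass)"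
        "\<bar>pd j (pd j chi) x * pd i potdiv x\<bar> \<le> 3 * (X * mass)"
        by (intro m X potdiv_bounds[OF x])+
      with sh[of j] show "\<bar>- (2 * (pd j chi x * pd j (pd i potdiv) x)
        + pd j (pd j chi) x * pd i potdiv x) + pd j (pd j (shellf i)) x\<bar> \<le> 33 * (X * mass)"
        by linarith
    qed
    with 1 show ?thesis by simp
  qed
  then show "\<bar>remf1 i j x\<bar> \<le> 15 * (X * mass)" "\<bar>remf2 i x\<bar> \<le> 99 * (X * mass)" by auto
qed

end

lemma sum3_abs_le: "(\<And>k::3. \<bar>t k\<bar> \<le> c) \<Longrightarrow> \<bar>\<Sum>k\<in>UNIV. t k\<bar> \<le> 3 * (c::real)"
proof -
  assume "\<And>k::3. \<bar>t k\<bar> \<le> c"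
  from this[of 1] this[of 2] this[of 3] show ?thesis by (simp add: sum_3)
qed

lemma integral_sum_smooth_supported:
  assumes "\<And>i. i \<in> I \<Longrightarrow> smooth (h i)" "\<And>i. i \<in> I \<Longrightarrow> supported r (h i)"
  shows "(LBINT x. (\<Sum>i\<in>I. h i x)) = (\<Sum>i\<in>I. LBINT x. h i x)"
  by (rule Bochner_Integration.integral_sum) (rule integrable_smooth_supported[OF assms])

lemma divergence_integral_eq_0:
  fixes G :: "'n::finite \<Rightarrow> real^'n \<Rightarrow> real"
  assumes "\<And>i. smooth (G i)" "\<And>i. supported r (G i)"
  shows "(LBINT x. dvg G x) = 0"
  by (subst integral_sum_smooth_supported[of _ _ r])
     (auto intro: smooth_pd supported_pd assms simp: integral_partial_deriv_eq_0[OF assms])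

context solenoidal_test
begin

abbreviation "divf \<equiv> (\<lambda>x. \<Sum>k\<in>UNIV. pd k (f k) x)"
abbreviation "bdiv \<equiv> conv (bump e) divf"

lemma smooth_divf: "smooth divf" by (intro smooth_rules f)
lemma supported_divf: "supported 2 divf" by (intro supported_sum supported_pd f2)
lemma smooth_bdiv: "smooth bdiv" by (rule smooth_conv_bump[OF smooth_divf supported_divf])

text \<open>The localized version of the identity between the L^2 norms of Hessian and Laplacian.
  The cutoff produces an error with a factor grad \<open>chi\<close>, hence confined to the region
  where the derivatives of \<open>potdiv\<close> are at most \<open>3 * mass\<close>; its two sums
  contribute 81 each to the constant 162.\<close>

lemma hessian_energy:
  assumes X: "\<And>j x. \<bar>pd j chi x\<bar> \<le> X"
  shows "(LBINT x. chi x * (\<Sum>i\<in>UNIV. \<Sum>j\<in>UNIV. (pd i (pd j potdiv) x)\<^sup>2))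
    \<le> (LBINT x. chi x * (bdiv x)\<^sup>2) + 162 * X * mass\<^sup>2 * bint 8 (\<lambda>x::real^3. 1)"
proof -
  define q where "q = potdiv"
  have sq: "smooth q" unfolding q_def by (rule smooth_potdiv)
  define L where "L x = lap q x" for x
  have L: "L = bdiv" unfolding L_def q_def laplacian_potdiv ..
  have sL: "smooth L" unfolding L by (rule smooth_bdiv)
  define E where "E x = (\<Sum>i\<in>UNIV. \<Sum>j\<in>UNIV. pd i chi x * (pd j q x * pd i (pd j q) x))
      - (\<Sum>j\<in>UNIV. pd j chi x * (pd j q x * L x))" for x
  \<comment> \<open>In the divergence of this field the third derivatives of \<open>q\<close> coming
    from its two parts cancel, because derivatives commute. What is left is \<open>chi\<close> times
    squared Hessian minus squared Laplacian, plus the error \<open>E\<close>.\<close>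
  define G where "G i x = (\<Sum>j\<in>UNIV. chi x * (pd j q x * pd i (pd j q) x)) - chi x * (pd i q x * L x)" for i x
  note sm = smooth_rules smooth_chi sq sL
  have sG: "smooth (G i)" for i unfolding G_def[abs_def] by (intro sm)
  have G8: "supported 8 (G i)" for i unfolding G_def[abs_def]
    by (intro supported_diff supported_sum supported_mult_left supported_chi)
  have sE: "smooth E" unfolding E_def[abs_def] by (intro sm)
  have E8: "supported 8 E" unfolding E_def[abs_def]
    by (intro supported_diff supported_sum supported_mult_left supported_pd supported_chi)
  define H where "H x = (\<Sum>i\<in>UNIV. \<Sum>j\<in>UNIV. (pd i (pd j q) x)\<^sup>2)" for x
  have sH: "smooth H" unfolding H_def[abs_def] by (intro sm)
  have dG: "dvg G x = chi x * H x - chi x * (L x)\<^sup>2 + E x" for x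
  proof -
    have dGi: "pd i (G i) x = 
        (\<Sum>j\<in>UNIV. pd i chi x * (pd j q x * pd i (pd j q) x))
       + (\<Sum>j\<in>UNIV. chi x * (pd i (pd j q) x)\<^sup>2)
       + (\<Sum>j\<in>UNIV. chi x * (pd j q x * pd i (pd i (pd j q)) x))
       - pd i chi x * (pd i q x * L x)
       - chi x * (pd i (pd i q) x * L x) - chi x * (pd i q x * pd i L x)" for i
    proof -
      have s1: "smooth (\<lambda>x. chi x * (pd j q x * pd i (pd j q) x))" for j by (intro sm)
      have s2: "smooth (\<lambda>x. chi x * (pd i q x * L x))" by (intro sm)
      have s3: "smooth (\<lambda>x. pd j q x * pd i (pd j q) x)" for j by (intro sm)
      have s4: "smooth (\<lambda>x. pd i q x * L x)" by (intro sm)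
      show ?thesis unfolding G_def[abs_def]
        by (simp add: pd_diff[OF smooth_sum[OF s1] s2] pd_sum[OF s1] pd_mult[OF smooth_chi s3] pd_mult[OF smooth_chi s4]
            pd_mult[OF smooth_pd[OF sq] smooth_pd[OF smooth_pd[OF sq]]]
            pd_mult[OF smooth_pd[OF sq] sL] sum.distrib[symmetric])
           (simp add: algebra_simps power2_eq_square)
    qed
    have "pd j L x = lap (pd j q) x" for j
    proof -
      have "pd j L = (\<lambda>x. \<Sum>i\<in>UNIV. pd j (pd i (pd i q)) x)"
        unfolding L_def[abs_def] by (rule pd_sum) (intro sm)
      moreover have "pd j (pd i (pd i q)) = pd i (pd i (pd j q))" for i
        by (simp only: partial_deriv_commute[OF smooth_pd[OF sq], of j i] partial_deriv_commute[OF sq, of j i])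
      ultimately show ?thesis by simp
    qed
    then have "(\<Sum>i\<in>UNIV. chi x * (pd i q x * pd i L x)) =
       (\<Sum>j\<in>UNIV. \<Sum>i\<in>UNIV. chi x * (pd j q x * pd i (pd i (pd j q)) x))"
      by (simp add: sum_distrib_left)
    also have "\<dots> = (\<Sum>i\<in>UNIV. \<Sum>j\<in>UNIV. chi x * (pd j q x * pd i (pd i (pd j q)) x))"
      by (rule sum.swap)
    finally have e1: "(\<Sum>i\<in>UNIV. chi x * (pd i q x * pd i L x)) = \<dots>" .
    have e2: "(\<Sum>i\<in>UNIV. chi x * (pd i (pd i q) x * L x)) = chi x * (L x)\<^sup>2"
      by (simp add: L_def sum_distrib_left[symmetric] sum_distrib_right[symmetric] power2_eq_square)
    show ?thesis
      unfolding dGi sum_subtractf sum.distrib e1 e2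
      by (simp add: H_def E_def sum_distrib_left)
  qed
  have i1: "integrable lborel (\<lambda>x. chi x * H x)" "integrable lborel (\<lambda>x. chi x * (L x)\<^sup>2)" "integrable lborel E"
    by (rule integrable_smooth_supported[of _ 8], (intro sm sH sE), (intro supported_mult_left supported_chi E8))+
  have "0 = (LBINT x. chi x * H x - chi x * (L x)\<^sup>2 + E x)"
    using divergence_integral_eq_0[of G 8, OF sG G8] by (simp add: dG)
  also have "\<dots> = (LBINT x. chi x * H x) - (LBINT x. chi x * (L x)\<^sup>2) + (LBINT x. E x)"
    using i1 by simp
  finally have "(LBINT x. chi x * H x) = (LBINT x. chi x * (L x)\<^sup>2) - (LBINT x. E x)" by simp
  moreover have "\<bar>LBINT x. 1 * E x\<bar> \<le> (162 * X * mass\<^sup>2) * bint 8 (\<lambda>x::real^3. \<bar>1\<bar>)"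
  proof (rule bint_bound[OF _ smooth_continuous[OF sE] E8])
    fix x
    have X0: "X \<ge> 0" using X[of 1 0] by linarith
    show "\<bar>E x\<bar> \<le> 162 * X * mass\<^sup>2"
    proof (cases "norm x < 4")
      case True then show ?thesis using X0 by (simp add: E_def chi_derivs_inner)
    next
      case False
      then have x: "norm x \<ge> 3" by simp
      note b = potdiv_bounds[OF x, folded q_def]
      have m: "\<bar>a * b\<bar> \<le> A * B" if "\<bar>a\<bar> \<le> A" "\<bar>b\<bar> \<le> B" for a b A B :: real
        unfolding abs_mult using that by (intro mult_mono) auto
      have "\<bar>\<Sum>i\<in>UNIV. \<Sum>j\<in>UNIV. pd i chi x * (pd j q x * pd i (pd j q) x)\<bar>
        \<le> 3 * (3 * (X * ((3 * mass) * (3 * mass))))"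
        by (intro sum3_abs_le m X b)
      moreover have "\<bar>\<Sum>j\<in>UNIV. pd j chi x * (pd j q x * L x)\<bar> \<le> 3 * (X * ((3 * mass) * (3 * (3 * mass))))"
        unfolding L_def by (intro sum3_abs_le m X b)
      ultimately have "\<bar>E x\<bar> \<le> 3 * (3 * (X * ((3 * mass) * (3 * mass)))) + 3 * (X * ((3 * mass) * (3 * (3 * mass))))"
        unfolding E_def by linarith
      also have "\<dots> = 162 * X * mass\<^sup>2" by (simp add: power2_eq_square)
      finally show ?thesis .
    qed
  qed auto
  ultimately show ?thesis by (simp add: H_def L q_def)
qed

text \<open>The pressure gradient is orthogonal to the solenoidal field \<open>testf\<close>, so its
  work against \<open>chi\<close> times the mollified field is minus its work against the correction
  \<open>W\<close>. There the momentum equation replaces the pressure gradient and all derivatives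
  move onto \<open>W\<close>. The Hessian of \<open>potdiv\<close> meets \<open>F\<close>; every
  other term carries a derivative of \<open>chi\<close>.\<close>

lemma pressure_identity:
  assumes su: "\<And>i. smooth (u i)" and sF: "\<And>i j. smooth (F i j)" and sp: "smooth p"
    and mom: "\<And>i x. (\<Sum>j\<in>UNIV. pd j (F i j) x) - lap (u i) x = - pd i p x"
    and div: "\<And>x. dvg u x = 0"
  shows "(LBINT x. (\<Sum>i\<in>UNIV. pd i p x * (chi x * conv (bump e) (f i) x))) =
     (LBINT x. chi x * (\<Sum>i\<in>UNIV. \<Sum>j\<in>UNIV. F i j x * pd j (pd i potdiv) x))
   - (\<Sum>i\<in>UNIV. \<Sum>j\<in>UNIV. LBINT x. F i j x * remf1 i j x)
   - (\<Sum>i\<in>UNIV. LBINT x. u i x * remf2 i x)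
   - (LBINT x. (\<Sum>i\<in>UNIV. pd i chi x * u i x) * bdiv x)"
proof -
  define q where "q = potdiv"
  have sq: "smooth q" unfolding q_def by (rule smooth_potdiv)
  define la where "la i = conv (bump e) (f i)" for i
  have sla: "smooth (la i)" for i unfolding la_def by (rule smooth_conv_bump[OF f f2])
  define W where "W i x = - (chi x * pd i q x) + shellf i x" for i x
  note sm = smooth_rules smooth_chi sq su sF sp smooth_shellf sla smooth_testf smooth_remf
  have sW: "smooth (W i)" for i unfolding W_def[abs_def] by (intro sm)
  have W8: "supported 8 (W i)" for i unfolding W_def[abs_def]
    by (intro supported_add supported_minus supported_mult_left supported_chi supported_remf)
  have tW: "testf i x = chi x * la i x + W i x" for i x
    by (simp add: testf_eq W_def la_def q_def)
  have int: "integrable lborel h" if "smooth h" "supported 8 h" for h :: "real^3 \<Rightarrow> real"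
    by (rule integrable_smooth_supported[OF that])
  have "(LBINT x. (\<Sum>i\<in>UNIV. pd i (\<lambda>x. p x * testf i x) x)) = 0"
    by (rule divergence_integral_eq_0[of _ 8]) (intro sm supported_mult_right supported_testf)+
  also have "(\<lambda>x. \<Sum>i\<in>UNIV. pd i (\<lambda>x. p x * testf i x) x) = 
     (\<lambda>x. (\<Sum>i\<in>UNIV. pd i p x * (chi x * la i x)) + (\<Sum>i\<in>UNIV. pd i p x * W i x))"
  proof
    fix x
    have "(\<Sum>i\<in>UNIV. pd i (\<lambda>x. p x * testf i x) x) = (\<Sum>i\<in>UNIV. pd i p x * testf i x) + p x * dvg testf x"
      by (simp add: pd_mult[OF sp smooth_testf] sum.distrib sum_distrib_left)
    also have "\<dots> = (\<Sum>i\<in>UNIV. pd i p x * (chi x * la i x)) + (\<Sum>i\<in>UNIV. pd i p x * W i x)"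
      by (simp add: testf_divergence tW distrib_left sum.distrib)
    finally show "(\<Sum>i\<in>UNIV. pd i (\<lambda>x. p x * testf i x) x) = \<dots>" .
  qed
  also have "(LBINT x. (\<Sum>i\<in>UNIV. pd i p x * (chi x * la i x)) + (\<Sum>i\<in>UNIV. pd i p x * W i x))
    = (LBINT x. (\<Sum>i\<in>UNIV. pd i p x * (chi x * la i x))) + (LBINT x. (\<Sum>i\<in>UNIV. pd i p x * W i x))"
    by (rule Bochner_Integration.integral_add; rule int; intro sm sW supported_sum supported_mult_right W8 supported_mult_left[OF supported_chi])
  finally have eq1: "(LBINT x. (\<Sum>i\<in>UNIV. pd i p x * (chi x * la i x))) = - (LBINT x. (\<Sum>i\<in>UNIV. pd i p x * W i x))"
    by simp
  define R where "R x = chi x * (\<Sum>i\<in>UNIV. \<Sum>j\<in>UNIV. F i j x * pd j (pd i q) x)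
      - (\<Sum>i\<in>UNIV. \<Sum>j\<in>UNIV. F i j x * remf1 i j x) - (\<Sum>i\<in>UNIV. u i x * remf2 i x)
      - (\<Sum>i\<in>UNIV. pd i chi x * u i x) * bdiv x" for x
  \<comment> \<open>All integrations by parts gathered in one field: \<open>F W\<close> takes the
    divergence off \<open>F\<close>, the next two terms are Green's second identity for
    \<open>u\<close> and \<open>W\<close>, and \<open>chi u bdiv\<close> removes the gradient of
    \<open>bdiv\<close> hidden in the Laplacian of \<open>W\<close>, using that \<open>u\<close> is
    solenoidal.\<close>
  define D where "D j x = (\<Sum>i\<in>UNIV. F i j x * W i x - pd j (u i) x * W i x + u i x * pd j (W i) x) + chi x * u j x * bdiv x" for j x
  have sD: "smooth (D j)" for j unfolding D_def[abs_def] by (intro sm sW smooth_bdiv)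
  have D8: "supported 8 (D j)" for j unfolding D_def[abs_def]
    by (intro supported_add supported_sum supported_diff supported_mult_right W8 supported_pd supported_mult_left supported_chi)
  have pt: "- (\<Sum>i\<in>UNIV. pd i p x * W i x) - dvg D x = R x" for x
  proof -
    have dW: "pd j (W i) x = - (chi x * pd j (pd i q) x) + remf1 i j x" for i j x
    proof -
      have "pd j (W i) = (\<lambda>x. - (pd j chi x * pd i q x + chi x * pd j (pd i q) x) + pd j (shellf i) x)"
        unfolding W_def[abs_def]
        by (simp only: pd_add[OF smooth_minus[OF smooth_mult[OF smooth_chi smooth_pd[OF sq]]] smooth_shellf]
            pd_minus[OF smooth_mult[OF smooth_chi smooth_pd[OF sq]]] pd_mult[OF smooth_chi smooth_pd[OF sq]])
      then show ?thesis by (simp add: remf1_def q_def)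
    qed
    have dq: "pd i bdiv x = lap (pd i q) x" for i
    proof -
      have "bdiv = (\<lambda>x. \<Sum>j\<in>UNIV. pd j (pd j q) x)"
        unfolding q_def by (simp add: laplacian_potdiv)
      then have "pd i bdiv x = (\<Sum>j\<in>UNIV. pd i (pd j (pd j q)) x)"
        by (simp add: pd_sum smooth_pd sq)
      moreover have "pd i (pd j (pd j q)) = pd j (pd j (pd i q))" for j
        by (simp only: partial_deriv_commute[OF smooth_pd[OF sq], of i j] partial_deriv_commute[OF sq, of i j])
      ultimately show ?thesis by simp
    qed
    have lW: "lap (W i) x = - (chi x * pd i bdiv x) + remf2 i x" for i
    proof -
      have "pd j (pd j (W i)) x = 
         - (chi x * pd j (pd j (pd i q)) x)
         + (- (2 * (pd j chi x * pd j (pd i q) x)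
      + pd j (pd j chi) x * pd i q x) + pd j (pd j (shellf i)) x)" for j
      proof -
        have 1: "pd j (W i) = (\<lambda>x. - (chi x * pd j (pd i q) x) + (- (pd j chi x * pd i q x) + pd j (shellf i) x))"
          using dW by (simp add: remf1_def q_def fun_eq_iff)
        have s1: "smooth (\<lambda>x. chi x * pd j (pd i q) x)" "smooth (\<lambda>x. pd j chi x * pd i q x)" by (intro sm)+
        have s2: "smooth (pd j (shellf i))" by (intro sm)
        show ?thesis unfolding 1
          by (simp only: pd_add[OF smooth_minus[OF s1(1)] smooth_add[OF smooth_minus[OF s1(2)] s2]] pd_add[OF smooth_minus[OF s1(2)] s2]
            pd_minus[OF s1(1)] pd_minus[OF s1(2)] pd_mult[OF smooth_chi smooth_pd[OF smooth_pd[OF sq]]]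
            pd_mult[OF smooth_pd[OF smooth_chi] smooth_pd[OF sq]])
      qed
      then show ?thesis unfolding dq remf2_def
        by (simp add: sum.distrib sum_subtractf sum_distrib_left sum_negf q_def)
    qed
    have dD: "pd j (D j) x = (\<Sum>i\<in>UNIV. pd j (F i j) x * W i x + F i j x * pd j (W i) x
        - pd j (pd j (u i)) x * W i x + u i x * pd j (pd j (W i)) x)
        + (pd j chi x * u j x * bdiv x + chi x * pd j (u j) x * bdiv x + chi x * u j x * pd j bdiv x)" for j
    proof -
      have s: "smooth (\<lambda>x. F i j x * W i x)" "smooth (\<lambda>x. pd j (u i) x * W i x)" "smooth (\<lambda>x. u i x * pd j (W i) x)"
        "smooth (\<lambda>x. chi x * u j x * bdiv x)" "smooth (\<lambda>x. chi x * u j x)" for i by (intro sm sW smooth_bdiv)+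
      show ?thesis unfolding D_def[abs_def]
        by (simp add: pd_add[OF smooth_sum[OF smooth_add[OF smooth_diff[OF s(1,2)] s(3)]] s(4)]
          pd_sum[OF smooth_add[OF smooth_diff[OF s(1,2)] s(3)]] pd_add[OF smooth_diff[OF s(1,2)] s(3)] pd_diff[OF s(1,2)]
          pd_mult[OF sF sW] pd_mult[OF smooth_pd[OF su] sW] pd_mult[OF su smooth_pd[OF sW]]
          pd_mult[OF s(5) smooth_bdiv] pd_mult[OF smooth_chi su])
          (simp add: algebra_simps)
    qed
    have mom': "- pd i p x = (\<Sum>j\<in>UNIV. pd j (F i j) x) - lap (u i) x" for i
      using mom[of i x] by simp
    have a1: "- (\<Sum>i\<in>UNIV. pd i p x * W i x) = (\<Sum>i\<in>UNIV. \<Sum>j\<in>UNIV. pd j (F i j) x * W i x - pd j (pd j (u i)) x * W i x)"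
      by (simp add: sum_negf[symmetric] mult_minus_left[symmetric] mom' left_diff_distrib sum_distrib_right sum_subtractf del: mult_minus_left)
    have "dvg D x = 
      (\<Sum>i\<in>UNIV. \<Sum>j\<in>UNIV. pd j (F i j) x * W i x - pd j (pd j (u i)) x * W i x)
      + (\<Sum>i\<in>UNIV. \<Sum>j\<in>UNIV. F i j x * pd j (W i) x) 
      + (\<Sum>i\<in>UNIV. u i x * lap (W i) x)
      + ((\<Sum>j\<in>UNIV. pd j chi x * u j x) * bdiv x + chi x * dvg u x * bdiv x + (\<Sum>j\<in>UNIV. chi x * u j x * pd j bdiv x))"
      unfolding dD
      by (simp add: sum_3 algebra_simps)
    then show ?thesis
      unfolding a1 dW lW R_def by (simp add: div sum_3 algebra_simps)
  qed
  have iD: "(LBINT x. dvg D x) = 0"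
    by (rule divergence_integral_eq_0[of D 8, OF sD D8])
  have "- (LBINT x. (\<Sum>i\<in>UNIV. pd i p x * W i x)) = (LBINT x. - (\<Sum>i\<in>UNIV. pd i p x * W i x) - dvg D x)"
  proof -
    have "integrable lborel (\<lambda>x. - (\<Sum>i\<in>UNIV. pd i p x * W i x))" "integrable lborel (\<lambda>x. \<Sum>j\<in>UNIV. pd j (D j) x)"
      by (rule int; intro sm sW sD supported_minus supported_sum supported_mult_right W8 supported_pd D8)+
    then show ?thesis using iD by simp
  qed
  also have "\<dots> = (LBINT x. R x)" by (simp only: pt)
  also have "\<dots> = (LBINT x. chi x * (\<Sum>i\<in>UNIV. \<Sum>j\<in>UNIV. F i j x * pd j (pd i q) x))
      - (LBINT x. (\<Sum>i\<in>UNIV. \<Sum>j\<in>UNIV. F i j x * remf1 i j x)) - (LBINT x. (\<Sum>i\<in>UNIV. u i x * remf2 i x))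
      - (LBINT x. (\<Sum>i\<in>UNIV. pd i chi x * u i x) * bdiv x)"
  proof -
    have "integrable lborel (\<lambda>x. chi x * (\<Sum>i\<in>UNIV. \<Sum>j\<in>UNIV. F i j x * pd j (pd i q) x))"
      "integrable lborel (\<lambda>x. \<Sum>i\<in>UNIV. \<Sum>j\<in>UNIV. F i j x * remf1 i j x)"
      "integrable lborel (\<lambda>x. \<Sum>i\<in>UNIV. u i x * remf2 i x)"
      "integrable lborel (\<lambda>x. (\<Sum>i\<in>UNIV. pd i chi x * u i x) * bdiv x)"
      by (rule int; intro sm smooth_bdiv supported_sum supported_mult_left supported_chi supported_pd
         supported_mult_right[OF supported_remf(1)] supported_mult_right[OF supported_remf(2)])+
    then show ?thesis unfolding R_def by simp
  qed
  also have "(LBINT x. (\<Sum>i\<in>UNIV. \<Sum>j\<in>UNIV. F i j x * remf1 i j x)) = (\<Sum>i\<in>UNIV. \<Sum>j\<in>UNIV. LBINT x. F i j x * remf1 i j x)"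
    by (subst integral_sum_smooth_supported[of _ _ 8], (intro sm supported_sum supported_mult_right supported_remf)+)+ rule
  also have "(LBINT x. (\<Sum>i\<in>UNIV. u i x * remf2 i x)) = (\<Sum>i\<in>UNIV. LBINT x. u i x * remf2 i x)"
    by (rule integral_sum_smooth_supported[of _ _ 8]) (intro sm supported_mult_right supported_remf)+
  finally show ?thesis unfolding eq1[unfolded la_def] by (simp only: q_def)
qed

end

section \<open>Estimating the work of the pressure\<close>

lemma young_mult:
  fixes a b s :: real
  assumes "s > 0"
  shows "\<bar>a * b\<bar> \<le> s * a\<^sup>2 + b\<^sup>2 / s"
proof -
  have "0 \<le> (s * \<bar>a\<bar> - \<bar>b\<bar>)\<^sup>2 / s" using assms by simp
  also have "\<dots> = s * a\<^sup>2 + b\<^sup>2 / s - 2 * \<bar>a * b\<bar>"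
    using assms by (simp add: power2_diff abs_mult field_simps power2_eq_square)
  finally show ?thesis by simp
qed

lemma sum3_square_le: "(\<Sum>i\<in>(UNIV::3 set). t i)\<^sup>2 \<le> 3 * (\<Sum>i\<in>UNIV. (t i)\<^sup>2)" for t :: "3 \<Rightarrow> real"
proof -
  have "0 \<le> (t 1 - t 2)\<^sup>2 + (t 1 - t 3)\<^sup>2 + (t 2 - t 3)\<^sup>2" by simp
  then show ?thesis by (simp add: sum_3 power2_eq_square algebra_simps)
qed

lemma bint_cutoff_le:
  assumes w: "smooth w" "\<And>x. 0 \<le> w x"
  shows "(LBINT x. chi x * w x) \<le> bint 8 w"
proof -
  have "(LBINT x. chi x * w x) = bint 8 (\<lambda>x. chi x * w x)"
    by (rule integral_supported_eq_bint) (intro supported_mult_left supported_chi)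
  also have "\<dots> \<le> bint 8 w"
    using mult_right_mono[OF cutoff_bounds(2) w(2)]
    by (intro bint_mono smooth_continuous smooth_mult smooth_chi w) simp
  finally show ?thesis .
qed

text \<open>Only the Hessian term lacks a pointwise bounded factor; Young's inequality with weight
  \<open>s\<close> splits it, and \<open>hessian_energy\<close> absorbs the squared Hessian. The
  remainder terms are bounded factors against L^1 norms. The last summand is kept as it stands
  because it vanishes in the limit.\<close>

lemma (in solenoidal_test) pressure_work_eps:
  assumes su: "\<And>i. smooth (u i)" and sF: "\<And>i j. smooth (F i j)" and sp: "smooth p"
    and mom: "\<And>i x. (\<Sum>j\<in>UNIV. pd j (F i j) x) - lap (u i) x = - pd i p x"
    and div: "\<And>x. dvg u x = 0"
    and X: "\<And>j x. \<bar>pd j chi x\<bar> \<le> X" "\<And>j k x. \<bar>pd k (pd j chi) x\<bar> \<le> X"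
    "\<And>j k l x. \<bar>pd l (pd k (pd j chi)) x\<bar> \<le> X"
    and s: "s > 0"
  shows "\<bar>LBINT x. (\<Sum>i\<in>UNIV. pd i p x * (chi x * conv (bump e) (f i) x))\<bar>
    \<le> s * bint 8 (\<lambda>x. \<Sum>i\<in>UNIV. \<Sum>j\<in>UNIV. (F i j x)\<^sup>2)
      + ((LBINT x. chi x * (bdiv x)\<^sup>2) + 162 * X * mass\<^sup>2 * bint 8 (\<lambda>x::real^3. 1)) / s
      + 15 * (X * mass) * (\<Sum>i\<in>UNIV. \<Sum>j\<in>UNIV. bint 8 (\<lambda>x. \<bar>F i j x\<bar>)) + 99 * (X * mass) * (\<Sum>i\<in>UNIV. bint 8 (\<lambda>x. \<bar>u i x\<bar>))
      + \<bar>LBINT x. (\<Sum>i\<in>UNIV. pd i chi x * u i x) * bdiv x\<bar>"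
proof -
  let ?A = "LBINT x. chi x * (\<Sum>i\<in>UNIV. \<Sum>j\<in>UNIV. F i j x * pd j (pd i potdiv) x)"
  define H where "H x = (\<Sum>i\<in>UNIV. \<Sum>j\<in>UNIV. (pd i (pd j potdiv) x)\<^sup>2)" for x
  define F2 where "F2 x = (\<Sum>i\<in>UNIV. \<Sum>j\<in>UNIV. (F i j x)\<^sup>2)" for x
  note sm = smooth_rules smooth_chi smooth_potdiv sF
  have sH: "smooth H" "smooth F2" unfolding H_def[abs_def] F2_def[abs_def] by (intro sm)+
  have int: "integrable lborel (\<lambda>x. chi x * w x)" if "smooth w" for w :: "real^3 \<Rightarrow> real"
    by (rule integrable_smooth_supported[of _ 8]) (intro sm that supported_mult_left supported_chi)+
  have "\<bar>?A\<bar> \<le> (LBINT x. \<bar>chi x * (\<Sum>i\<in>UNIV. \<Sum>j\<in>UNIV. F i j x * pd j (pd i potdiv) x)\<bar>)"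
    by (rule integral_abs_bound)
  also have "\<dots> \<le> (LBINT x. s * (chi x * F2 x) + (chi x * H x) / s)"
  proof (rule integral_mono)
    show "integrable lborel (\<lambda>x. \<bar>chi x * (\<Sum>i\<in>UNIV. \<Sum>j\<in>UNIV. F i j x * pd j (pd i potdiv) x)\<bar>)"
      by (intro integrable_abs int sm)
    show "integrable lborel (\<lambda>x. s * (chi x * F2 x) + (chi x * H x) / s)"
      by (intro Bochner_Integration.integrable_add integrable_mult_right integrable_divide int sH)
    fix x
    have "\<bar>\<Sum>i\<in>UNIV. \<Sum>j\<in>UNIV. F i j x * pd j (pd i potdiv) x\<bar> \<le> (\<Sum>i\<in>UNIV. \<Sum>j\<in>UNIV. \<bar>F i j x * pd j (pd i potdiv) x\<bar>)"
      by (intro order_trans[OF sum_abs] sum_mono) simp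
    also have "\<dots> \<le> (\<Sum>i\<in>UNIV. \<Sum>j\<in>UNIV. s * (F i j x)\<^sup>2 + (pd j (pd i potdiv) x)\<^sup>2 / s)"
      by (intro sum_mono young_mult s)
    also have "\<dots> = s * F2 x + H x / s"
      by (simp add: F2_def H_def sum.distrib sum_distrib_left sum_divide_distrib partial_deriv_commute[OF smooth_potdiv])
    finally have "chi x * \<bar>\<Sum>i\<in>UNIV. \<Sum>j\<in>UNIV. F i j x * pd j (pd i potdiv) x\<bar> \<le> chi x * (s * F2 x + H x / s)"
      by (rule mult_left_mono[OF _ cutoff_bounds(1)])
    then show "\<bar>chi x * (\<Sum>i\<in>UNIV. \<Sum>j\<in>UNIV. F i j x * pd j (pd i potdiv) x)\<bar> \<le> s * (chi x * F2 x) + (chi x * H x) / s"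
      by (simp add: abs_mult cutoff_bounds algebra_simps)
  qed
  also have "\<dots> = s * (LBINT x. chi x * F2 x) + (LBINT x. chi x * H x) / s"
    using int[OF sH(1)] int[OF sH(2)] by simp
  also have "\<dots> \<le> s * bint 8 F2 + ((LBINT x. chi x * (bdiv x)\<^sup>2) + 162 * X * mass\<^sup>2 * bint 8 (\<lambda>x::real^3. 1)) / s"
    using s hessian_energy[OF X(1), folded H_def]
    by (intro add_mono mult_left_mono divide_right_mono bint_cutoff_le sH) (auto simp: F2_def intro!: sum_nonneg)
  finally have A: "\<bar>?A\<bar> \<le> s * bint 8 F2 + ((LBINT x. chi x * (bdiv x)\<^sup>2) + 162 * X * mass\<^sup>2 * bint 8 (\<lambda>x::real^3. 1)) / s" .
  have "\<bar>\<Sum>i\<in>UNIV. \<Sum>j\<in>UNIV. LBINT x. F i j x * remf1 i j x\<bar> \<le> (\<Sum>i\<in>UNIV. \<Sum>j\<in>UNIV. \<bar>LBINT x. F i j x * remf1 i j x\<bar>)"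
    by (intro order_trans[OF sum_abs] sum_mono) simp
  also have "\<dots> \<le> (\<Sum>i\<in>UNIV. \<Sum>j\<in>UNIV. 15 * (X * mass) * bint 8 (\<lambda>x. \<bar>F i j x\<bar>))"
    by (intro sum_mono bint_bound smooth_continuous sF smooth_remf supported_remf remf_bounds X)
  finally have B: "\<bar>\<Sum>i\<in>UNIV. \<Sum>j\<in>UNIV. LBINT x. F i j x * remf1 i j x\<bar> \<le> 15 * (X * mass) * (\<Sum>i\<in>UNIV. \<Sum>j\<in>UNIV. bint 8 (\<lambda>x. \<bar>F i j x\<bar>))"
    by (simp only: sum_distrib_left)
  have "\<bar>\<Sum>i\<in>UNIV. LBINT x. u i x * remf2 i x\<bar> \<le> (\<Sum>i\<in>UNIV. \<bar>LBINT x. u i x * remf2 i x\<bar>)"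
    by (rule sum_abs)
  also have "\<dots> \<le> (\<Sum>i\<in>UNIV. 99 * (X * mass) * bint 8 (\<lambda>x. \<bar>u i x\<bar>))"
    by (intro sum_mono bint_bound smooth_continuous su smooth_remf supported_remf remf_bounds X)
  finally have C: "\<bar>\<Sum>i\<in>UNIV. LBINT x. u i x * remf2 i x\<bar> \<le> 99 * (X * mass) * (\<Sum>i\<in>UNIV. bint 8 (\<lambda>x. \<bar>u i x\<bar>))"
    by (simp only: sum_distrib_left)
  show ?thesis
    unfolding pressure_identity[OF su sF sp mom div] F2_def[symmetric]
    using A B C by linarith
qed

text \<open>The limit \<open>e\<close> to 0 of the previous estimate. \<open>mass\<close> does not
  involve \<open>e\<close>, the mollified functions converge boundedly, and \<open>chi\<close>
  disappears next to \<open>f\<close> because it equals 1 on the support of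
  \<open>f\<close>.\<close>

lemma pressure_work_mass:
  fixes u :: "3 \<Rightarrow> real^3 \<Rightarrow> real"
  assumes su: "\<And>i. smooth (u i)" and sF: "\<And>i j. smooth (F i j)" and sp: "smooth p"
    and mom: "\<And>i x. (\<Sum>j\<in>UNIV. pd j (F i j) x) - lap (u i) x = - pd i p x"
    and div: "\<And>x. dvg u x = 0"
    and X: "\<And>j x. \<bar>pd j chi x\<bar> \<le> X" "\<And>j k x. \<bar>pd k (pd j chi) x\<bar> \<le> X"
    "\<And>j k l x. \<bar>pd l (pd k (pd j chi)) x\<bar> \<le> X"
    and s: "s > 0"
  defines "f \<equiv> \<lambda>i x. phi x * u i x"
  defines "m \<equiv> (24 / kap) * (\<Sum>i\<in>UNIV. LBINT y. \<bar>f i y\<bar>)"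
  shows "\<bar>LBINT x. (\<Sum>i\<in>UNIV. pd i p x * f i x)\<bar>
    \<le> s * bint 8 (\<lambda>x. \<Sum>i\<in>UNIV. \<Sum>j\<in>UNIV. (F i j x)\<^sup>2)
      + ((LBINT x. chi x * (\<Sum>k\<in>UNIV. pd k (f k) x)\<^sup>2) + 162 * X * m\<^sup>2 * bint 8 (\<lambda>x::real^3. 1)) / s
      + 15 * (X * m) * (\<Sum>i\<in>UNIV. \<Sum>j\<in>UNIV. bint 8 (\<lambda>x. \<bar>F i j x\<bar>)) + 99 * (X * m) * (\<Sum>i\<in>UNIV. bint 8 (\<lambda>x. \<bar>u i x\<bar>))"
proof -
  define e where "e n = inverse (real (Suc n))" for n
  have e: "e n > 0" for n by (simp add: e_def)
  have e0: "e \<longlonglongrightarrow> 0" unfolding e_def by (rule LIMSEQ_inverse_real_of_nat)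
  have sf: "smooth (f i)" for i unfolding f_def by (intro smooth_rules smooth_phi su)
  have f2: "supported 2 (f i)" for i unfolding f_def by (intro supported_mult_left supported_phi)
  interpret T: solenoidal_test "e n" f for n by unfold_locales (rule e sf f2)+
  define g where "g = (\<lambda>x. \<Sum>k\<in>UNIV. pd k (f k) x)"
  have sg: "smooth g" and g2: "supported 2 g" unfolding g_def by (rule T.smooth_divf T.supported_divf)+
  have lim: "(\<lambda>n. LBINT x. w x * conv (bump (e n)) h x) \<longlonglongrightarrow> (LBINT x. w x * h x)"
    and lim2: "(\<lambda>n. LBINT x. w x * (conv (bump (e n)) h x)\<^sup>2) \<longlonglongrightarrow> (LBINT x. w x * (h x)\<^sup>2)"
    if w: "smooth w" "supported 8 w" and h: "smooth h" "supported 2 h" for w h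
  proof -
    obtain B where B: "B \<ge> 0" "\<And>x. \<bar>h x\<bar> \<le> B"
      using continuous_supported_bounded[OF smooth_continuous[OF h(1)] h(2)] by blast
    have b: "\<bar>conv (bump (e n)) h x\<bar> \<le> B" for n x
      by (rule conv_bump_bound[OF e smooth_continuous[OF h(1)] B(2)])
    have c: "smooth (conv (bump (e n)) h)" for n by (rule T.smooth_conv_bump[OF h])
    have l: "(\<lambda>n. conv (bump (e n)) h x) \<longlonglongrightarrow> h x" for x
      by (rule conv_bump_tendsto[OF smooth_continuous[OF h(1)] B(2) e e0])
    show "(\<lambda>n. LBINT x. w x * conv (bump (e n)) h x) \<longlonglongrightarrow> (LBINT x. w x * h x)"
      by (rule integral_mult_tendsto[OF smooth_continuous[OF w(1)] w(2) smooth_continuous[OF c] b l smooth_continuous[OF h(1)]])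
    show "(\<lambda>n. LBINT x. w x * (conv (bump (e n)) h x)\<^sup>2) \<longlonglongrightarrow> (LBINT x. w x * (h x)\<^sup>2)"
    proof (rule integral_mult_tendsto[OF smooth_continuous[OF w(1)] w(2)])
      show "\<bar>(conv (bump (e n)) h x)\<^sup>2\<bar> \<le> B\<^sup>2" for n x
        using power_mono[OF b[of n x] abs_ge_zero, of 2] by simp
      show "(\<lambda>n. (conv (bump (e n)) h x)\<^sup>2) \<longlonglongrightarrow> (h x)\<^sup>2" for x by (intro tendsto_intros l)
    qed (intro smooth_continuous smooth_rules c h)+
  qed
  have m: "T.mass = m" by (simp add: T.mass_def m_def)
  have "(\<lambda>n. \<bar>LBINT x. (\<Sum>i\<in>UNIV. pd i p x * (chi x * conv (bump (e n)) (f i) x))\<bar>) \<longlonglongrightarrow>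
     \<bar>\<Sum>i\<in>UNIV. LBINT x. (pd i p x * chi x) * f i x\<bar>"
  proof -
    have "(\<lambda>n. \<bar>\<Sum>i\<in>UNIV. LBINT x. (pd i p x * chi x) * conv (bump (e n)) (f i) x\<bar>) \<longlonglongrightarrow>
     \<bar>\<Sum>i\<in>UNIV. LBINT x. (pd i p x * chi x) * f i x\<bar>"
      by (intro tendsto_rabs tendsto_sum lim smooth_rules sp smooth_chi supported_mult_right supported_chi sf f2)
    moreover have "(LBINT x. (\<Sum>i\<in>UNIV. pd i p x * (chi x * conv (bump (e n)) (f i) x)))
       = (\<Sum>i\<in>UNIV. LBINT x. (pd i p x * chi x) * conv (bump (e n)) (f i) x)" for n
      by (subst integral_sum_smooth_supported[of _ _ 8])
         (intro smooth_rules sp smooth_chi T.smooth_conv_bump[OF sf f2] supported_mult_right supported_mult_left[OF supported_chi] |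
           simp add: mult.assoc)+
    ultimately show ?thesis by simp
  qed
  also have "(\<Sum>i\<in>UNIV. LBINT x. (pd i p x * chi x) * f i x) = (LBINT x. (\<Sum>i\<in>UNIV. pd i p x * f i x))"
  proof -
    have "(\<lambda>x. (pd i p x * chi x) * f i x) = (\<lambda>x. pd i p x * f i x)" for i
    proof
      fix x
      show "(pd i p x * chi x) * f i x = pd i p x * f i x"
        using f2[of i] cutoff_eq_1[of 4 8 x] by (cases "norm x \<le> 4") (auto simp: supported_def)
    qed
    then show ?thesis
      by (subst integral_sum_smooth_supported[of _ _ 2]) (simp | intro smooth_rules sp sf supported_mult_right f2)+
  qed
  finally have L: "(\<lambda>n. \<bar>LBINT x. (\<Sum>i\<in>UNIV. pd i p x * (chi x * conv (bump (e n)) (f i) x))\<bar>) \<longlonglongrightarrow>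
     \<bar>LBINT x. (\<Sum>i\<in>UNIV. pd i p x * f i x)\<bar>" .
  have "(\<lambda>n. \<bar>LBINT x. (\<Sum>i\<in>UNIV. pd i chi x * u i x) * conv (bump (e n)) g x\<bar>) \<longlonglongrightarrow> \<bar>LBINT x. (\<Sum>i\<in>UNIV. pd i chi x * u i x) * g x\<bar>"
    by (intro tendsto_rabs lim smooth_rules smooth_chi su supported_sum supported_mult_left supported_pd supported_chi sg g2)
  \<comment> \<open>The limit \<open>g\<close> of the mollified divergence vanishes for |x| > 2,
    whereas the derivatives of \<open>chi\<close> vanish for |x| < 4. For positive \<open>e\<close>
    the mollifier spreads \<open>g\<close> into the shell, so the product disappears only
    now.\<close>
  also have "(\<lambda>x. (\<Sum>i\<in>UNIV. pd i chi x * u i x) * g x) = (\<lambda>x. 0)"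
  proof
    fix x
    show "(\<Sum>i\<in>UNIV. pd i chi x * u i x) * g x = 0"
      using g2 T.chi_derivs_inner(1)[of x] by (cases "norm x < 4") (auto simp: supported_def)
  qed
  finally have L0: "(\<lambda>n. \<bar>LBINT x. (\<Sum>i\<in>UNIV. pd i chi x * u i x) * conv (bump (e n)) g x\<bar>) \<longlonglongrightarrow> 0" by simp
  define A where "A = s * bint 8 (\<lambda>x. \<Sum>i\<in>UNIV. \<Sum>j\<in>UNIV. (F i j x)\<^sup>2)"
  define B where "B = 15 * (X * m) * (\<Sum>i\<in>UNIV. \<Sum>j\<in>UNIV. bint 8 (\<lambda>x. \<bar>F i j x\<bar>)) + 99 * (X * m) * (\<Sum>i\<in>UNIV. bint 8 (\<lambda>x. \<bar>u i x\<bar>))"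
  define D where "D = 162 * X * m\<^sup>2 * bint 8 (\<lambda>x::real^3. 1)"
  have R: "(\<lambda>n. A + ((LBINT x. chi x * (conv (bump (e n)) g x)\<^sup>2) + D) / s + B + \<bar>LBINT x. (\<Sum>i\<in>UNIV. pd i chi x * u i x) * conv (bump (e n)) g x\<bar>)
     \<longlonglongrightarrow> A + ((LBINT x. chi x * (g x)\<^sup>2) + D) / s + B + 0"
    using s by (intro tendsto_intros L0 lim2 smooth_chi supported_chi sg g2) auto
  have "\<bar>LBINT x. (\<Sum>i\<in>UNIV. pd i p x * f i x)\<bar> \<le> A + ((LBINT x. chi x * (g x)\<^sup>2) + D) / s + B + 0"
  proof (rule LIMSEQ_le[OF L R], intro exI[of _ 0] allI impI)
    fix n
    show "\<bar>LBINT x. (\<Sum>i\<in>UNIV. pd i p x * (chi x * conv (bump (e n)) (f i) x))\<bar>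
      \<le> A + ((LBINT x. chi x * (conv (bump (e n)) g x)\<^sup>2) + D) / s + B + \<bar>LBINT x. (\<Sum>i\<in>UNIV. pd i chi x * u i x) * conv (bump (e n)) g x\<bar>"
      using T.pressure_work_eps[OF su sF sp mom div X s, of n]
      unfolding A_def B_def D_def m g_def by linarith
  qed
  then show ?thesis unfolding A_def B_def D_def g_def by linarith
qed


lemma finite_family_bounded:
  fixes h :: "'i::finite \<Rightarrow> 'a::euclidean_space \<Rightarrow> real"
  assumes "\<And>i. continuous_on UNIV (h i)" "\<And>i. supported r (h i)"
  shows "\<exists>X\<ge>0. \<forall>i x. \<bar>h i x\<bar> \<le> X"
proof -
  have "\<exists>B. B \<ge> 0 \<and> (\<forall>x. \<bar>h i x\<bar> \<le> B)" for i
    using continuous_supported_bounded[OF assms, of i] by metis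
  then obtain B where B: "\<And>i. B i \<ge> 0" "\<And>i x. \<bar>h i x\<bar> \<le> B i" by metis
  have "\<bar>h i x\<bar> \<le> sum B UNIV" for i x
    using B(2)[of i x] member_le_sum[of i UNIV B] B(1) by auto
  then show ?thesis using B(1) by (intro exI[of _ "sum B UNIV"]) (auto intro: sum_nonneg)
qed

text \<open>Order three is reached because \<open>remf2\<close> differentiates \<open>shellf\<close>
  twice and \<open>shellf\<close> already contains a derivative of \<open>chi\<close>.\<close>

lemma derivatives_bounded:
  fixes w :: "real^'n::finite \<Rightarrow> real"
  assumes "smooth w" "supported r w"
  obtains X where "X \<ge> 0" "\<And>j x. \<bar>pd j w x\<bar> \<le> X" "\<And>j k x. \<bar>pd k (pd j w) x\<bar> \<le> X"
    "\<And>j k l x. \<bar>pd l (pd k (pd j w)) x\<bar> \<le> X"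
proof -
  have *: "continuous_on UNIV (pd j w)" "continuous_on UNIV (pd k (pd j w))"
    "continuous_on UNIV (pd l (pd k (pd j w)))"
    "supported r (pd j w)" "supported r (pd k (pd j w))"
    "supported r (pd l (pd k (pd j w)))" for j k l
    by (intro smooth_continuous smooth_pd supported_pd assms)+
  have "\<exists>X\<ge>0. \<forall>i x. \<bar>pd i w x\<bar> \<le> X"
    by (rule finite_family_bounded[of _ r]) (rule *)+
  then obtain A where A: "A \<ge> 0" "\<And>j x. \<bar>pd j w x\<bar> \<le> A" by blast
  have "\<exists>X\<ge>0. \<forall>i x. \<bar>(case i of (j, k) \<Rightarrow> pd k (pd j w)) x\<bar> \<le> X"
    by (rule finite_family_bounded[of _ r]) (auto intro: *)
  then obtain B where B: "\<And>j k x. \<bar>pd k (pd j w) x\<bar> \<le> B" by (metis (no_types, lifting) case_prod_conv)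
  have "\<exists>X\<ge>0. \<forall>i x. \<bar>(case i of (j, k, l) \<Rightarrow> pd l (pd k (pd j w))) x\<bar> \<le> X"
    by (rule finite_family_bounded[of _ r]) (auto intro: *)
  then obtain C where C: "\<And>j k l x. \<bar>pd l (pd k (pd j w)) x\<bar> \<le> C"
    by (metis (no_types, lifting) case_prod_conv)
  show ?thesis
    by (rule that[of "max A (max B C)"]) (use A B C in \<open>auto simp: le_max_iff_disj\<close>)
qed

lemma sum3_mean_square_le:
  fixes w :: "3 \<Rightarrow> 'a::euclidean_space \<Rightarrow> real"
  assumes "\<And>i. continuous_on UNIV (w i)" and r: "r > 0"
  shows "(\<Sum>i\<in>(UNIV::3 set). bint r (\<lambda>x. \<bar>w i x\<bar>))\<^sup>2
    \<le> 3 * bint r (\<lambda>x::'a. 1) * (\<Sum>i\<in>UNIV. bint r (\<lambda>x. (w i x)\<^sup>2))"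
proof -
  have "(\<Sum>i\<in>(UNIV::3 set). bint r (\<lambda>x. \<bar>w i x\<bar>))\<^sup>2 \<le> 3 * (\<Sum>i\<in>UNIV. (bint r (\<lambda>x. \<bar>w i x\<bar>))\<^sup>2)"
    by (rule sum3_square_le)
  also have "\<dots> \<le> 3 * (\<Sum>i\<in>UNIV. bint r (\<lambda>x::'a. 1) * bint r (\<lambda>x. (w i x)\<^sup>2))"
    by (intro mult_left_mono sum_mono bint_abs_square assms) auto
  finally show ?thesis by (simp add: sum_distrib_left mult.assoc)
qed

text \<open>The constant depends only on the cutoffs and the kernel, so that one constant serves all
  rescaled solutions. The L^1 quantities \<open>m\<close>, \<open>U1\<close> and \<open>F1\<close>
  become L^2 quantities by Cauchy--Schwarz on the ball of radius 8, and the mixed product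
  \<open>m * F1\<close> is split with the same weight \<open>s\<close>.\<close>

lemma pressure_work_estimate:
  "\<exists>C>0. \<forall>u F p s. (\<forall>i. smooth (u i)) \<longrightarrow> (\<forall>i j. smooth (F i j)) \<longrightarrow> smooth p \<longrightarrow>
     (\<forall>i x. (\<Sum>j\<in>UNIV. pd j (F i j) x) - lap (u i) x = - pd i p x) \<longrightarrow>
     (\<forall>x. dvg u x = 0) \<longrightarrow> s > 0 \<longrightarrow>
     \<bar>LBINT x. (\<Sum>i\<in>UNIV. pd i p x * (phi x * u i x))\<bar>
       \<le> C * (s * bint 8 (\<lambda>x. \<Sum>i\<in>UNIV. \<Sum>j\<in>UNIV. (F i j x)\<^sup>2) + (1 + 1 / s) * bint 8 (\<lambda>x. \<Sum>i\<in>UNIV. (u i x)\<^sup>2))"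
proof -
  obtain X1 where X1: "X1 \<ge> 0" "\<And>j x. \<bar>pd j chi x\<bar> \<le> X1" "\<And>j k x. \<bar>pd k (pd j chi) x\<bar> \<le> X1"
    "\<And>j k l x. \<bar>pd l (pd k (pd j chi)) x\<bar> \<le> X1"
    by (rule derivatives_bounded[OF smooth_chi supported_chi]) (rule that; assumption | blast)
  obtain X2 where X2: "X2 \<ge> 0" "\<And>j x. \<bar>pd j phi x\<bar> \<le> X2" "\<And>j k x. \<bar>pd k (pd j phi) x\<bar> \<le> X2"
    "\<And>j k l x. \<bar>pd l (pd k (pd j phi)) x\<bar> \<le> X2"
    by (rule derivatives_bounded[OF smooth_phi supported_phi]) (rule that; assumption | blast)
  define X where "X = max X1 X2"
  have X: "X \<ge> 0" "\<And>j x. \<bar>pd j chi x\<bar> \<le> X" "\<And>j k x. \<bar>pd k (pd j chi) x\<bar> \<le> X"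
    "\<And>j k l x. \<bar>pd l (pd k (pd j chi)) x\<bar> \<le> X" "\<And>j x. \<bar>pd j phi x\<bar> \<le> X"
    using X1 X2(1,2) by (auto simp: X_def le_max_iff_disj)
  define K where "K = 24 / kap"
  have K: "K > 0" using kap_pos by (simp add: K_def)
  define V where "V = bint 8 (\<lambda>x::real^3. 1)"
  have V: "V \<ge> 0" unfolding V_def by (rule bint_nonneg) simp
  \<comment> \<open>The coefficients collected at the end: 486 = 162 * 3, 135 = 15 * 9, 45 = 15 * 3
    and 297 = 99 * 3, where 3 and 9 are the numbers of components of \<open>u\<close> and
    \<open>F\<close> in the Cauchy--Schwarz step.\<close>
  define C where "C = 1 + 3 * X\<^sup>2 + 486 * X * K\<^sup>2 * V\<^sup>2 + 135 * X * V + 45 * X * K\<^sup>2 * V + 297 * X * K * V"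
  have pos: "0 \<le> 3 * X\<^sup>2" "0 \<le> 486 * X * K\<^sup>2 * V\<^sup>2" "0 \<le> 135 * X * V" "0 \<le> 45 * X * K\<^sup>2 * V" "0 \<le> 297 * X * K * V"
    using X(1) K V by auto
  have C0: "C > 0" using pos unfolding C_def by linarith
  show ?thesis
  proof (intro exI[of _ C] conjI C0 allI impI)
    fix u :: "3 \<Rightarrow> real^3 \<Rightarrow> real" and F :: "3 \<Rightarrow> 3 \<Rightarrow> real^3 \<Rightarrow> real" and p and s :: real
    assume su: "\<forall>i. smooth (u i)" and sF: "\<forall>i j. smooth (F i j)" and sp: "smooth p"
      and mom: "\<forall>i x. (\<Sum>j\<in>UNIV. pd j (F i j) x) - lap (u i) x = - pd i p x"
      and div: "\<forall>x. dvg u x = 0" and s: "s > 0"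
    note su = su[rule_format] and sF = sF[rule_format] and mom = mom[rule_format] and div = div[rule_format]
    define f where "f = (\<lambda>i x. phi x * u i x)"
    define m where "m = K * (\<Sum>i\<in>UNIV. LBINT y. \<bar>f i y\<bar>)"
    define U2 where "U2 = bint 8 (\<lambda>x. \<Sum>i\<in>UNIV. (u i x)\<^sup>2)"
    define F2 where "F2 = bint 8 (\<lambda>x. \<Sum>i\<in>UNIV. \<Sum>j\<in>UNIV. (F i j x)\<^sup>2)"
    define U1 where "U1 = (\<Sum>i\<in>UNIV. bint 8 (\<lambda>x. \<bar>u i x\<bar>))"
    define F1 where "F1 = (\<Sum>i\<in>UNIV. \<Sum>j\<in>UNIV. bint 8 (\<lambda>x. \<bar>F i j x\<bar>))"
    have U2: "U2 \<ge> 0" "F2 \<ge> 0" unfolding U2_def F2_def by (intro bint_nonneg sum_nonneg zero_le_power2)+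
    have U1: "U1 \<ge> 0" unfolding U1_def by (intro sum_nonneg bint_nonneg) simp
    note co = smooth_continuous[OF su] smooth_continuous[OF sF]
    have U12: "U1\<^sup>2 \<le> 3 * V * U2"
      using sum3_mean_square_le[of u 8, OF co(1)]
      unfolding U1_def U2_def V_def by (subst bint_sum) (auto intro!: continuous_intros co)
    have F12: "F1\<^sup>2 \<le> 9 * V * F2"
    proof -
      have "F1\<^sup>2 \<le> 3 * (\<Sum>i\<in>UNIV. (\<Sum>j\<in>UNIV. bint 8 (\<lambda>x. \<bar>F i j x\<bar>))\<^sup>2)"
        unfolding F1_def by (rule sum3_square_le)
      also have "\<dots> \<le> 3 * (\<Sum>i\<in>UNIV. 3 * V * (\<Sum>j\<in>UNIV. bint 8 (\<lambda>x. (F i j x)\<^sup>2)))"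
        unfolding V_def by (intro mult_left_mono sum_mono sum3_mean_square_le co) auto
      also have "\<dots> = 9 * V * (\<Sum>i\<in>UNIV. \<Sum>j\<in>UNIV. bint 8 (\<lambda>x. (F i j x)\<^sup>2))"
        by (simp add: sum_distrib_left mult.assoc)
      also have "(\<Sum>i\<in>UNIV. \<Sum>j\<in>UNIV. bint 8 (\<lambda>x. (F i j x)\<^sup>2)) = F2"
        unfolding F2_def by (subst bint_sum, (intro continuous_intros co)+)+ rule
      finally show ?thesis .
    qed
    have mU: "m \<le> K * U1"
      unfolding m_def U1_def
    proof (intro mult_left_mono sum_mono)
      fix i
      have "(LBINT y. \<bar>f i y\<bar>) = bint 8 (\<lambda>y. \<bar>f i y\<bar>)"
        using supported_phi by (intro integral_supported_eq_bint) (auto simp: f_def supported_def)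
      also have "\<dots> \<le> bint 8 (\<lambda>y. \<bar>u i y\<bar>)"
      proof (intro bint_mono continuous_intros co)
        show "continuous_on UNIV (f i)" unfolding f_def by (intro continuous_intros co smooth_continuous smooth_phi)
        show "\<bar>f i y\<bar> \<le> \<bar>u i y\<bar>" for y
          using mult_right_mono[OF cutoff_bounds(2)[of 1 2 y] abs_ge_zero[of "u i y"]] cutoff_bounds(1)[of 1 2 y]
          by (simp add: f_def abs_mult)
      qed
      finally show "(LBINT y. \<bar>f i y\<bar>) \<le> bint 8 (\<lambda>y. \<bar>u i y\<bar>)" .
    qed (use K in auto)
    have m0: "m \<ge> 0" unfolding m_def using K by (intro mult_nonneg_nonneg sum_nonneg) (auto intro: integral_nonneg_AE)
    have m2: "m\<^sup>2 \<le> 3 * K\<^sup>2 * V * U2"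
    proof -
      have "m\<^sup>2 \<le> (K * U1)\<^sup>2" by (rule power_mono[OF mU m0])
      also have "\<dots> = K\<^sup>2 * U1\<^sup>2" by (simp add: power_mult_distrib)
      also have "\<dots> \<le> K\<^sup>2 * (3 * V * U2)" by (intro mult_left_mono U12) simp
      finally show ?thesis by simp
    qed
    have mU1: "m * U1 \<le> 3 * K * V * U2"
    proof -
      have "m * U1 \<le> (K * U1) * U1" by (rule mult_right_mono[OF mU U1])
      also have "\<dots> = K * U1\<^sup>2" by (simp add: power2_eq_square)
      also have "\<dots> \<le> K * (3 * V * U2)" using K by (intro mult_left_mono U12) simp
      finally show ?thesis by simp
    qed
    have mF1: "m * F1 \<le> s * (9 * V * F2) + (3 * K\<^sup>2 * V * U2) / s"
    proof -
      have "m * F1 \<le> \<bar>F1 * m\<bar>" by (simp add: mult.commute)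
      also have "\<dots> \<le> s * F1\<^sup>2 + m\<^sup>2 / s" by (rule young_mult[OF s])
      also have "\<dots> \<le> s * (9 * V * F2) + (3 * K\<^sup>2 * V * U2) / s"
        using s by (intro add_mono mult_left_mono divide_right_mono F12 m2) auto
      finally show ?thesis .
    qed
    define g where "g = (\<lambda>x. \<Sum>k\<in>UNIV. pd k (f k) x)"
    have gx: "g x = (\<Sum>k\<in>UNIV. pd k phi x * u k x)" for x
      unfolding g_def f_def using div[of x]
      by (simp add: pd_mult[OF smooth_phi su] sum.distrib sum_distrib_left[symmetric])
    have sg: "smooth g" unfolding gx[abs_def] by (intro smooth_rules smooth_phi su)
    have G: "(LBINT x. chi x * (g x)\<^sup>2) \<le> 3 * X\<^sup>2 * U2"
    proof -
      have "(LBINT x. chi x * (g x)\<^sup>2) \<le> bint 8 (\<lambda>x. (g x)\<^sup>2)"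
        by (intro bint_cutoff_le smooth_rules sg) simp
      also have "\<dots> \<le> bint 8 (\<lambda>x. 3 * X\<^sup>2 * (\<Sum>k\<in>UNIV. (u k x)\<^sup>2))"
      proof (intro bint_mono continuous_intros co smooth_continuous sg)
        fix x
        have "(g x)\<^sup>2 \<le> 3 * (\<Sum>k\<in>UNIV. (pd k phi x * u k x)\<^sup>2)" unfolding gx by (rule sum3_square_le)
        also have "\<dots> \<le> 3 * (\<Sum>k\<in>UNIV. X\<^sup>2 * (u k x)\<^sup>2)"
          using power_mono[OF X(5) abs_ge_zero, of _ x 2]
          by (intro mult_left_mono sum_mono) (auto simp: power_mult_distrib intro!: mult_right_mono)
        finally show "(g x)\<^sup>2 \<le> 3 * X\<^sup>2 * (\<Sum>k\<in>UNIV. (u k x)\<^sup>2)" by (simp add: sum_distrib_left mult.assoc)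
      qed
      also have "\<dots> = 3 * X\<^sup>2 * U2" unfolding U2_def by (rule bint_cmult)
      finally show ?thesis .
    qed
    have "\<bar>LBINT x. (\<Sum>i\<in>UNIV. pd i p x * f i x)\<bar>
      \<le> s * F2 + ((LBINT x. chi x * (g x)\<^sup>2) + 162 * X * m\<^sup>2 * V) / s + 15 * (X * m) * F1 + 99 * (X * m) * U1"
      using pressure_work_mass[OF su sF sp mom div X(2-4) s]
      by (simp only: f_def m_def K_def F2_def g_def V_def F1_def U1_def)
    also have "\<dots> = s * F2 + ((LBINT x. chi x * (g x)\<^sup>2) + (162 * X * V) * m\<^sup>2) / s + (15 * X) * (m * F1) + (99 * X) * (m * U1)"
      by (simp add: mult_ac)
    also have "\<dots> \<le> s * F2 + (3 * X\<^sup>2 * U2 + (162 * X * V) * (3 * K\<^sup>2 * V * U2)) / s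
       + (15 * X) * (s * (9 * V * F2) + (3 * K\<^sup>2 * V * U2) / s) + (99 * X) * (3 * K * V * U2)"
      using s X(1) V by (intro add_mono mult_left_mono divide_right_mono order_refl G m2 mF1 mU1) auto
    also have "\<dots> = (1 + 135 * X * V) * (s * F2) + (3 * X\<^sup>2 + 486 * X * K\<^sup>2 * V\<^sup>2 + 45 * X * K\<^sup>2 * V) * (U2 / s) + (297 * X * K * V) * U2"
      by (simp add: algebra_simps add_divide_distrib power2_eq_square)
    also have "\<dots> \<le> C * (s * F2) + C * (U2 / s) + C * U2"
      using s U2 by (intro add_mono mult_right_mono) (use pos in \<open>auto simp: C_def\<close>)
    also have "\<dots> = C * (s * F2 + (1 + 1 / s) * U2)" by (simp add: algebra_simps)
    finally show "\<bar>LBINT x. (\<Sum>i\<in>UNIV. pd i p x * (phi x * u i x))\<bar>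
       \<le> C * (s * bint 8 (\<lambda>x. \<Sum>i\<in>UNIV. \<Sum>j\<in>UNIV. (F i j x)\<^sup>2) + (1 + 1 / s) * bint 8 (\<lambda>x. \<Sum>i\<in>UNIV. (u i x)\<^sup>2))"
      by (simp only: f_def F2_def U2_def)
  qed
qed

section \<open>The local energy inequality\<close>

text \<open>The system in components, solved for the Laplacians so that they can be substituted
  directly in the energy identity.\<close>

definition mhd :: "(3 \<Rightarrow> real^3 \<Rightarrow> real) \<Rightarrow> (3 \<Rightarrow> real^3 \<Rightarrow> real) \<Rightarrow> (real^3 \<Rightarrow> real) \<Rightarrow> bool" where
  "mhd u h p \<longleftrightarrow> (\<forall>i. smooth (u i)) \<and> (\<forall>i. smooth (h i)) \<and> smooth p \<and>
    (\<forall>x. dvg u x = 0) \<and> (\<forall>x. dvg h x = 0) \<and>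
    (\<forall>i x. lap (u i) x =
       (\<Sum>j\<in>UNIV. u j x * pd j (u i) x) - (\<Sum>j\<in>UNIV. h j x * pd j (h i) x) + pd i p x) \<and>
    (\<forall>i x. lap (h i) x =
       (\<Sum>j\<in>UNIV. u j x * pd j (h i) x) - (\<Sum>j\<in>UNIV. h j x * pd j (u i) x))"

definition grad_sq :: "(3 \<Rightarrow> real^3 \<Rightarrow> real) \<Rightarrow> (3 \<Rightarrow> real^3 \<Rightarrow> real) \<Rightarrow> real^3 \<Rightarrow> real" where
  "grad_sq u h x = (\<Sum>i\<in>UNIV. \<Sum>j\<in>UNIV. (pd j (u i) x)\<^sup>2 + (pd j (h i) x)\<^sup>2)"

definition mod_sq :: "(3 \<Rightarrow> real^3 \<Rightarrow> real) \<Rightarrow> (3 \<Rightarrow> real^3 \<Rightarrow> real) \<Rightarrow> real^3 \<Rightarrow> real" where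
  "mod_sq u h x = (\<Sum>i\<in>UNIV. (u i x)\<^sup>2 + (h i x)\<^sup>2)"

lemma mod_sq_nonneg: "mod_sq u h x \<ge> 0" and grad_sq_nonneg: "grad_sq u h x \<ge> 0"
  unfolding mod_sq_def grad_sq_def by (intro sum_nonneg add_nonneg_nonneg zero_le_power2)+

text \<open>The first equation is tested with phi u and the second with phi h, and the results are
  added. The magnetic terms do not cancel one by one, but u . (h . grad h) + h . (h . grad u) = h .
  grad (u . h), which is again a transport term; this is where \<open>P\<close> comes from. The work
  of the pressure is left for its own estimate.\<close>

lemma energy_identity:
  assumes mhd: "mhd u h p"
  defines "Q \<equiv> mod_sq u h" and "P \<equiv> \<lambda>x. \<Sum>k\<in>UNIV. u k x * h k x"
  shows "(LBINT x. phi x * grad_sq u h x) =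
    (\<integral>x. Q x * lap phi x / 2 + Q x * (\<Sum>j\<in>UNIV. u j x * pd j phi x) / 2
       - P x * (\<Sum>j\<in>UNIV. h j x * pd j phi x) \<partial>lborel)
    - (LBINT x. (\<Sum>i\<in>UNIV. pd i p x * (phi x * u i x)))"
proof -
  have su: "smooth (u i)" and sh: "smooth (h i)" and sp: "smooth p" for i using mhd by (auto simp: mhd_def)
  have du: "dvg u x = 0" and dh: "dvg h x = 0" for x
    using mhd by (auto simp: mhd_def)
  note sm = smooth_rules smooth_phi su sh sp
  have Qd: "Q = (\<lambda>x. \<Sum>i\<in>UNIV. (u i x)\<^sup>2 + (h i x)\<^sup>2)" by (simp add: Q_def mod_sq_def[abs_def])
  have sQ: "smooth Q" unfolding Qd by (intro sm)
  have sP: "smooth P" unfolding P_def by (intro sm)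
  have sG: "smooth (grad_sq u h)" unfolding grad_sq_def[abs_def] by (intro sm)
  \<comment> \<open>The first two terms are Green's identity for \<open>Q / 2\<close> and
    \<open>phi\<close>. The other two carry the transport of \<open>Q / 2\<close> by
    \<open>u\<close> and of \<open>P\<close> by \<open>h\<close>, whose divergences produce only
    derivatives of \<open>phi\<close> besides the transport terms since \<open>u\<close> and
    \<open>h\<close> are solenoidal.\<close>
  define D where "D j x = phi x * (pd j Q x / 2) - (Q x / 2) * pd j phi x - phi x * (u j x * (Q x / 2)) + phi x * (h j x * P x)" for j x
  have half: "smooth (\<lambda>x. Q x / 2)" "smooth (\<lambda>x. pd j Q x / 2)" for j
    using smooth_mult[OF smooth_const[of "1/2"] sQ] smooth_mult[OF smooth_const[of "1/2"] smooth_pd[OF sQ]] by simp_all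
  have pdhalf: "pd i (\<lambda>x. Q x / 2) = (\<lambda>x. pd i Q x / 2)"
    "pd i (\<lambda>x. pd j Q x / 2) = (\<lambda>x. pd i (pd j Q) x / 2)" for i j
    using pd_cmult[OF sQ, of i "1/2"] pd_cmult[OF smooth_pd[OF sQ], of i "1/2"] by simp_all
  have sD: "smooth (D j)" for j unfolding D_def[abs_def] by (intro sm sQ sP half)
  have D2: "supported 2 (D j)" for j unfolding D_def[abs_def]
    by (intro supported_add supported_diff supported_mult_left[OF supported_phi] supported_mult_right supported_pd supported_phi)
  define B where "B x = Q x * lap phi x / 2 + Q x * (\<Sum>j\<in>UNIV. u j x * pd j phi x) / 2
       - P x * (\<Sum>j\<in>UNIV. h j x * pd j phi x)" for x
  define W where "W x = (\<Sum>i\<in>UNIV. pd i p x * (phi x * u i x))" for x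
  have Balt: "B = (\<lambda>x. (Q x / 2) * lap phi x + (Q x / 2) * (\<Sum>j\<in>UNIV. u j x * pd j phi x)
       - P x * (\<Sum>j\<in>UNIV. h j x * pd j phi x))" by (simp add: B_def fun_eq_iff)
  have pt: "dvg D x = phi x * grad_sq u h x - B x + W x" for x
  proof -
    have dQ: "pd j Q = (\<lambda>x. \<Sum>k\<in>UNIV. 2 * (u k x * pd j (u k) x) + 2 * (h k x * pd j (h k) x))" for j
      unfolding Qd power2_eq_square
      by (simp add: pd_sum[OF smooth_add[OF smooth_mult[OF su su] smooth_mult[OF sh sh]]] pd_add[OF smooth_mult[OF su su] smooth_mult[OF sh sh]]
         pd_mult[OF su su] pd_mult[OF sh sh] mult.commute)
    have ddQ: "pd j (pd j Q) x = (\<Sum>k\<in>UNIV. 2 * ((pd j (u k) x)\<^sup>2 + u k x * pd j (pd j (u k)) x)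
        + 2 * ((pd j (h k) x)\<^sup>2 + h k x * pd j (pd j (h k)) x))" for j
    proof -
      have s: "smooth (\<lambda>x. u k x * pd j (u k) x)" "smooth (\<lambda>x. h k x * pd j (h k) x)"
        "smooth (\<lambda>x. 2 * (u k x * pd j (u k) x))" "smooth (\<lambda>x. 2 * (h k x * pd j (h k) x))" for k by (intro sm)+
      show ?thesis unfolding dQ
        by (simp only: pd_sum[OF smooth_add[OF s(3,4)]] pd_add[OF s(3,4)] pd_cmult[OF s(1)] pd_cmult[OF s(2)]
           pd_mult[OF su smooth_pd[OF su]] pd_mult[OF sh smooth_pd[OF sh]] power2_eq_square)
    qed
    have lap: "lap Q x = 2 * grad_sq u h x
        + 2 * (\<Sum>k\<in>UNIV. u k x * lap (u k) x)
        + 2 * (\<Sum>k\<in>UNIV. h k x * lap (h k) x)"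
      unfolding ddQ grad_sq_def by (simp add: sum_3 algebra_simps)
    have dP: "pd j P x = (\<Sum>k\<in>UNIV. pd j (u k) x * h k x + u k x * pd j (h k) x)" for j
      unfolding P_def by (simp add: pd_sum[OF smooth_mult[OF su sh]] pd_mult[OF su sh])
    have dD: "pd j (D j) x = phi x * pd j (pd j Q) x / 2 - (Q x / 2) * pd j (pd j phi) x
        - pd j phi x * (u j x * (Q x / 2)) - phi x * (pd j (u j) x * (Q x / 2)) - phi x * (u j x * pd j Q x) / 2
        + pd j phi x * (h j x * P x) + phi x * (pd j (h j) x * P x) + phi x * (h j x * pd j P x)" for j
    proof -
      have s: "smooth (\<lambda>x. phi x * (pd j Q x / 2))" "smooth (\<lambda>x. (Q x / 2) * pd j phi x)"
        "smooth (\<lambda>x. phi x * (u j x * (Q x / 2)))" "smooth (\<lambda>x. phi x * (h j x * P x))"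
        "smooth (\<lambda>x. u j x * (Q x / 2))" "smooth (\<lambda>x. h j x * P x)" by (intro sm sQ sP half)+
      show ?thesis unfolding D_def[abs_def]
        by (simp only: pd_add[OF smooth_diff[OF smooth_diff[OF s(1,2)] s(3)] s(4)] pd_diff[OF smooth_diff[OF s(1,2)] s(3)] pd_diff[OF s(1,2)]
          pd_mult[OF smooth_phi half(2)] pd_mult[OF half(1) smooth_pd[OF smooth_phi]] pd_mult[OF smooth_phi s(5)] pd_mult[OF smooth_phi s(6)]
          pd_mult[OF su half(1)] pd_mult[OF sh sP] pdhalf) (simp add: algebra_simps)
    qed
    have "dvg D x = phi x * lap Q x / 2 - B x
       - phi x * (dvg u x * (Q x / 2)) - phi x * (\<Sum>j\<in>UNIV. u j x * pd j Q x) / 2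
       + phi x * (dvg h x * P x) + phi x * (\<Sum>j\<in>UNIV. h j x * pd j P x)"
      unfolding dD B_def by (simp add: sum_3 field_simps)
    also have "\<dots> = phi x * (grad_sq u h x
        + (\<Sum>k\<in>UNIV. u k x * lap (u k) x)
        + (\<Sum>k\<in>UNIV. h k x * lap (h k) x)) - B x
        - phi x * (\<Sum>j\<in>UNIV. u j x * pd j Q x) / 2 + phi x * (\<Sum>j\<in>UNIV. h j x * pd j P x)"
      unfolding lap du dh by (simp add: field_simps)
    finally have eq: "dvg D x = \<dots>" .
    have lu: "lap (u k) x =
       (\<Sum>j\<in>UNIV. u j x * pd j (u k) x) - (\<Sum>j\<in>UNIV. h j x * pd j (h k) x) + pd k p x" for k
      using mhd by (simp add: mhd_def)
    have lh: "lap (h k) x =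
       (\<Sum>j\<in>UNIV. u j x * pd j (h k) x) - (\<Sum>j\<in>UNIV. h j x * pd j (u k) x)" for k
      using mhd by (simp add: mhd_def)
    show ?thesis unfolding eq lu lh unfolding dQ dP W_def by (simp add: sum_3 field_simps)
  qed
  have int: "integrable lborel w" if "smooth w" "supported 2 w" for w :: "real^3 \<Rightarrow> real"
    by (rule integrable_smooth_supported[OF that])
  have iB: "integrable lborel B" unfolding Balt
    by (rule int; intro sm sQ sP half supported_diff supported_add supported_mult_right supported_sum supported_pd supported_phi)
  have iW: "integrable lborel W" unfolding W_def[abs_def]
    by (rule int; intro sm supported_sum supported_mult_right[OF supported_mult_left[OF supported_phi]])
  have iG: "integrable lborel (\<lambda>x. phi x * grad_sq u h x)"
    by (rule int; intro sm sG supported_mult_left supported_phi)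
  have "0 = (LBINT x. phi x * grad_sq u h x - B x + W x)"
    using divergence_integral_eq_0[of D 2, OF sD D2] by (simp add: pt)
  also have "\<dots> = (LBINT x. phi x * grad_sq u h x) - (LBINT x. B x) + (LBINT x. W x)"
    using iB iW iG by simp
  finally show ?thesis unfolding B_def W_def by linarith
qed

text \<open>The cubic boundary terms are split by Young's inequality into
  \<open>s * (Q x)\<^sup>2\<close> and \<open>Q x / s\<close>, matching the form of the pressure
  estimate with the same \<open>s\<close>. The factor 5 generously covers the coefficients 3/2 and
  9/2 that result.\<close>

lemma unit_energy_estimate:
  "\<exists>C>0. \<forall>u h p s. mhd u h p \<longrightarrow> s > 0 \<longrightarrow>
     bint 1 (grad_sq u h) \<le> C * (s * bint 8 (\<lambda>x. (mod_sq u h x)\<^sup>2) + (1 + 1 / s) * bint 8 (mod_sq u h))"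
proof -
  obtain C1 where C1: "C1 > 0" and work: "\<forall>u F p s. (\<forall>i. smooth (u i)) \<longrightarrow> (\<forall>i j. smooth (F i j)) \<longrightarrow> smooth p \<longrightarrow>
     (\<forall>i x. (\<Sum>j\<in>UNIV. pd j (F i j) x) - lap (u i) x = - pd i p x) \<longrightarrow>
     (\<forall>x. dvg u x = 0) \<longrightarrow> s > 0 \<longrightarrow>
     \<bar>LBINT x. (\<Sum>i\<in>UNIV. pd i p x * (phi x * u i x))\<bar>
       \<le> C1 * (s * bint 8 (\<lambda>x. \<Sum>i\<in>UNIV. \<Sum>j\<in>UNIV. (F i j x)\<^sup>2) + (1 + 1 / s) * bint 8 (\<lambda>x. \<Sum>i\<in>UNIV. (u i x)\<^sup>2))"
    using pressure_work_estimate by (elim exE conjE)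
  obtain X where X: "X \<ge> 0" "\<And>j x. \<bar>pd j phi x\<bar> \<le> X" "\<And>j k x. \<bar>pd k (pd j phi) x\<bar> \<le> X"
    "\<And>j k l x. \<bar>pd l (pd k (pd j phi)) x\<bar> \<le> X"
    by (rule derivatives_bounded[OF smooth_phi supported_phi]) (rule that; assumption | blast)
  define C where "C = 5 * X + 2 * C1"
  have C0: "C > 0" using X C1 by (simp add: C_def add_nonneg_pos)
  show ?thesis
  proof (intro exI[of _ C] conjI C0 allI impI)
    fix u h p and s :: real
    assume mhd: "mhd u h p" and s: "s > 0"
    have su: "smooth (u i)" and sh: "smooth (h i)" and sp: "smooth p" for i using mhd by (auto simp: mhd_def)
    have du: "dvg u x = 0" and dh: "dvg h x = 0" for x
      using mhd by (auto simp: mhd_def)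
    note sm = smooth_rules smooth_phi su sh sp
    define Q where "Q = mod_sq u h"
    define P where "P = (\<lambda>x. \<Sum>k\<in>UNIV. u k x * h k x)"
    have Q0: "Q x \<ge> 0" for x unfolding Q_def by (rule mod_sq_nonneg)
    have sQ: "smooth Q" unfolding Q_def mod_sq_def[abs_def] by (intro sm)
    have sP: "smooth P" unfolding P_def by (intro sm)
    have sG: "smooth (grad_sq u h)" unfolding grad_sq_def[abs_def] by (intro sm)
    define A where "A = s * bint 8 (\<lambda>x. (Q x)\<^sup>2) + (1 + 1 / s) * bint 8 Q"
    \<comment> \<open>Reynolds stress minus Maxwell stress. Since both fields are solenoidal, its
      divergence is the whole nonlinearity of the momentum equation, so both nonlinear terms enter
      the pressure estimate through one tensor.\<close>
    define F where "F i j x = u i x * u j x - h i x * h j x" for i j x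
    have sF: "smooth (F i j)" for i j unfolding F_def[abs_def] by (intro sm)
    have dF: "(\<Sum>j\<in>UNIV. pd j (F i j) x) - lap (u i) x = - pd i p x" for i x
    proof -
      have "(\<Sum>j\<in>UNIV. pd j (F i j) x) = (\<Sum>j\<in>UNIV. u j x * pd j (u i) x) + u i x * dvg u x
         - ((\<Sum>j\<in>UNIV. h j x * pd j (h i) x) + h i x * dvg h x)"
        unfolding F_def[abs_def]
        by (simp add: pd_diff[OF smooth_mult[OF su su] smooth_mult[OF sh sh]] pd_mult[OF su su] pd_mult[OF sh sh]
          sum.distrib sum_subtractf sum_distrib_left mult.commute)
      moreover have "lap (u i) x =
         (\<Sum>j\<in>UNIV. u j x * pd j (u i) x) - (\<Sum>j\<in>UNIV. h j x * pd j (h i) x) + pd i p x"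
        using mhd by (simp add: mhd_def)
      ultimately show ?thesis by (simp add: du dh)
    qed
    have Fb: "bint 8 (\<lambda>x. \<Sum>i\<in>UNIV. \<Sum>j\<in>UNIV. (F i j x)\<^sup>2) \<le> bint 8 (\<lambda>x. 2 * (Q x)\<^sup>2)"
    proof (intro bint_mono smooth_continuous sm sF sQ)
      fix x
      define a b where "a = (\<Sum>i\<in>UNIV. (u i x)\<^sup>2)" and "b = (\<Sum>i\<in>UNIV. (h i x)\<^sup>2)"
      have ab: "a \<ge> 0" "b \<ge> 0" unfolding a_def b_def by (intro sum_nonneg zero_le_power2)+
      have "(\<Sum>i\<in>UNIV. \<Sum>j\<in>UNIV. (F i j x)\<^sup>2) \<le> (\<Sum>i\<in>UNIV. \<Sum>j\<in>UNIV. 2 * ((u i x)\<^sup>2 * (u j x)\<^sup>2) + 2 * ((h i x)\<^sup>2 * (h j x)\<^sup>2))"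
      proof (intro sum_mono)
        fix i j
        have "0 \<le> (u i x * u j x + h i x * h j x)\<^sup>2" by simp
        then show "(F i j x)\<^sup>2 \<le> 2 * ((u i x)\<^sup>2 * (u j x)\<^sup>2) + 2 * ((h i x)\<^sup>2 * (h j x)\<^sup>2)"
          by (simp add: F_def power2_eq_square algebra_simps)
      qed
      also have "\<dots> = 2 * a\<^sup>2 + 2 * b\<^sup>2"
        unfolding a_def b_def by (simp add: sum_3 power2_eq_square algebra_simps)
      also have "\<dots> \<le> 2 * (a + b)\<^sup>2" using mult_nonneg_nonneg[OF ab] by (simp add: power2_eq_square algebra_simps)
      also have "a + b = Q x" by (simp add: a_def b_def Q_def mod_sq_def sum.distrib)
      finally show "(\<Sum>i\<in>UNIV. \<Sum>j\<in>UNIV. (F i j x)\<^sup>2) \<le> 2 * (Q x)\<^sup>2" .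
    qed
    have Ub: "bint 8 (\<lambda>x. \<Sum>i\<in>UNIV. (u i x)\<^sup>2) \<le> bint 8 Q"
    proof (intro bint_mono smooth_continuous sm sQ)
      show "(\<Sum>i\<in>UNIV. (u i x)\<^sup>2) \<le> Q x" for x unfolding Q_def mod_sq_def by (intro sum_mono) simp
    qed
    have Q20: "bint 8 (\<lambda>x. (Q x)\<^sup>2) \<ge> 0" "bint 8 Q \<ge> 0" by (auto intro!: bint_nonneg Q0)
    have "\<bar>LBINT x. (\<Sum>i\<in>UNIV. pd i p x * (phi x * u i x))\<bar>
       \<le> C1 * (s * bint 8 (\<lambda>x. \<Sum>i\<in>UNIV. \<Sum>j\<in>UNIV. (F i j x)\<^sup>2) + (1 + 1 / s) * bint 8 (\<lambda>x. \<Sum>i\<in>UNIV. (u i x)\<^sup>2))"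
      using work su sF sp dF du s by blast
    also have "\<dots> \<le> C1 * (s * (2 * bint 8 (\<lambda>x. (Q x)\<^sup>2)) + (1 + 1 / s) * (2 * bint 8 Q))"
      using C1 s Fb Ub Q20 by (intro mult_left_mono add_mono) (auto simp: bint_cmult)
    also have "\<dots> = 2 * C1 * A" by (simp add: A_def algebra_simps)
    finally have p: "\<bar>LBINT x. (\<Sum>i\<in>UNIV. pd i p x * (phi x * u i x))\<bar> \<le> 2 * C1 * A" .
    define B where "B x = Q x * lap phi x / 2 + Q x * (\<Sum>j\<in>UNIV. u j x * pd j phi x) / 2
       - P x * (\<Sum>j\<in>UNIV. h j x * pd j phi x)" for x
    have Balt: "B = (\<lambda>x. (1/2) * (Q x * lap phi x) + (1/2) * (Q x * (\<Sum>j\<in>UNIV. u j x * pd j phi x))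
       - P x * (\<Sum>j\<in>UNIV. h j x * pd j phi x))" by (simp add: B_def fun_eq_iff)
    have sB: "smooth B" unfolding Balt by (intro sm sQ sP)
    have B2: "supported 8 B" unfolding Balt
      by (rule supported_mono[of 2], intro supported_diff supported_add supported_mult_right supported_sum supported_pd supported_phi) simp
    have Bx: "B x \<le> 5 * X * (s * (Q x)\<^sup>2 + (1 + 1 / s) * Q x)" for x
    proof -
      have sq: "(u j x)\<^sup>2 \<le> Q x" "(h j x)\<^sup>2 \<le> Q x" for j
        using member_le_sum[of j UNIV "\<lambda>i. (u i x)\<^sup>2 + (h i x)\<^sup>2"]
        by (auto simp: Q_def mod_sq_def intro: order_trans[rotated])
      have y: "\<bar>a * b\<bar> \<le> s * (Q x)\<^sup>2 + Q x / s" if "\<bar>a\<bar> \<le> Q x" "b\<^sup>2 \<le> Q x" for a b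
      proof -
        have "\<bar>a * b\<bar> \<le> s * a\<^sup>2 + b\<^sup>2 / s" by (rule young_mult[OF s])
        also have "a\<^sup>2 \<le> (Q x)\<^sup>2" using power_mono[OF that(1) abs_ge_zero, of 2] by simp
        finally show ?thesis using that(2) s by (simp add: divide_right_mono add_mono order_trans[OF _ add_mono])
      qed
      let ?Y = "s * (Q x)\<^sup>2 + Q x / s"
      have Y0: "?Y \<ge> 0" using s Q0 by simp
      have Pb: "\<bar>P x\<bar> \<le> Q x"
      proof -
        have "\<bar>P x\<bar> \<le> (\<Sum>k\<in>UNIV. \<bar>u k x * h k x\<bar>)" unfolding P_def by (rule sum_abs)
        also have "\<dots> \<le> (\<Sum>k\<in>UNIV. (u k x)\<^sup>2 + (h k x)\<^sup>2)"
          using young_mult[of 1] by (intro sum_mono) auto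
        finally show ?thesis by (simp add: Q_def mod_sq_def)
      qed
      have m: "\<bar>a * b\<bar> \<le> A * B" if "\<bar>a\<bar> \<le> A" "\<bar>b\<bar> \<le> B" for a b A B :: real
        unfolding abs_mult using that by (intro mult_mono) auto
      have t1: "\<bar>Q x * lap phi x\<bar> \<le> Q x * (3 * X)"
        using Q0 by (intro m sum3_abs_le X) simp
      have t2: "\<bar>Q x * (\<Sum>j\<in>UNIV. u j x * pd j phi x)\<bar> \<le> 3 * (?Y * X)"
      proof -
        have eq: "Q x * (\<Sum>j\<in>UNIV. u j x * pd j phi x) = (\<Sum>j\<in>UNIV. (Q x * u j x) * pd j phi x)"
          by (simp add: sum_distrib_left mult.assoc)
        show ?thesis unfolding eq using Q0 by (intro sum3_abs_le m X y sq) simp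
      qed
      have t3: "\<bar>P x * (\<Sum>j\<in>UNIV. h j x * pd j phi x)\<bar> \<le> 3 * (?Y * X)"
      proof -
        have eq: "P x * (\<Sum>j\<in>UNIV. h j x * pd j phi x) = (\<Sum>j\<in>UNIV. (P x * h j x) * pd j phi x)"
          by (simp add: sum_distrib_left mult.assoc)
        show ?thesis unfolding eq by (intro sum3_abs_le m X y sq Pb)
      qed
      have "B x \<le> Q x * (3 * X) / 2 + 3 * (?Y * X) / 2 + 3 * (?Y * X)"
      proof -
        have "a / 2 + b / 2 - c \<le> A / 2 + B / 2 + D" if "\<bar>a\<bar> \<le> A" "\<bar>b\<bar> \<le> B" "\<bar>c\<bar> \<le> D" for a b c A B D :: real
          using that by linarith
        from this[OF t1 t2 t3] show ?thesis unfolding B_def .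
      qed
      also have "\<dots> = (3/2) * (X * Q x) + (9/2) * (X * ?Y)" by simp
      also have "\<dots> \<le> 5 * (X * Q x) + 5 * (X * ?Y)"
        using mult_nonneg_nonneg[OF X(1) Q0[of x]] mult_nonneg_nonneg[OF X(1) Y0] by linarith
      also have "\<dots> = 5 * X * (s * (Q x)\<^sup>2 + (1 + 1 / s) * Q x)" by (simp add: algebra_simps)
      finally show ?thesis .
    qed
    have "(LBINT x. B x) = bint 8 B" by (rule integral_supported_eq_bint[OF B2])
    also have "\<dots> \<le> bint 8 (\<lambda>x. 5 * X * (s * (Q x)\<^sup>2 + (1 + 1 / s) * Q x))"
      by (intro bint_mono smooth_continuous sm sQ sB Bx)
    also have "\<dots> = 5 * X * A"
      unfolding A_def bint_cmult[symmetric]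
      by (subst bint_add[symmetric]) (intro smooth_continuous sm sQ | simp add: bint_cmult)+
    finally have b: "(LBINT x. B x) \<le> 5 * X * A" .
    have "bint 1 (grad_sq u h) \<le> bint 1 (\<lambda>x. phi x * grad_sq u h x)"
      by (intro bint_mono smooth_continuous sm sG) (simp add: cutoff_eq_1)
    also have "\<dots> \<le> bint 2 (\<lambda>x. phi x * grad_sq u h x)"
      by (intro bint_mono_radius smooth_continuous sm sG mult_nonneg_nonneg cutoff_bounds grad_sq_nonneg) simp
    also have "\<dots> = (LBINT x. phi x * grad_sq u h x)"
      by (rule integral_supported_eq_bint[symmetric]) (intro supported_mult_left supported_phi)
    also have "\<dots> = (LBINT x. B x) - (LBINT x. (\<Sum>i\<in>UNIV. pd i p x * (phi x * u i x)))"
      using energy_identity[OF mhd] unfolding B_def Q_def P_def .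
    also have "\<dots> \<le> 5 * X * A + 2 * C1 * A" using b p by linarith
    also have "\<dots> = C * A" by (simp add: C_def algebra_simps)
    finally show "bint 1 (grad_sq u h) \<le> C * (s * bint 8 (\<lambda>x. (mod_sq u h x)\<^sup>2) + (1 + 1 / s) * bint 8 (mod_sq u h))"
      by (simp add: A_def Q_def)
  qed
qed

section \<open>Rescaling the energy inequality to arbitrary radius\<close>

lemma bint_scale:
  fixes f :: "'a::euclidean_space \<Rightarrow> real"
  assumes f: "continuous_on UNIV f" and R: "R > 0"
  shows "bint r (\<lambda>x. f (R *\<^sub>R x)) = bint (R * r) f / R ^ DIM('a)"
proof -
  have [measurable]: "f \<in> borel_measurable borel" using f by (rule borel_measurable_continuous_onI)
  have "bint (R * r) f = \<bar>R\<bar> ^ DIM('a) * (LBINT x. indicator (cball 0 (R * r)) (0 + R *\<^sub>R x) * f (0 + R *\<^sub>R x))"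
    unfolding bint_def using R by (intro integral_affine borel_measurable_times borel_measurable_indicator) auto
  also have "(\<lambda>x. indicator (cball 0 (R * r)) (0 + R *\<^sub>R x) * f (0 + R *\<^sub>R x)) = (\<lambda>x. indicator (cball 0 r) x * f (R *\<^sub>R x))"
    using R by (auto simp: fun_eq_iff indicator_def)
  finally show ?thesis using R by (simp add: bint_def)
qed

lemma pd_scale: "smooth f \<Longrightarrow> pd j (\<lambda>x. c * f (R *\<^sub>R x)) = (\<lambda>x. (c * R) * pd j f (R *\<^sub>R x))"
  using partial_deriv_affine[of f j 0 R] pd_cmult[OF smooth_affine[of f 0 R], of j c]
  by (simp add: smooth_differentiable mult.assoc)

lemma smooth_scale: "smooth f \<Longrightarrow> smooth (\<lambda>x. c * f (R *\<^sub>R x))"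
  using smooth_mult[OF smooth_const[of c] smooth_affine[of f 0 R]] by simp

text \<open>The natural scaling of the system: the momentum and induction equations pick up the
  common factor R^3.\<close>

lemma mhd_scale:
  assumes "mhd u h p"
  shows "mhd (\<lambda>i x. R * u i (R *\<^sub>R x)) (\<lambda>i x. R * h i (R *\<^sub>R x)) (\<lambda>x. R\<^sup>2 * p (R *\<^sub>R x))"
proof -
  have su: "smooth (u i)" and sh: "smooth (h i)" and sp: "smooth p" for i using assms by (auto simp: mhd_def)
  have du: "dvg u x = 0" and dh: "dvg h x = 0" for x
    using assms by (auto simp: mhd_def)
  have lu: "lap (u i) x =
       (\<Sum>j\<in>UNIV. u j x * pd j (u i) x) - (\<Sum>j\<in>UNIV. h j x * pd j (h i) x) + pd i p x"
    and lh: "lap (h i) x =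
       (\<Sum>j\<in>UNIV. u j x * pd j (h i) x) - (\<Sum>j\<in>UNIV. h j x * pd j (u i) x)" for i x
    using assms by (auto simp: mhd_def)
  have pd: "pd j (\<lambda>x. R * f (R *\<^sub>R x)) = (\<lambda>x. (R * R) * pd j f (R *\<^sub>R x))"
    "pd j (\<lambda>x. f (R *\<^sub>R x)) = (\<lambda>x. R * pd j f (R *\<^sub>R x))"
    "pd j (\<lambda>x. R\<^sup>2 * f (R *\<^sub>R x)) = (\<lambda>x. (R\<^sup>2 * R) * pd j f (R *\<^sub>R x))"
    if "smooth f" for f and j :: 3
    using pd_scale[OF that, of j R R] pd_scale[OF that, of j 1 R] pd_scale[OF that, of j "R\<^sup>2" R] by simp_all
  have f: "R * a * ((R * R) * b) = (R * R * R) * (a * b)" "R\<^sup>2 * R = R * R * R" for a b by (simp_all add: power2_eq_square)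
  show ?thesis
    unfolding mhd_def pd(1)[OF su] pd(1)[OF sh] pd(3)[OF sp]
      pd_scale[OF smooth_pd[OF su]] pd_scale[OF smooth_pd[OF sh]]
    by (intro conjI allI smooth_scale su sh sp)
       (simp_all only: f sum_distrib_left[symmetric] du dh lu lh mult_zero_right right_diff_distrib[symmetric] distrib_left[symmetric])
qed

lemma smooth_mod_sq: "mhd u h p \<Longrightarrow> smooth (mod_sq u h)"
  and smooth_grad_sq: "mhd u h p \<Longrightarrow> smooth (grad_sq u h)"
  unfolding mod_sq_def[abs_def] grad_sq_def[abs_def] mhd_def
  by (auto intro!: smooth_sum smooth_add smooth_power smooth_pd)

text \<open>Applies the estimate at unit scale to the rescaled solution. Energy and fourth power
  both pick up the factor R and the second power picks up 1/R; dividing by R therefore leaves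
  \<open>s\<close> unchanged and puts R^(-2) next to the second power.\<close>

lemma energy_estimate:
  "\<exists>C>0. \<forall>u h p s R. mhd u h p \<longrightarrow> s > 0 \<longrightarrow> R > 0 \<longrightarrow>
     bint R (grad_sq u h) \<le> C * (s * bint (8 * R) (\<lambda>x. (mod_sq u h x)\<^sup>2) + (1 + 1 / s) * (bint (8 * R) (mod_sq u h) / R\<^sup>2))"
proof -
  obtain C where C: "C > 0" "\<forall>u h p s. mhd u h p \<longrightarrow> s > 0 \<longrightarrow>
     bint 1 (grad_sq u h) \<le> C * (s * bint 8 (\<lambda>x. (mod_sq u h x)\<^sup>2) + (1 + 1 / s) * bint 8 (mod_sq u h))"
    using unit_energy_estimate by (elim exE conjE)
  show ?thesis
  proof (intro exI[of _ C] conjI C(1) allI impI)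
    fix u h p and s R :: real
    assume m: "mhd u h p" and s: "s > 0" and R: "R > 0"
    have su: "smooth (u i)" and sh: "smooth (h i)" for i using m by (auto simp: mhd_def)
    let ?u = "\<lambda>i x. R * u i (R *\<^sub>R x)" and ?h = "\<lambda>i x. R * h i (R *\<^sub>R x)"
    have g: "grad_sq ?u ?h = (\<lambda>x. R ^ 4 * grad_sq u h (R *\<^sub>R x))"
      unfolding grad_sq_def pd_scale[OF su] pd_scale[OF sh]
      by (simp add: fun_eq_iff sum_distrib_left power_mult_distrib distrib_left power_numeral_reduce mult_ac)
    have q: "mod_sq ?u ?h = (\<lambda>x. R ^ 2 * mod_sq u h (R *\<^sub>R x))"
      unfolding mod_sq_def by (simp add: fun_eq_iff sum_distrib_left power_mult_distrib distrib_left)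
    have q2: "(\<lambda>x. (mod_sq ?u ?h x)\<^sup>2) = (\<lambda>x. R ^ 4 * (mod_sq u h (R *\<^sub>R x))\<^sup>2)"
      unfolding q by (simp add: power_mult_distrib)
    have c: "continuous_on UNIV (grad_sq u h)" "continuous_on UNIV (mod_sq u h)" "continuous_on UNIV (\<lambda>x. (mod_sq u h x)\<^sup>2)"
      by (intro smooth_continuous smooth_grad_sq[OF m] smooth_mod_sq[OF m] smooth_power)+
    have b1: "bint 1 (grad_sq ?u ?h) = R * bint R (grad_sq u h)"
      unfolding g bint_cmult using bint_scale[OF c(1) R, of 1] R by (simp add: power_numeral_reduce)
    have b2: "bint 8 (mod_sq ?u ?h) = bint (8 * R) (mod_sq u h) / R"
      unfolding q bint_cmult using bint_scale[OF c(2) R, of 8] R by (simp add: power_numeral_reduce mult.commute)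
    have b3: "bint 8 (\<lambda>x. (mod_sq ?u ?h x)\<^sup>2) = R * bint (8 * R) (\<lambda>x. (mod_sq u h x)\<^sup>2)"
      unfolding q2 bint_cmult using bint_scale[OF c(3) R, of 8] R by (simp add: power_numeral_reduce mult.commute)
    have "bint 1 (grad_sq ?u ?h) \<le> C * (s * bint 8 (\<lambda>x. (mod_sq ?u ?h x)\<^sup>2) + (1 + 1 / s) * bint 8 (mod_sq ?u ?h))"
      using C(2) mhd_scale[OF m, of R] s by blast
    then have "R * bint R (grad_sq u h) \<le> C * (s * (R * bint (8 * R) (\<lambda>x. (mod_sq u h x)\<^sup>2)) + (1 + 1 / s) * (bint (8 * R) (mod_sq u h) / R))"
      unfolding b1 b2 b3 .
    also have "\<dots> = R * (C * (s * bint (8 * R) (\<lambda>x. (mod_sq u h x)\<^sup>2) + (1 + 1 / s) * (bint (8 * R) (mod_sq u h) / R\<^sup>2)))"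
      using R s by (simp add: field_simps power2_eq_square)
    finally show "bint R (grad_sq u h) \<le> C * (s * bint (8 * R) (\<lambda>x. (mod_sq u h x)\<^sup>2) + (1 + 1 / s) * (bint (8 * R) (mod_sq u h) / R\<^sup>2))"
      using R by simp
  qed
qed

section \<open>A weak-type estimate for fields in \<open>BMO\<^sup>-\<^sup>1\<close>\<close>

definition mollc :: real where "mollc = (\<integral>x. cutoff (1/4) (1/2) x \<partial>(lborel :: (real^3) measure))"

definition moll :: "real^3 \<Rightarrow> real" where "moll x = (1 / mollc) * cutoff (1/4) (1/2) x"

lemma smooth_moll: "smooth moll"
  unfolding moll_def[abs_def] by (intro smooth_rules smooth_cutoff) auto

lemma supported_moll: "supported (1/2) moll"
  unfolding moll_def[abs_def] by (intro supported_mult_right supported_cutoff) auto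

lemma mollc_pos: "mollc > 0"
proof -
  have s: "smooth (cutoff (1/4) (1/2) :: real^3 \<Rightarrow> real)" by (rule smooth_cutoff) auto
  have "0 < bint (1/4) (\<lambda>x::real^3. 1)" by (subst bint_const) auto
  also have "\<dots> \<le> bint (1/4) (cutoff (1/4) (1/2) :: real^3 \<Rightarrow> real)"
    by (intro bint_mono smooth_continuous s) (auto simp: cutoff_eq_1)
  also have "\<dots> \<le> bint (1/2) (cutoff (1/4) (1/2) :: real^3 \<Rightarrow> real)"
    by (intro bint_mono_radius smooth_continuous s cutoff_bounds) auto
  also have "\<dots> = mollc" unfolding mollc_def
    by (rule integral_supported_eq_bint[symmetric], rule supported_cutoff) auto
  finally show ?thesis .
qed

lemma moll_nonneg: "moll x \<ge> 0"
  unfolding moll_def using mollc_pos by (intro mult_nonneg_nonneg cutoff_bounds) simp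

lemma integrable_moll: "integrable lborel moll"
  by (rule integrable_smooth_supported[OF smooth_moll supported_moll])

lemma integral_moll: "(LBINT x. moll x) = 1"
  unfolding moll_def using mollc_pos by (simp add: mollc_def)

text \<open>A weighted mean over the ball of radius t/2 about \<open>x\<close>. The weight is
  smooth, so that it can be used as a test function in the weak divergence.\<close>

definition avg :: "real \<Rightarrow> (real^3 \<Rightarrow> real) \<Rightarrow> real^3 \<Rightarrow> real" where
  "avg t v x = (LBINT w. v (x - t *\<^sub>R w) * moll w)"

lemma integral_lebesgue_eq_lborel:
  "f \<in> borel_measurable borel \<Longrightarrow> (LINT x|lebesgue. f x) = (LBINT x. f x)" for f :: "'a::euclidean_space \<Rightarrow> real"
  by (simp add: integral_completion)

text \<open>A count of powers of \<open>t\<close>: the test function is \<open>moll\<close> rescaled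
  to size \<open>t\<close> around \<open>x\<close> without normalization, so its gradient is O(1/t),
  and against the oscillation of \<open>d\<close> over a ball of volume O(t^3) it gives O(t^2). The
  same pairing is t^3 times the average, and dividing leaves 1/t.\<close>

lemma BMO_inv_avg_bound:
  assumes v: "smooth (\<lambda>x. v x $ i)" and B: "BMO_inv v"
  shows "\<exists>C>0. \<forall>x t. t > 0 \<longrightarrow> \<bar>avg t (\<lambda>x. v x $ i) x\<bar> \<le> C / t"
proof -
  obtain d :: "real^3 \<Rightarrow> real^3^3" where d: "\<And>i j. BMO (\<lambda>x. d x $ i $ j)" and w: "is_weak_div v d"
    using B unfolding BMO_inv_def by blast
  have "\<exists>C. \<forall>x r. r > 0 \<longrightarrow> set_mean (ball x r) (\<lambda>y. \<bar>d y $ i $ j - set_mean (ball x r) (\<lambda>y. d y $ i $ j)\<bar>) \<le> C" for j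
    using d[of i j] unfolding BMO_def by blast
  then obtain c where c: "\<And>j x r. r > 0 \<Longrightarrow> set_mean (ball x r) (\<lambda>y. \<bar>d y $ i $ j - set_mean (ball x r) (\<lambda>y. d y $ i $ j)\<bar>) \<le> c j"
    by metis
  have li: "locally_integrable (\<lambda>x. d x $ i $ j)" for j using d[of i j] by (simp add: BMO_def)
  obtain M where M: "M \<ge> 0" "\<And>j x. \<bar>pd j moll x\<bar> \<le> M"
    "\<And>j k x. \<bar>pd k (pd j moll) x\<bar> \<le> M"
    "\<And>j k l x. \<bar>pd l (pd k (pd j moll)) x\<bar> \<le> M"
    by (rule derivatives_bounded[OF smooth_moll supported_moll]) (rule that; assumption | blast)
  define V where "V = unit_ball_vol (3::real)"
  have V: "V > 0" by (simp add: V_def)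
  define C where "C = 1 + M * V * (\<Sum>j\<in>UNIV. \<bar>c j\<bar>)"
  have C: "C > 0" unfolding C_def using M V by (intro add_pos_nonneg mult_nonneg_nonneg sum_nonneg) auto
  show ?thesis
  proof (intro exI[of _ C] conjI C allI impI)
    fix x t assume t: "(t::real) > 0"
    define \<phi> where "\<phi> y = moll ((1/t) *\<^sub>R x + (- (1/t)) *\<^sub>R y)" for y
    have arg: "(1/t) *\<^sub>R x + (- (1/t)) *\<^sub>R y = (1/t) *\<^sub>R (x - y)" for y by (simp add: algebra_simps)
    have s\<phi>: "smooth \<phi>" unfolding \<phi>_def[abs_def] by (rule smooth_affine[OF smooth_moll])
    have pd\<phi>: "pd j \<phi> = (\<lambda>y. - (1/t) * pd j moll ((1/t) *\<^sub>R (x - y)))" for j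
      unfolding \<phi>_def[abs_def] using partial_deriv_affine[OF smooth_differentiable[OF smooth_moll], of j "(1/t) *\<^sub>R x" "- (1/t)"]
      by (simp add: scaleR_diff_right)
    have far: "norm ((1/t) *\<^sub>R (x - y)) > 1/2" if "y \<notin> ball x t" for y
    proof -
      have "norm ((1/t) *\<^sub>R (x - y)) = norm (x - y) / t" using t by (simp only: norm_scaleR) simp
      moreover have "norm (x - y) / t \<ge> 1" using that t by (simp add: dist_norm)
      ultimately show ?thesis by linarith
    qed
    have \<phi>0: "pd j \<phi> y = 0" if "y \<notin> ball x t" for j y
      using supported_pd[OF supported_moll, of j] far[OF that] by (simp add: pd\<phi> supported_def)
    have \<phi>b: "\<bar>pd j \<phi> y\<bar> \<le> M / t" for j y
      using M(2) t by (simp add: pd\<phi> abs_mult divide_right_mono)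
    have sup\<phi>: "supported (norm x + t) \<phi>"
      unfolding supported_def
    proof safe
      fix y :: "real^3" assume "norm x + t < norm y"
      then have "y \<notin> ball x t" using norm_triangle_ineq2[of y x] by (simp add: dist_norm norm_minus_commute)
      from supportedD[OF supported_moll far[OF this]] show "\<phi> y = 0" by (simp only: \<phi>_def arg)
    qed
    have test: "test_function \<phi>" by (rule test_function_supported[OF s\<phi> sup\<phi>])
    have eq: "(LINT y|lebesgue. v y $ i * \<phi> y) = - (\<Sum>j\<in>UNIV. LINT y|lebesgue. d y $ i $ j * pd j \<phi> y)"
      using w test unfolding is_weak_div_def by blast
    have jb: "\<bar>LINT y|lebesgue. d y $ i $ j * pd j \<phi> y\<bar> \<le> (M / t) * (\<bar>c j\<bar> * (V * t ^ 3))" for j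
    proof -
      \<comment> \<open>A derivative of the test function integrates to zero, so a constant may be
        taken off \<open>d\<close>. The mean over the ball containing the support of that derivative
        is the constant for which the oscillation bound is available.\<close>
      define m where "m = set_mean (ball x t) (\<lambda>y. d y $ i $ j)"
      have "set_integrable lebesgue (cball x t) (\<lambda>y. d y $ i $ j)" using li[of j] by (auto simp: locally_integrable_def)
      then have "set_integrable lebesgue (ball x t) (\<lambda>y. d y $ i $ j)"
        by (rule set_integrable_subset) auto
      then have i1: "integrable lebesgue (\<lambda>y. indicator (ball x t) y * d y $ i $ j)" by (simp add: set_integrable_def)
      have i0: "integrable lebesgue (\<lambda>y. indicator (ball x t) y * m)"
        by (intro integrable_mult_left integrable_real_indicator) (use emeasure_lborel_ball_finite[of x t] in auto)
      have i2: "integrable lebesgue (\<lambda>y. indicator (ball x t) y * (d y $ i $ j - m))"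
        using Bochner_Integration.integrable_diff[OF i1 i0] by (simp add: right_diff_distrib)
      have meas: "pd j \<phi> \<in> borel_measurable lebesgue"
        using smooth_measurable[OF smooth_pd[OF s\<phi>, of j]] by (simp add: measurable_completion)
      have i4: "integrable lebesgue (\<lambda>y. (d y $ i $ j - m) * pd j \<phi> y)"
      proof (rule Bochner_Integration.integrable_bound[of _ "\<lambda>y. (M / t) * (indicator (ball x t) y * (d y $ i $ j - m))"])
        show "integrable lebesgue (\<lambda>y. (M / t) * (indicator (ball x t) y * (d y $ i $ j - m)))" by (intro integrable_mult_right i2)
        have "(\<lambda>y. (d y $ i $ j - m) * pd j \<phi> y) = (\<lambda>y. (indicator (ball x t) y * (d y $ i $ j - m)) * pd j \<phi> y)"
          using \<phi>0 by (auto simp: fun_eq_iff indicator_def)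
        then show "(\<lambda>y. (d y $ i $ j - m) * pd j \<phi> y) \<in> borel_measurable lebesgue"
          using borel_measurable_times[OF borel_measurable_integrable[OF i2] meas] by simp
        show "AE y in lebesgue. norm ((d y $ i $ j - m) * pd j \<phi> y) \<le> norm ((M / t) * (indicator (ball x t) y * (d y $ i $ j - m)))"
        proof (rule AE_I2)
          fix y
          have "\<bar>d y $ i $ j - m\<bar> * \<bar>pd j \<phi> y\<bar> \<le> \<bar>d y $ i $ j - m\<bar> * (M / t)" by (intro mult_left_mono \<phi>b) simp
          then show "norm ((d y $ i $ j - m) * pd j \<phi> y) \<le> norm ((M / t) * (indicator (ball x t) y * (d y $ i $ j - m)))"
            using \<phi>0[of y j] M(1) t by (cases "y \<in> ball x t") (auto simp: abs_mult mult.commute)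
        qed
      qed
      have i5: "integrable lebesgue (pd j \<phi>)"
        using integrable_smooth_supported[OF smooth_pd[OF s\<phi>] supported_pd[OF sup\<phi>], of j]
        by (subst integrable_completion) auto
      have z: "(LINT y|lebesgue. pd j \<phi> y) = 0"
        using integral_partial_deriv_eq_0[OF s\<phi> sup\<phi>, of j] smooth_measurable[OF smooth_pd[OF s\<phi>, of j]]
        by (simp add: integral_lebesgue_eq_lborel)
      have "(LINT y|lebesgue. d y $ i $ j * pd j \<phi> y) = (LINT y|lebesgue. (d y $ i $ j - m) * pd j \<phi> y + m * pd j \<phi> y)"
        by (simp add: algebra_simps)
      also have "\<dots> = (LINT y|lebesgue. (d y $ i $ j - m) * pd j \<phi> y)"
        using i4 i5 z by simp
      finally have "\<bar>LINT y|lebesgue. d y $ i $ j * pd j \<phi> y\<bar> \<le> (LINT y|lebesgue. \<bar>(d y $ i $ j - m) * pd j \<phi> y\<bar>)"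
        using integral_abs_bound[of lebesgue "\<lambda>y. (d y $ i $ j - m) * pd j \<phi> y"] by simp
      also have "\<dots> \<le> (LINT y|lebesgue. (M / t) * \<bar>indicator (ball x t) y * (d y $ i $ j - m)\<bar>)"
      proof (intro integral_mono integrable_abs i4 integrable_mult_right i2)
        fix y
        have "\<bar>d y $ i $ j - m\<bar> * \<bar>pd j \<phi> y\<bar> \<le> \<bar>d y $ i $ j - m\<bar> * (M / t)" by (intro mult_left_mono \<phi>b) simp
        then show "\<bar>(d y $ i $ j - m) * pd j \<phi> y\<bar> \<le> (M / t) * \<bar>indicator (ball x t) y * (d y $ i $ j - m)\<bar>"
          using \<phi>0[of y j] by (cases "y \<in> ball x t") (auto simp: abs_mult mult.commute)
      qed
      also have "\<dots> = (M / t) * (LINT y:ball x t|lebesgue. \<bar>d y $ i $ j - m\<bar>)"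
        by (simp add: set_lebesgue_integral_def abs_mult)
      also have "\<dots> \<le> (M / t) * (\<bar>c j\<bar> * (V * t ^ 3))"
      proof (rule mult_left_mono)
        have ms: "measure lebesgue (ball x t) = V * t ^ 3"
          using content_ball[of t x] t by (simp add: V_def)
        have "(LINT y:ball x t|lebesgue. \<bar>d y $ i $ j - m\<bar>) / (V * t ^ 3) \<le> \<bar>c j\<bar>"
          using c[OF t, of x j] unfolding m_def[symmetric] unfolding set_mean_def ms by linarith
        then show "(LINT y:ball x t|lebesgue. \<bar>d y $ i $ j - m\<bar>) \<le> \<bar>c j\<bar> * (V * t ^ 3)"
          using V t by (simp add: pos_divide_le_eq)
        show "0 \<le> M / t" using M(1) t by simp
      qed
      finally show ?thesis .
    qed
    have "\<bar>LINT y|lebesgue. v y $ i * \<phi> y\<bar> \<le> (\<Sum>j\<in>UNIV. (M / t) * (\<bar>c j\<bar> * (V * t ^ 3)))"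
      unfolding eq abs_minus_cancel by (rule order_trans[OF sum_abs sum_mono]) (rule jb)
    also have "\<dots> = M * V * (\<Sum>j\<in>UNIV. \<bar>c j\<bar>) * t\<^sup>2"
      using t by (simp add: sum_distrib_left sum_distrib_right field_simps power2_eq_square power3_eq_cube)
    also have "\<dots> \<le> C * t\<^sup>2" by (intro mult_right_mono) (auto simp: C_def)
    finally have b: "\<bar>LINT y|lebesgue. v y $ i * \<phi> y\<bar> \<le> C * t\<^sup>2" .
    have [measurable]: "(\<lambda>y. v y $ i) \<in> borel_measurable borel" "\<phi> \<in> borel_measurable borel"
      using v s\<phi> by (auto intro: smooth_measurable)
    have "(LINT y|lebesgue. v y $ i * \<phi> y) = (LBINT y. v y $ i * \<phi> y)"
      by (rule integral_lebesgue_eq_lborel) simp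
    also have "\<dots> = \<bar>- t\<bar> ^ DIM(real^3) * (LBINT w. v (x + (- t) *\<^sub>R w) $ i * \<phi> (x + (- t) *\<^sub>R w))"
      using t by (intro integral_affine) auto
    also have "\<dots> = t ^ 3 * avg t (\<lambda>x. v x $ i) x"
      using t by (simp add: avg_def \<phi>_def arg algebra_simps power3_eq_cube)
    finally have "t ^ 3 * \<bar>avg t (\<lambda>x. v x $ i) x\<bar> \<le> C * t\<^sup>2" using b t by (simp add: abs_mult)
    then have "t\<^sup>2 * (t * \<bar>avg t (\<lambda>x. v x $ i) x\<bar>) \<le> t\<^sup>2 * C" by (simp add: power_numeral_reduce mult_ac)
    then have "t * \<bar>avg t (\<lambda>x. v x $ i) x\<bar> \<le> C" using t by simp
    then show "\<bar>avg t (\<lambda>x. v x $ i) x\<bar> \<le> C / t" using t by (simp add: field_simps)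
  qed
qed

section \<open>Controlling the distance to averages by the gradient\<close>

definition gsq :: "(real^3 \<Rightarrow> real) \<Rightarrow> real^3 \<Rightarrow> real" where
  "gsq v x = (\<Sum>j\<in>UNIV. (pd j v x)\<^sup>2)"

lemma gsq_nonneg: "gsq v x \<ge> 0"
  unfolding gsq_def by (intro sum_nonneg zero_le_power2)

lemma smooth_gsq: "smooth v \<Longrightarrow> smooth (gsq v)"
  unfolding gsq_def[abs_def] by (intro smooth_rules)

lemma nn_integral_bint:
  fixes f :: "'a::euclidean_space \<Rightarrow> real"
  assumes "continuous_on UNIV f" "\<And>x. f x \<ge> 0"
  shows "(\<integral>\<^sup>+x. ennreal (indicator (cball 0 r) x * f x) \<partial>lborel) = ennreal (bint r f)"
  unfolding bint_def using assms
  by (intro nn_integral_eq_integral integrable_indicator_cball AE_I2) (auto simp: indicator_def)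

text \<open>Cauchy--Schwarz along the segment from \<open>x\<close> to \<open>x - z\<close>.\<close>

lemma difference_square_le:
  assumes v: "smooth v"
  shows "ennreal ((v x - v (x - z))\<^sup>2) \<le>
    (\<integral>\<^sup>+s. ennreal (indicator {0..1} s * ((norm z)\<^sup>2 * gsq v (x - s *\<^sub>R z))) \<partial>lborel)"
proof -
  define g where "g s = (\<Sum>j\<in>UNIV. (- z) $ j * pd j v (x + s *\<^sub>R (- z)))" for s
  have der: "((\<lambda>s. v (x + s *\<^sub>R (- z))) has_real_derivative g s) (at s)" for s
    unfolding g_def by (rule has_real_derivative_line) (rule smooth_differentiable_at[OF v])
  have cg: "continuous_on UNIV g"
    unfolding g_def
    by (intro continuous_intros continuous_on_compose2[OF smooth_continuous[OF smooth_pd[OF v], of UNIV]]) auto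
  have "(g has_integral (v (x + 1 *\<^sub>R (- z)) - v (x + 0 *\<^sub>R (- z)))) {0..1}"
    by (rule fundamental_theorem_of_calculus)
       (auto intro: der has_field_derivative_at_within simp: has_real_derivative_iff_has_vector_derivative[symmetric] simp del: scaleR_minus_right)
  then have I: "integral {0..1} g = v (x - z) - v x" by (auto simp: integral_unique)
  have s: "set_integrable lborel {0..1} h" if "continuous_on UNIV h" for h :: "real \<Rightarrow> real"
    unfolding set_integrable_def by (intro borel_integrable_compact continuous_on_subset[OF that]) auto
  have I1: "(LBINT s. indicator {0..1} s * g s) = v (x - z) - v x"
    using set_borel_integral_eq_integral(2)[OF s[OF cg]] I by (simp add: set_lebesgue_integral_def)
  define d where "d = v (x - z) - v x"
  have i: "integrable lborel (\<lambda>s. indicator {0..1} s * h s)" if "continuous_on UNIV h" for h :: "real \<Rightarrow> real"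
    using s[OF that] by (simp add: set_integrable_def)
  have i1: "integrable lborel (\<lambda>s. indicator {0..1} s * (g s)\<^sup>2)" by (intro i continuous_intros cg)
  have "0 \<le> (LBINT s. indicator {0..1} s * (g s - d)\<^sup>2)"
    by (intro integral_nonneg_AE AE_I2) auto
  also have "\<dots> = (LBINT s. indicator {0..1} s * (g s)\<^sup>2 + ((- 2 * d) * (indicator {0..1} s * g s) + d\<^sup>2 * indicator {0..1::real} s))"
    by (simp add: power2_diff algebra_simps)
  also have "\<dots> = (LBINT s. indicator {0..1} s * (g s)\<^sup>2) + ((- 2 * d) * d + d\<^sup>2)"
    using i1 i[OF cg] I1 by (subst Bochner_Integration.integral_add) (auto simp: d_def)
  finally have "d\<^sup>2 \<le> (LBINT s. indicator {0..1} s * (g s)\<^sup>2)" by (simp add: power2_eq_square)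
  then have "ennreal (d\<^sup>2) \<le> ennreal (LBINT s. indicator {0..1} s * (g s)\<^sup>2)" by (rule ennreal_leI)
  also have "\<dots> = (\<integral>\<^sup>+s. ennreal (indicator {0..1} s * (g s)\<^sup>2) \<partial>lborel)"
    by (rule nn_integral_eq_integral[symmetric, OF i1]) auto
  also have "\<dots> \<le> (\<integral>\<^sup>+s. ennreal (indicator {0..1} s * ((norm z)\<^sup>2 * gsq v (x - s *\<^sub>R z))) \<partial>lborel)"
  proof (intro nn_integral_mono ennreal_leI mult_left_mono)
    fix s
    have "(g s)\<^sup>2 \<le> (\<Sum>j\<in>UNIV. ((- z) $ j)\<^sup>2) * (\<Sum>j\<in>UNIV. (pd j v (x + s *\<^sub>R (- z)))\<^sup>2)"
      unfolding g_def by (rule Cauchy_Schwarz_ineq_sum)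
    also have "\<dots> = (norm z)\<^sup>2 * gsq v (x - s *\<^sub>R z)"
      unfolding norm_sq_sum gsq_def by simp
    finally show "(g s)\<^sup>2 \<le> (norm z)\<^sup>2 * gsq v (x - s *\<^sub>R z)" .
  qed auto
  finally show ?thesis by (simp add: d_def power2_commute)
qed

text \<open>The bound along segments is integrated over the ball and the order of integration
  exchanged. For each fixed \<open>s\<close> in [0, 1] the shift by \<open>s *\<^sub>R z\<close>
  moves the ball of radius \<open>R\<close> into the one of radius \<open>2 * R\<close>. Integrals
  with values in \<open>ennreal\<close> keep this to measurability.\<close>

lemma translation_difference_le:
  assumes v: "smooth v" and z: "norm z \<le> R"
  shows "(\<integral>\<^sup>+x. ennreal (indicator (cball 0 R) x * (v x - v (x - z))\<^sup>2) \<partial>lborel) \<le> ennreal ((norm z)\<^sup>2 * bint (2 * R) (gsq v))"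
proof -
  define G where "G = gsq v"
  have [measurable]: "G \<in> borel_measurable borel" unfolding G_def by (rule smooth_measurable[OF smooth_gsq[OF v]])
  have G0: "G x \<ge> 0" for x by (simp add: G_def gsq_nonneg)
  have cG: "continuous_on UNIV G" unfolding G_def by (rule smooth_continuous[OF smooth_gsq[OF v]])
  have [measurable]: "cball 0 r \<in> sets (borel :: (real^3) measure)" for r by simp
  have "(\<integral>\<^sup>+x. ennreal (indicator (cball 0 R) x * (v x - v (x - z))\<^sup>2) \<partial>lborel)
    \<le> (\<integral>\<^sup>+x. (\<integral>\<^sup>+s. ennreal (indicator (cball 0 R) x * (indicator {0..1} s * ((norm z)\<^sup>2 * G (x - s *\<^sub>R z)))) \<partial>lborel) \<partial>lborel)"
  proof (rule nn_integral_mono)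
    fix x
    show "ennreal (indicator (cball 0 R) x * (v x - v (x - z))\<^sup>2) \<le> (\<integral>\<^sup>+s. ennreal (indicator (cball 0 R) x * (indicator {0..1} s * ((norm z)\<^sup>2 * G (x - s *\<^sub>R z)))) \<partial>lborel)"
      using difference_square_le[OF v, of x z] by (cases "x \<in> cball 0 R") (auto simp: G_def)
  qed
  also have "\<dots> = (\<integral>\<^sup>+s. (\<integral>\<^sup>+x. ennreal (indicator (cball 0 R) x * (indicator {0..1} s * ((norm z)\<^sup>2 * G (x - s *\<^sub>R z)))) \<partial>lborel) \<partial>lborel)"
    by (rule lborel_pair.Fubini'[symmetric]) measurable
  also have "\<dots> \<le> (\<integral>\<^sup>+s. ennreal ((norm z)\<^sup>2 * bint (2 * R) G) * indicator {0..1} (s::real) \<partial>lborel)"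
  proof (rule nn_integral_mono)
    fix s :: real
    show "(\<integral>\<^sup>+x. ennreal (indicator (cball 0 R) x * (indicator {0..1} s * ((norm z)\<^sup>2 * G (x - s *\<^sub>R z)))) \<partial>lborel) \<le> ennreal ((norm z)\<^sup>2 * bint (2 * R) G) * indicator {0..1} s"
    proof (cases "s \<in> {0..1}")
      case True
      have "(\<integral>\<^sup>+x. ennreal (indicator (cball 0 R) x * (indicator {0..1} s * ((norm z)\<^sup>2 * G (x - s *\<^sub>R z)))) \<partial>lborel)
        \<le> (\<integral>\<^sup>+x. ennreal (indicator (cball 0 (2 * R)) (x - s *\<^sub>R z) * ((norm z)\<^sup>2 * G (x - s *\<^sub>R z))) \<partial>lborel)"
      proof (intro nn_integral_mono ennreal_leI)
        fix x :: "real^3"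
        have "norm (x - s *\<^sub>R z) \<le> 2 * R" if "norm x \<le> R"
        proof -
          have "norm (s *\<^sub>R z) \<le> 1 * norm z" using True by (simp add: mult_left_le_one_le)
          then show ?thesis using norm_triangle_ineq4[of x "s *\<^sub>R z"] that z by linarith
        qed
        then show "indicator (cball 0 R) x * (indicator {0..1} s * ((norm z)\<^sup>2 * G (x - s *\<^sub>R z))) \<le> indicator (cball 0 (2 * R)) (x - s *\<^sub>R z) * ((norm z)\<^sup>2 * G (x - s *\<^sub>R z))"
          using True G0[of "x - s *\<^sub>R z"] by (auto simp: indicator_def)
      qed
      also have "\<dots> = (\<integral>\<^sup>+x. ennreal (indicator (cball 0 (2 * R)) x * ((norm z)\<^sup>2 * G x)) \<partial>lborel)"
        using nn_integral_affine[of "\<lambda>x. ennreal (indicator (cball 0 (2 * R)) x * ((norm z)\<^sup>2 * G x))" 1 "- (s *\<^sub>R z)"]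
        by simp
      also have "\<dots> = ennreal (bint (2 * R) (\<lambda>x. (norm z)\<^sup>2 * G x))"
        by (intro nn_integral_bint continuous_intros cG) (simp add: G0)
      finally show ?thesis using True by (simp add: bint_cmult)
    next
      case False then show ?thesis by simp
    qed
  qed
  also have "\<dots> = ennreal ((norm z)\<^sup>2 * bint (2 * R) G)"
    by (subst nn_integral_cmult_indicator) auto
  finally show ?thesis by (simp add: G_def)
qed

text \<open>Nonnegativity of the variance of \<open>h\<close> under the probability density
  \<open>moll\<close>.\<close>

lemma moll_jensen:
  assumes h: "continuous_on UNIV h"
  shows "ennreal ((LBINT w. h w * moll w)\<^sup>2) \<le> (\<integral>\<^sup>+w. ennreal (moll w * (h w)\<^sup>2) \<partial>lborel)"
proof -
  define m where "m = (LBINT w. h w * moll w)"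
  have i: "integrable lborel (\<lambda>w. k w * moll w)" if "continuous_on UNIV k" for k
    by (rule integrable_supported[of _ "1/2"])
       (intro continuous_intros that smooth_continuous smooth_moll supported_mult_right supported_moll)+
  have i2: "integrable lborel (\<lambda>w. (h w)\<^sup>2 * moll w)" by (intro i continuous_intros h)
  have "0 \<le> (LBINT w. (h w - m)\<^sup>2 * moll w)"
    by (intro integral_nonneg_AE AE_I2) (simp add: moll_nonneg)
  also have "\<dots> = (LBINT w. (h w)\<^sup>2 * moll w + ((- 2 * m) * (h w * moll w) + m\<^sup>2 * moll w))"
    by (simp add: power2_diff algebra_simps)
  also have "\<dots> = (LBINT w. (h w)\<^sup>2 * moll w) + ((- 2 * m) * m + m\<^sup>2)"
    using i2 i[OF h] integrable_moll
    by (subst Bochner_Integration.integral_add) (auto simp: m_def[symmetric] integral_moll)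
  finally have "m\<^sup>2 \<le> (LBINT w. (h w)\<^sup>2 * moll w)" by (simp add: power2_eq_square)
  then have "ennreal (m\<^sup>2) \<le> ennreal (LBINT w. (h w)\<^sup>2 * moll w)" by (rule ennreal_leI)
  also have "\<dots> = (\<integral>\<^sup>+w. ennreal ((h w)\<^sup>2 * moll w) \<partial>lborel)"
    by (rule nn_integral_eq_integral[symmetric, OF i2]) (simp add: moll_nonneg)
  finally show ?thesis by (simp add: m_def mult.commute)
qed

text \<open>A Poincare inequality: Jensen's inequality for \<open>moll\<close> reduces the distance
  to the average to translation differences for the shifts \<open>t *\<^sub>R w\<close>, which stay
  shorter than \<open>t\<close>, hence than \<open>R\<close>, on the support of
  \<open>moll\<close>.\<close>

lemma avg_difference_le:
  assumes v: "smooth v" and t: "t > 0" "t \<le> R"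
  shows "(\<integral>\<^sup>+x. ennreal (indicator (cball 0 R) x * (v x - avg t v x)\<^sup>2) \<partial>lborel) \<le> ennreal (t\<^sup>2 * bint (2 * R) (gsq v))"
proof -
  have [measurable]: "v \<in> borel_measurable borel" "moll \<in> borel_measurable borel"
    using smooth_measurable v smooth_moll by auto
  have [measurable]: "cball 0 r \<in> sets (borel :: (real^3) measure)" for r by simp
  define B where "B = bint (2 * R) (gsq v)"
  have B: "B \<ge> 0" unfolding B_def by (rule bint_nonneg) (rule gsq_nonneg)
  have "(\<integral>\<^sup>+x. ennreal (indicator (cball 0 R) x * (v x - avg t v x)\<^sup>2) \<partial>lborel)
     \<le> (\<integral>\<^sup>+x. (\<integral>\<^sup>+w. ennreal (moll w) * ennreal (indicator (cball 0 R) x * (v x - v (x - t *\<^sub>R w))\<^sup>2) \<partial>lborel) \<partial>lborel)"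
  proof (rule nn_integral_mono)
    fix x
    have c: "continuous_on UNIV (\<lambda>w. v (x - t *\<^sub>R w))"
      by (rule continuous_on_compose2[OF smooth_continuous[OF v, of UNIV]]) (auto intro!: continuous_intros)
    have i: "integrable lborel (\<lambda>w. v (x - t *\<^sub>R w) * moll w)"
      by (rule integrable_supported[of _ "1/2"]) (intro continuous_intros c smooth_continuous smooth_moll supported_mult_right supported_moll)+
    have "v x - avg t v x = (LBINT w. (v x - v (x - t *\<^sub>R w)) * moll w)"
      using i integrable_moll by (simp add: avg_def left_diff_distrib integral_moll)
    then have "ennreal ((v x - avg t v x)\<^sup>2) \<le> (\<integral>\<^sup>+w. ennreal (moll w * (v x - v (x - t *\<^sub>R w))\<^sup>2) \<partial>lborel)"
      using moll_jensen[of "\<lambda>w. v x - v (x - t *\<^sub>R w)"] c by (simp add: continuous_on_diff)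
    then show "ennreal (indicator (cball 0 R) x * (v x - avg t v x)\<^sup>2)
      \<le> (\<integral>\<^sup>+w. ennreal (moll w) * ennreal (indicator (cball 0 R) x * (v x - v (x - t *\<^sub>R w))\<^sup>2) \<partial>lborel)"
      by (cases "x \<in> cball 0 R") (auto simp: moll_nonneg ennreal_mult')
  qed
  also have "\<dots> = (\<integral>\<^sup>+w. (\<integral>\<^sup>+x. ennreal (moll w) * ennreal (indicator (cball 0 R) x * (v x - v (x - t *\<^sub>R w))\<^sup>2) \<partial>lborel) \<partial>lborel)"
    by (rule lborel_pair.Fubini'[symmetric]) measurable
  also have "\<dots> \<le> (\<integral>\<^sup>+w. ennreal (moll w) * ennreal (t\<^sup>2 * B) \<partial>lborel)"
  proof (rule nn_integral_mono)
    fix w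
    have "(\<integral>\<^sup>+x. ennreal (moll w) * ennreal (indicator (cball 0 R) x * (v x - v (x - t *\<^sub>R w))\<^sup>2) \<partial>lborel)
       = ennreal (moll w) * (\<integral>\<^sup>+x. ennreal (indicator (cball 0 R) x * (v x - v (x - t *\<^sub>R w))\<^sup>2) \<partial>lborel)"
      by (rule nn_integral_cmult) measurable
    also have "\<dots> \<le> ennreal (moll w) * ennreal (t\<^sup>2 * B)"
    proof (cases "norm w \<le> 1/2")
      case True
      have w: "norm (t *\<^sub>R w) \<le> t" using True t by (simp add: mult_left_le)
      have "(\<integral>\<^sup>+x. ennreal (indicator (cball 0 R) x * (v x - v (x - t *\<^sub>R w))\<^sup>2) \<partial>lborel) \<le> ennreal ((norm (t *\<^sub>R w))\<^sup>2 * B)"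
        unfolding B_def by (rule translation_difference_le[OF v order_trans[OF w t(2)]])
      also have "\<dots> \<le> ennreal (t\<^sup>2 * B)"
        using B power_mono[OF w norm_ge_zero, of 2] by (intro ennreal_leI mult_right_mono)
      finally show ?thesis by (rule mult_left_mono) simp
    next
      case False
      then have "moll w = 0" using supported_moll by (simp add: supported_def)
      then show ?thesis by simp
    qed
    finally show "(\<integral>\<^sup>+x. ennreal (moll w) * ennreal (indicator (cball 0 R) x * (v x - v (x - t *\<^sub>R w))\<^sup>2) \<partial>lborel) \<le> ennreal (moll w) * ennreal (t\<^sup>2 * B)" .
  qed
  also have "\<dots> = (\<integral>\<^sup>+w. ennreal (moll w) \<partial>lborel) * ennreal (t\<^sup>2 * B)"
    by (rule nn_integral_multc) measurable
  also have "(\<integral>\<^sup>+w. ennreal (moll w) \<partial>lborel) = 1"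
    using nn_integral_eq_integral[OF integrable_moll] by (simp add: moll_nonneg integral_moll)
  finally show ?thesis by (simp add: B_def)
qed

section \<open>Level sets and the dyadic summation of the fourth power\<close>

definition levelset :: "real \<Rightarrow> (real^3 \<Rightarrow> real) \<Rightarrow> real \<Rightarrow> (real^3) set" where
  "levelset R v l = {x \<in> cball 0 R. \<bar>v x\<bar> > l}"

lemma levelset_measurable:
  assumes "smooth v" shows "levelset R v l \<in> sets borel"
proof -
  have "open {x. \<bar>v x\<bar> > l}"
    by (intro open_Collect_less continuous_intros smooth_continuous assms)
  moreover have "levelset R v l = cball 0 R \<inter> {x. \<bar>v x\<bar> > l}" by (auto simp: levelset_def)
  ultimately show ?thesis by auto
qed

lemma emeasure_levelset_finite: "emeasure lborel (levelset R v l) < \<infinity>"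
proof -
  have "emeasure lborel (levelset R v l) \<le> emeasure lborel (cball (0::real^3) R)"
    by (rule emeasure_mono) (auto simp: levelset_def)
  also have "\<dots> < \<infinity>" by (rule emeasure_lborel_cball_finite)
  finally show ?thesis .
qed

text \<open>Averaging at the scale \<open>t = 2 C / l\<close> makes the average at most \<open>l / 2\<close>, so on the level set the
  difference to the average is at least \<open>l / 2\<close>.\<close>

lemma weak_type:
  assumes v: "smooth v" and C: "C > 0" "\<And>x t. t > 0 \<Longrightarrow> \<bar>avg t v x\<bar> \<le> C / t"
    and l: "l > 0" "l * R \<ge> 2 * C"
  shows "l ^ 4 * measure lborel (levelset R v l) \<le> 16 * C\<^sup>2 * bint (2 * R) (gsq v)"
proof -
  define t where "t = 2 * C / l"
  have t: "t > 0" "t \<le> R" using C(1) l by (simp_all add: t_def field_simps)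
  have B: "bint (2 * R) (gsq v) \<ge> 0" by (rule bint_nonneg) (rule gsq_nonneg)
  have [measurable]: "levelset R v l \<in> sets borel" by (rule levelset_measurable[OF v])
  have "ennreal (l\<^sup>2 / 4) * emeasure lborel (levelset R v l) = (\<integral>\<^sup>+x. ennreal (l\<^sup>2 / 4) * indicator (levelset R v l) x \<partial>lborel)"
    by (subst nn_integral_cmult_indicator) auto
  also have "\<dots> \<le> (\<integral>\<^sup>+x. ennreal (indicator (cball 0 R) x * (v x - avg t v x)\<^sup>2) \<partial>lborel)"
  proof (rule nn_integral_mono)
    fix x
    show "ennreal (l\<^sup>2 / 4) * indicator (levelset R v l) x \<le> ennreal (indicator (cball 0 R) x * (v x - avg t v x)\<^sup>2)"
    proof (cases "x \<in> levelset R v l")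
      case True
      have "\<bar>avg t v x\<bar> \<le> l / 2" using C(2)[OF t(1), of x] C(1) l(1) by (simp add: t_def)
      moreover have "l < \<bar>v x\<bar>" using True by (simp add: levelset_def)
      ultimately have "l / 2 \<le> \<bar>v x - avg t v x\<bar>" by linarith
      then have "(l / 2)\<^sup>2 \<le> \<bar>v x - avg t v x\<bar>\<^sup>2" using l(1) by (intro power_mono) auto
      then show ?thesis using True by (auto simp: levelset_def power_divide intro!: ennreal_leI)
    qed simp
  qed
  also have "\<dots> \<le> ennreal (t\<^sup>2 * bint (2 * R) (gsq v))" by (rule avg_difference_le[OF v t])
  finally have "ennreal (l\<^sup>2 / 4) * emeasure lborel (levelset R v l) \<le> ennreal (t\<^sup>2 * bint (2 * R) (gsq v))" .
  moreover have "emeasure lborel (levelset R v l) = ennreal (measure lborel (levelset R v l))"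
    using emeasure_levelset_finite[of R v l] by (intro emeasure_eq_ennreal_measure) auto
  ultimately have "ennreal (l\<^sup>2 / 4) * ennreal (measure lborel (levelset R v l)) \<le> ennreal (t\<^sup>2 * bint (2 * R) (gsq v))"
    by (simp only:)
  then have "ennreal ((l\<^sup>2 / 4) * measure lborel (levelset R v l)) \<le> ennreal (t\<^sup>2 * bint (2 * R) (gsq v))"
    by (subst ennreal_mult) auto
  then have "(l\<^sup>2 / 4) * measure lborel (levelset R v l) \<le> t\<^sup>2 * bint (2 * R) (gsq v)"
    using B by (subst (asm) ennreal_le_iff) auto
  then have "(4 * l\<^sup>2) * ((l\<^sup>2 / 4) * measure lborel (levelset R v l)) \<le> (4 * l\<^sup>2) * (t\<^sup>2 * bint (2 * R) (gsq v))"
    by (rule mult_left_mono) simp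
  also have "(4 * l\<^sup>2) * (t\<^sup>2 * bint (2 * R) (gsq v)) = 16 * C\<^sup>2 * bint (2 * R) (gsq v)"
    using l(1) by (simp add: t_def power_divide power_mult_distrib field_simps)
  finally show ?thesis by (simp add: power_numeral_reduce mult_ac)
qed

text \<open>A discrete layer-cake formula. If t lies between consecutive levels 2^k l and 2^(k+1) l,
  the single summand for k already dominates because of the factor 16 = 2^4; below \<open>l\<close>
  the first term suffices, and above the top level t^4 is traded for t^6.\<close>

lemma dyadic_fourth_power:
  fixes t l :: real
  assumes l: "l > 0" and t: "t \<ge> 0"
  shows "t ^ 4 \<le> l ^ 4 + 16 * (\<Sum>k\<le>N. (2 ^ k * l) ^ 4 * (if t > 2 ^ k * l then 1 else 0)) + t ^ 6 / (2 ^ Suc N * l)\<^sup>2"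
proof -
  let ?S = "\<lambda>N. 16 * (\<Sum>k\<le>N. (2 ^ k * l) ^ 4 * (if t > 2 ^ k * l then 1 else 0))"
  have S0: "?S N \<ge> 0" for N by (intro mult_nonneg_nonneg sum_nonneg) auto
  have base: "t ^ 4 \<le> l ^ 4 + ?S N" if "t \<le> l" for N
    using power_mono[OF that t, of 4] S0[of N] by linarith
  have st: "t ^ 4 \<le> 16 * (2 ^ k * l) ^ 4" if "t \<le> 2 ^ Suc k * l" for k
    using power_mono[OF that t, of 4] by (simp add: power_mult_distrib)
  have P: "t \<le> 2 ^ Suc N * l \<Longrightarrow> t ^ 4 \<le> l ^ 4 + ?S N" for N
  proof (induction N)
    case 0
    show ?case
    proof (cases "t \<le> l")
      case True then show ?thesis by (rule base)
    next
      case False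
      then have "?S 0 = 16 * l ^ 4" by simp
      moreover have "t ^ 4 \<le> 16 * l ^ 4" using st[of 0] 0 by simp
      moreover have "l ^ 4 \<ge> 0" by simp
      ultimately show ?thesis by linarith
    qed
  next
    case (Suc N)
    show ?case
    proof (cases "t \<le> 2 ^ Suc N * l")
      case True
      have "?S N \<le> ?S (Suc N)" by simp
      then show ?thesis using Suc.IH[OF True] by linarith
    next
      case False
      then have "?S (Suc N) = ?S N + 16 * (2 ^ Suc N * l) ^ 4" by (simp add: algebra_simps)
      moreover have "t ^ 4 \<le> 16 * (2 ^ Suc N * l) ^ 4" by (rule st[OF Suc.prems])
      moreover have "l ^ 4 \<ge> 0" by simp
      ultimately show ?thesis using S0[of N] by linarith
    qed
  qed
  have t6: "0 \<le> t ^ 6 / (2 ^ Suc N * l)\<^sup>2" using t by simp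
  show ?thesis
  proof (cases "t \<le> 2 ^ Suc N * l")
    case True from P[OF this] t6 show ?thesis by linarith
  next
    case False
    then have "(2 ^ Suc N * l)\<^sup>2 \<le> t\<^sup>2" using l by (intro power_mono) auto
    then have "t ^ 4 * (2 ^ Suc N * l)\<^sup>2 \<le> t ^ 4 * t\<^sup>2" by (rule mult_left_mono) simp
    then have "t ^ 4 * (2 ^ Suc N * l)\<^sup>2 \<le> t ^ 6" by (simp flip: power_add)
    then have "t ^ 4 \<le> t ^ 6 / (2 ^ Suc N * l)\<^sup>2" using l by (simp add: pos_le_divide_eq)
    moreover have "l ^ 4 \<ge> 0" by simp
    ultimately show ?thesis using S0[of N] by linarith
  qed
qed

text \<open>Each dyadic level contributes the same multiple of the gradient integral, whence the
  factor \<open>Suc N\<close>. The condition \<open>2 ^ N \<ge> R\<^sup>2\<close> lifts the top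
  level to order \<open>R\<close>, so that the sixth-power tail is at most of order 1/R, like the
  contribution below the lowest level.\<close>

lemma fourth_power_integral:
  assumes v: "smooth v" and C: "C > 0" "\<And>x t. t > 0 \<Longrightarrow> \<bar>avg t v x\<bar> \<le> C / t"
    and S: "\<And>R. bint R (\<lambda>x. (v x) ^ 6) \<le> S"
  shows "\<exists>K>0. \<forall>R N. R \<ge> 1 \<longrightarrow> 2 ^ N \<ge> R\<^sup>2 \<longrightarrow> bint R (\<lambda>x. (v x) ^ 4) \<le> K * (1 / R + real (Suc N) * bint (2 * R) (gsq v))"
proof -
  define V where "V = unit_ball_vol (3::real)"
  have V: "V > 0" by (simp add: V_def)
  have S0: "S \<ge> 0" using S[of 0] bint_nonneg[of 0 "\<lambda>x. (v x) ^ 6"] by (simp add: order_trans)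
  define K where "K = 16 * C ^ 4 * V + S / (4 * C\<^sup>2) + 256 * C\<^sup>2"
  have K0: "K > 0" unfolding K_def using C(1) V S0 by (intro add_nonneg_pos add_nonneg_nonneg) auto
  show ?thesis
  proof (intro exI[of _ K] conjI K0 allI impI)
    fix R :: real and N :: nat
    assume R: "R \<ge> 1" and N: "2 ^ N \<ge> R\<^sup>2"
    define B where "B = bint (2 * R) (gsq v)"
    have B: "B \<ge> 0" unfolding B_def by (rule bint_nonneg) (rule gsq_nonneg)
    \<comment> \<open>The smallest level admissible for \<open>weak_type\<close>, which requires
      \<open>l * R \<ge> 2 * C\<close>. Values below it contribute at most l^4 times the volume,
      which is 16 C^4 V / R.\<close>
    define l where "l = 2 * C / R"
    have l: "l > 0" using C R by (simp add: l_def)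
    define L where "L k = levelset R v (2 ^ k * l)" for k
    have Lm: "L k \<in> sets borel" for k unfolding L_def by (rule levelset_measurable[OF v])
    have Li: "integrable lborel (indicator (L k) :: real^3 \<Rightarrow> real)" for k
      using Lm emeasure_levelset_finite unfolding L_def by (intro integrable_real_indicator) auto
    have i: "integrable lborel (\<lambda>x. indicator (cball 0 R) x * k x)" if "smooth k" for k :: "real^3 \<Rightarrow> real"
      by (rule integrable_indicator_cball[OF smooth_continuous[OF that]])
    have "bint R (\<lambda>x. (v x) ^ 4) \<le> (\<integral>x. indicator (cball 0 R) x * l ^ 4 + 16 * (\<Sum>k\<le>N. (2 ^ k * l) ^ 4 * indicator (L k) x)
         + (1 / (2 ^ Suc N * l)\<^sup>2) * (indicator (cball 0 R) x * (v x) ^ 6) \<partial>lborel)"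
      unfolding bint_def
    proof (rule integral_mono)
      show "integrable lborel (\<lambda>x. indicator (cball 0 R) x * (v x) ^ 4)" by (intro i smooth_power v)
      show "integrable lborel (\<lambda>x. indicator (cball 0 R) x * l ^ 4 + 16 * (\<Sum>k\<le>N. (2 ^ k * l) ^ 4 * indicator (L k) x)
         + (1 / (2 ^ Suc N * l)\<^sup>2) * (indicator (cball 0 R) x * (v x) ^ 6))"
        by (intro Bochner_Integration.integrable_add i smooth_const integrable_mult_right Bochner_Integration.integrable_sum Li smooth_power v)
      fix x
      show "indicator (cball 0 R) x * (v x) ^ 4 \<le> indicator (cball 0 R) x * l ^ 4 + 16 * (\<Sum>k\<le>N. (2 ^ k * l) ^ 4 * indicator (L k) x)
         + (1 / (2 ^ Suc N * l)\<^sup>2) * (indicator (cball 0 R) x * (v x) ^ 6)"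
      proof (cases "x \<in> cball 0 R")
        case True
        have "indicator (L k) x = (if \<bar>v x\<bar> > 2 ^ k * l then 1 else 0 :: real)" for k
          using True by (simp add: L_def levelset_def)
        then show ?thesis using True dyadic_fourth_power[OF l abs_ge_zero, of "v x" N] by (simp add: power_even_abs)
      next
        case False then show ?thesis by (auto intro!: sum_nonneg)
      qed
    qed
    also have "\<dots> = l ^ 4 * (V * R ^ 3) + 16 * (\<Sum>k\<le>N. (2 ^ k * l) ^ 4 * measure lborel (L k)) + (1 / (2 ^ Suc N * l)\<^sup>2) * bint R (\<lambda>x. (v x) ^ 6)"
    proof -
      have 1: "(\<integral>x. indicator (cball 0 R) x * l ^ 4 \<partial>(lborel :: (real^3) measure)) = l ^ 4 * (V * R ^ 3)"
        using bint_const[of R "l ^ 4", where 'a="real^3"] R by (simp add: bint_def V_def)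
      have 2: "(LBINT x. (\<Sum>k\<le>N. (2 ^ k * l) ^ 4 * indicator (L k) x)) = (\<Sum>k\<le>N. (2 ^ k * l) ^ 4 * measure lborel (L k))"
        by (subst Bochner_Integration.integral_sum) (auto intro!: integrable_mult_right Li simp: Lm)
      have i1: "integrable lborel (\<lambda>x::real^3. indicator (cball 0 R) x * l ^ 4)"
        "integrable lborel (\<lambda>x. 16 * (\<Sum>k\<le>N. (2 ^ k * l) ^ 4 * indicator (L k) x))"
        "integrable lborel (\<lambda>x. (1 / (2 ^ Suc N * l)\<^sup>2) * (indicator (cball 0 R) x * (v x) ^ 6))"
        by (intro Bochner_Integration.integrable_add i smooth_const integrable_mult_right Bochner_Integration.integrable_sum Li smooth_power v)+
      show ?thesis
        unfolding Bochner_Integration.integral_add[OF Bochner_Integration.integrable_add[OF i1(1,2)] i1(3)] Bochner_Integration.integral_add[OF i1(1,2)]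
          integral_mult_right_zero 1 2 bint_def ..
    qed
    also have "\<dots> \<le> l ^ 4 * (V * R ^ 3) + 16 * (\<Sum>k\<le>N. 16 * C\<^sup>2 * B) + (1 / (2 ^ Suc N * l)\<^sup>2) * S"
    proof (intro add_mono mult_left_mono sum_mono S order_refl)
      fix k
      have "1 * (l * R) \<le> 2 ^ k * (l * R)" using l R by (intro mult_right_mono) auto
      moreover have "l * R = 2 * C" using R by (simp add: l_def)
      ultimately have "2 ^ k * l * R \<ge> 2 * C" by (simp add: mult.assoc)
      then show "(2 ^ k * l) ^ 4 * measure lborel (L k) \<le> 16 * C\<^sup>2 * B"
        unfolding L_def B_def using l by (intro weak_type[OF v C]) auto
    qed (use V l R in auto)
    also have "l ^ 4 * (V * R ^ 3) = (16 * C ^ 4 * V) * (1 / R)"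
      using R by (simp add: l_def power_divide power_mult_distrib field_simps power_numeral_reduce)
    also have "16 * (\<Sum>k\<le>N. 16 * C\<^sup>2 * B) = (256 * C\<^sup>2) * (real (Suc N) * B)" by simp
    also have "(1 / (2 ^ Suc N * l)\<^sup>2) * S \<le> (S / (4 * C\<^sup>2)) * (1 / R)"
    proof -
      have "(2::real) ^ N \<le> 2 ^ Suc N" by simp
      then have "R\<^sup>2 \<le> 2 ^ Suc N" using N by linarith
      then have "R\<^sup>2 * l \<le> 2 ^ Suc N * l" using l by (intro mult_right_mono) auto
      moreover have "R\<^sup>2 * l = 2 * C * R" using R by (simp add: l_def power2_eq_square)
      ultimately have "2 * C * R \<le> 2 ^ Suc N * l" by (simp only:)
      then have "(2 * C * R)\<^sup>2 \<le> (2 ^ Suc N * l)\<^sup>2" using C R by (intro power_mono) auto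
      then have "1 / (2 ^ Suc N * l)\<^sup>2 \<le> 1 / (2 * C * R)\<^sup>2" 
      proof (rule divide_left_mono)
        show "0 < (2 ^ Suc N * l)\<^sup>2 * (2 * C * R)\<^sup>2"
          using C R l by (intro mult_pos_pos zero_less_power) auto
      qed auto
      also have "\<dots> \<le> 1 / (4 * C\<^sup>2 * R)"
        using C R by (intro divide_left_mono) (auto simp: power_mult_distrib power2_eq_square)
      finally have "(1 / (2 ^ Suc N * l)\<^sup>2) * S \<le> 1 / (4 * C\<^sup>2 * R) * S" using S0 by (rule mult_right_mono)
      then show ?thesis by (simp add: field_simps)
    qed
    finally have "bint R (\<lambda>x. (v x) ^ 4) \<le> (16 * C ^ 4 * V + S / (4 * C\<^sup>2)) * (1 / R) + (256 * C\<^sup>2) * (real (Suc N) * B)"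
      by (simp add: algebra_simps)
    also have "\<dots> \<le> K * (1 / R) + K * (real (Suc N) * B)"
      using C(1) V S0 B R by (intro add_mono mult_right_mono) (auto simp: K_def)
    finally show "bint R (\<lambda>x. (v x) ^ 4) \<le> K * (1 / R + real (Suc N) * bint (2 * R) (gsq v))"
      by (simp add: B_def distrib_left)
  qed
qed

section \<open>Bootstrapping the growth of the energy\<close>

text \<open>A purely numerical step: two free parameters are set to the powers of \<open>R\<close>
  that balance the two sides of each inequality. The factor 512 = 8^3 and the constant
  \<open>Y\<close> account for the passage from radius \<open>R\<close> to
  \<open>8 * R\<close>.\<close>

lemma bootstrap_energy:
  fixes E X2 X4 :: "real \<Rightarrow> real"
  assumes en: "\<And>s R. s > 0 \<Longrightarrow> R > 0 \<Longrightarrow> E R \<le> C * (s * X4 (8 * R) + (1 + 1 / s) * (X2 (8 * R) / R\<^sup>2))" and C: "C > 0"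
    and x2: "\<And>d R. d > 0 \<Longrightarrow> R > 0 \<Longrightarrow> X2 R \<le> d * X4 R + V * R ^ 3 / d" and V: "V \<ge> 0"
    and b: "b \<ge> -1" and K: "K > 0" and X4: "\<And>R. R \<ge> 1 \<Longrightarrow> X4 R \<le> K * R powr b"
  shows "\<exists>K>0. \<forall>R\<ge>1. E R \<le> K * R powr (3 / 4 * b - 1 / 4)"
proof -
  define Y where "Y = K * 8 powr b"
  have Y: "Y > 0" using K by (simp add: Y_def)
  define L where "L = C * (Y + 2 * (Y + 512 * V))"
  have L: "L > 0" unfolding L_def using C Y V by (intro mult_pos_pos add_pos_nonneg) auto
  show ?thesis
  proof (intro exI[of _ L] conjI L allI impI)
    fix R :: real assume R: "R \<ge> 1"
    \<comment> \<open>\<open>d\<close> balances d R^b against R^3 / d, both of order R^(3/2 + b/2).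
      With X2 / R^2 then of order R^(b/2 - 1/2), \<open>s\<close> balances s R^b against R^(b/2 -
      1/2) / s, and the common exponent is 3b/4 - 1/4.\<close>
    define s where "s = R powr (- (1 + b) / 4)"
    define d where "d = R powr (3 / 2 - b / 2)"
    have s: "s > 0" and d: "d > 0" using R by (auto simp: s_def d_def)
    have X8: "X4 (8 * R) \<le> Y * R powr b"
      using X4[of "8 * R"] R by (simp add: Y_def powr_mult mult.assoc)
    have "X2 (8 * R) \<le> d * X4 (8 * R) + V * (8 * R) ^ 3 / d" using d R by (intro x2) auto
    also have "\<dots> \<le> d * (Y * R powr b) + V * (8 * R) ^ 3 / d" using d X8 by simp
    also have "d * (Y * R powr b) = Y * R powr (3 / 2 + b / 2)"
    proof -
      have "d * R powr b = R powr (3 / 2 + b / 2)"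
        unfolding d_def powr_add[symmetric] by (rule arg_cong[where f="\<lambda>t. R powr t"]) (simp add: field_simps)
      then show ?thesis by (metis mult.assoc mult.commute)
    qed
    also have "V * (8 * R) ^ 3 / d = 512 * V * (R powr 3 / d)"
      using R by (simp add: power_mult_distrib powr_numeral)
    also have "R powr 3 / d = R powr (3 / 2 + b / 2)"
      unfolding d_def powr_diff[symmetric] by (rule arg_cong[where f="\<lambda>t. R powr t"]) (simp add: field_simps)
    finally have "X2 (8 * R) \<le> (Y + 512 * V) * R powr (3 / 2 + b / 2)" by (simp add: algebra_simps)
    then have "X2 (8 * R) / R\<^sup>2 \<le> (Y + 512 * V) * R powr (3 / 2 + b / 2) / R\<^sup>2"
      using R by (intro divide_right_mono) auto
    also have "R\<^sup>2 = R powr 2" using R by (simp add: powr_numeral)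
    also have "(Y + 512 * V) * R powr (3 / 2 + b / 2) / R powr 2 = (Y + 512 * V) * R powr (b / 2 - 1 / 2)"
    proof -
      have "R powr (3 / 2 + b / 2) / R powr 2 = R powr (b / 2 - 1 / 2)"
        unfolding powr_diff[symmetric] by (rule arg_cong[where f="\<lambda>t. R powr t"]) (simp add: field_simps)
      then show ?thesis by (simp only: times_divide_eq_right[symmetric])
    qed
    finally have X2b: "X2 (8 * R) / R powr 2 \<le> (Y + 512 * V) * R powr (b / 2 - 1 / 2)" .
    have sinv: "1 / s = R powr ((1 + b) / 4)"
      unfolding s_def inverse_eq_divide[symmetric] powr_minus[symmetric]
      by (rule arg_cong[where f="\<lambda>t. R powr t"]) (simp add: field_simps)
    \<comment> \<open>Here \<open>b \<ge> -1\<close> enters: it makes \<open>s\<close> at most 1, so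
      that \<open>1 + 1 / s\<close> can be replaced by \<open>2 * (1 / s)\<close>.\<close>
    have s1: "1 / s \<ge> 1" unfolding sinv using R b by (intro ge_one_powr_ge_zero) auto
    have "E R \<le> C * (s * X4 (8 * R) + (1 + 1 / s) * (X2 (8 * R) / R\<^sup>2))"
      using s R by (intro en) auto
    also have "\<dots> \<le> C * (s * (Y * R powr b) + (1 + 1 / s) * ((Y + 512 * V) * R powr (b / 2 - 1 / 2)))"
      using C s X8 X2b R by (intro mult_left_mono add_mono) (auto simp: powr_numeral)
    also have "\<dots> \<le> C * (s * (Y * R powr b) + (2 * (1 / s)) * ((Y + 512 * V) * R powr (b / 2 - 1 / 2)))"
      using C s1 Y V R by (intro mult_left_mono add_left_mono mult_right_mono) auto
    also have "s * (Y * R powr b) = Y * R powr (3 / 4 * b - 1 / 4)"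
    proof -
      have "s * R powr b = R powr (3 / 4 * b - 1 / 4)"
        unfolding s_def powr_add[symmetric] by (rule arg_cong[where f="\<lambda>t. R powr t"]) (simp add: field_simps)
      then show ?thesis by (metis mult.assoc mult.commute)
    qed
    also have "(2 * (1 / s)) * ((Y + 512 * V) * R powr (b / 2 - 1 / 2)) = 2 * (Y + 512 * V) * (R powr ((1 + b) / 4) * R powr (b / 2 - 1 / 2))"
      unfolding sinv by (simp add: mult_ac)
    also have "R powr ((1 + b) / 4) * R powr (b / 2 - 1 / 2) = R powr (3 / 4 * b - 1 / 4)"
      unfolding powr_add[symmetric] by (rule arg_cong[where f="\<lambda>t. R powr t"]) (simp add: field_simps)
    finally show "E R \<le> L * R powr (3 / 4 * b - 1 / 4)" by (simp add: L_def algebra_simps)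
  qed
qed

text \<open>The assumption on \<open>a\<close> lets the term 1/R be absorbed into the power of
  \<open>R\<close>, so the only loss against the energy exponent is the 1/16 that stands for the
  logarithm.\<close>

lemma bootstrap_fourth:
  fixes E X4 :: "real \<Rightarrow> real"
  assumes x4: "\<And>R. R \<ge> 1 \<Longrightarrow> X4 R \<le> C * (1 / R + R powr (1 / 16) * E (2 * R))" and C: "C > 0"
    and a: "a \<ge> -1" and K: "K > 0" and E: "\<And>R. R \<ge> 1 \<Longrightarrow> E R \<le> K * R powr a"
  shows "\<exists>K>0. \<forall>R\<ge>1. X4 R \<le> K * R powr (a + 1 / 16)"
proof -
  define L where "L = C * (1 + K * 2 powr a)"
  have L: "L > 0" unfolding L_def using C K by (intro mult_pos_pos add_pos_pos) auto
  show ?thesis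
  proof (intro exI[of _ L] conjI L allI impI)
    fix R :: real assume R: "R \<ge> 1"
    have "1 / R = R powr (- 1)" using R by (simp add: powr_minus divide_inverse)
    also have "\<dots> \<le> R powr (a + 1 / 16)" using R a by (intro powr_mono) auto
    finally have 1: "1 / R \<le> R powr (a + 1 / 16)" .
    have "R powr (1 / 16) * E (2 * R) \<le> R powr (1 / 16) * (K * (2 * R) powr a)"
      using R E[of "2 * R"] by (intro mult_left_mono) auto
    also have "\<dots> = (K * 2 powr a) * R powr (a + 1 / 16)"
      using R by (simp add: powr_mult powr_add mult_ac)
    finally have 2: "R powr (1 / 16) * E (2 * R) \<le> (K * 2 powr a) * R powr (a + 1 / 16)" .
    have "X4 R \<le> C * (1 / R + R powr (1 / 16) * E (2 * R))" by (rule x4[OF R])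
    also have "\<dots> \<le> C * (R powr (a + 1 / 16) + (K * 2 powr a) * R powr (a + 1 / 16))"
      using C 1 2 by (intro mult_left_mono add_mono) auto
    finally show "X4 R \<le> L * R powr (a + 1 / 16)" by (simp add: L_def algebra_simps)
  qed
qed

text \<open>The exponents of \<open>X4\<close> are \<open>1\<close>, \<open>9/16\<close>, \<open>15/64\<close>; the last one is below \<open>1/3\<close>, which makes the
  exponent of \<open>E\<close> negative.\<close>

lemma bootstrap_vanish:
  fixes E X2 X4 :: "real \<Rightarrow> real"
  assumes en: "\<And>s R. s > 0 \<Longrightarrow> R > 0 \<Longrightarrow> E R \<le> C * (s * X4 (8 * R) + (1 + 1 / s) * (X2 (8 * R) / R\<^sup>2))" and C: "C > 0"
    and x2: "\<And>d R. d > 0 \<Longrightarrow> R > 0 \<Longrightarrow> X2 R \<le> d * X4 R + V * R ^ 3 / d" and V: "V \<ge> 0"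
    and x4: "\<And>R. R \<ge> 1 \<Longrightarrow> X4 R \<le> D * (1 / R + R powr (1 / 16) * E (2 * R))" and D: "D > 0"
    and x40: "\<And>R. R \<ge> 1 \<Longrightarrow> X4 R \<le> K * R" and K: "K > 0"
    and mono: "\<And>R S. R \<le> S \<Longrightarrow> E R \<le> E S"
  shows "E R \<le> 0"
proof -
  note E = bootstrap_energy[of E C X4 X2 V, OF en C x2 V] and X = bootstrap_fourth[of X4 D E, OF x4 D]
  have "\<exists>K>0. \<forall>R\<ge>1. E R \<le> K * R powr (3 / 4 * 1 - 1 / 4)"
    by (rule E[of 1 K]) (use K x40 in auto)
  then obtain K1 where K1: "K1 > 0" "\<And>R. R \<ge> 1 \<Longrightarrow> E R \<le> K1 * R powr (1 / 2)" by auto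
  have "\<exists>K>0. \<forall>R\<ge>1. X4 R \<le> K * R powr (1 / 2 + 1 / 16)"
    by (rule X[of "1/2" K1]) (use K1 in auto)
  then obtain K2 where K2: "K2 > 0" "\<And>R. R \<ge> 1 \<Longrightarrow> X4 R \<le> K2 * R powr (9 / 16)" by auto
  have "\<exists>K>0. \<forall>R\<ge>1. E R \<le> K * R powr (3 / 4 * (9 / 16) - 1 / 4)"
    by (rule E[of "9/16" K2]) (use K2 in auto)
  then obtain K3 where K3: "K3 > 0" "\<And>R. R \<ge> 1 \<Longrightarrow> E R \<le> K3 * R powr (11 / 64)" by auto
  have "\<exists>K>0. \<forall>R\<ge>1. X4 R \<le> K * R powr (11 / 64 + 1 / 16)"
    by (rule X[of "11/64" K3]) (use K3 in auto)
  then obtain K4 where K4: "K4 > 0" "\<And>R. R \<ge> 1 \<Longrightarrow> X4 R \<le> K4 * R powr (15 / 64)" by auto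
  have "\<exists>K>0. \<forall>R\<ge>1. E R \<le> K * R powr (3 / 4 * (15 / 64) - 1 / 4)"
    by (rule E[of "15/64" K4]) (use K4 in auto)
  then obtain K5 where K5: "K5 > 0" "\<And>R. R \<ge> 1 \<Longrightarrow> E R \<le> K5 * R powr (- 19 / 256)" by auto
  have "((\<lambda>S::real. K5 * S powr (- 19 / 256)) \<longlongrightarrow> K5 * 0) at_top"
    by (intro tendsto_mult_left tendsto_neg_powr filterlim_ident) simp
  moreover have "eventually (\<lambda>S. E R \<le> K5 * S powr (- 19 / 256)) at_top"
    using eventually_ge_at_top[of "max R 1"]
  proof eventually_elim
    case (elim S)
    then show ?case using mono[of R S] K5(2)[of S] by linarith
  qed
  ultimately show ?thesis using tendsto_lowerbound[of "\<lambda>S. K5 * S powr (- 19 / 256)" "K5 * 0" at_top "E R"] by simp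
qed

text \<open>Replaces the logarithmic number of levels by a small power. A loss of eta per round
  takes the exponents of the fourth power from 1 to 1/2 + eta and to 1/8 + 7 eta / 4, which must
  fall below 1/3: eta = 1/16 gives 15/64, whereas 1/8 would give 11/32. The factor 66 = 2 * 32 + 2
  comes from ln R \<le> 16 R^(1/16) and ln 2 \<ge> 1/2.\<close>

lemma dyadic_scale:
  fixes R :: real
  assumes R: "R \<ge> 1"
  obtains N :: nat where "2 ^ N \<ge> R\<^sup>2" "real (Suc N) \<le> 66 * R powr (1 / 16)"
proof
  define N where "N = nat \<lceil>2 * log 2 R\<rceil>"
  have l0: "log 2 R \<ge> 0" using R by simp
  have "2 powr (2 * log 2 R) = 2 powr (log 2 R + log 2 R)" by simp
  also have "\<dots> = R\<^sup>2" unfolding powr_add using R by (simp add: power2_eq_square)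
  finally have "R\<^sup>2 = 2 powr (2 * log 2 R)" by (rule sym)
  also have "\<dots> \<le> 2 powr (real N)" unfolding N_def by (intro powr_mono) linarith+
  also have "\<dots> = 2 ^ N" by (rule powr_realpow) simp
  finally show "2 ^ N \<ge> R\<^sup>2" .
  have "ln R = 16 * ln (R powr (1 / 16))" using R by (simp add: ln_powr)
  also have "\<dots> \<le> 16 * R powr (1 / 16)" using R ln_le_minus_one[of "R powr (1/16)"] by simp
  finally have lnR: "ln R \<le> 16 * R powr (1 / 16)" .
  have "ln (2::real) \<ge> 1 / 2" using ln_le_minus_one[of "1 / 2"] by (simp add: ln_div)
  then have "log 2 R \<le> ln R / (1 / 2)" unfolding log_def using R by (intro divide_left_mono) auto
  then have "log 2 R \<le> 32 * R powr (1 / 16)" using lnR by simp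
  moreover have "1 \<le> R powr (1 / 16)" using R by (intro ge_one_powr_ge_zero) auto
  moreover have "real N \<le> 2 * log 2 R + 1" unfolding N_def using l0 by linarith
  ultimately show "real (Suc N) \<le> 66 * R powr (1 / 16)" by simp
qed

section \<open>Applying the bootstrap to the system\<close>

lemma mod_sq_square_le: "(mod_sq u h x)\<^sup>2 \<le> 6 * (\<Sum>i\<in>UNIV. (u i x) ^ 4 + (h i x) ^ 4)"
proof -
  have "(mod_sq u h x)\<^sup>2 \<le> 3 * (\<Sum>i\<in>UNIV. ((u i x)\<^sup>2 + (h i x)\<^sup>2)\<^sup>2)"
    unfolding mod_sq_def by (rule sum3_square_le)
  also have "\<dots> \<le> 3 * (\<Sum>i\<in>UNIV. 2 * ((u i x) ^ 4 + (h i x) ^ 4))"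
  proof (intro mult_left_mono sum_mono)
    fix i
    have "0 \<le> ((u i x)\<^sup>2 - (h i x)\<^sup>2)\<^sup>2" by simp
    then show "((u i x)\<^sup>2 + (h i x)\<^sup>2)\<^sup>2 \<le> 2 * ((u i x) ^ 4 + (h i x) ^ 4)"
      by (simp add: power2_sum power2_diff flip: power_mult)
  qed simp
  finally show ?thesis by (simp add: sum_distrib_left algebra_simps)
qed

lemma fourth_power_mhd:
  assumes su: "\<And>i. smooth (u i)" and sh: "\<And>i. smooth (h i)"
    and Cu: "\<And>i. \<exists>C>0. \<forall>x t. t > 0 \<longrightarrow> \<bar>avg t (u i) x\<bar> \<le> C / t"
    and Ch: "\<And>i. \<exists>C>0. \<forall>x t. t > 0 \<longrightarrow> \<bar>avg t (h i) x\<bar> \<le> C / t"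
    and S: "\<And>i R. bint R (\<lambda>x. (u i x) ^ 6) \<le> S" "\<And>i R. bint R (\<lambda>x. (h i x) ^ 6) \<le> S"
  shows "\<exists>K>0. \<forall>R\<ge>1. bint R (\<lambda>x. (mod_sq u h x)\<^sup>2) \<le> K * (1 / R + R powr (1 / 16) * bint (2 * R) (grad_sq u h))"
proof -
  have "\<exists>K>0. \<forall>R N. R \<ge> 1 \<longrightarrow> 2 ^ N \<ge> R\<^sup>2 \<longrightarrow> bint R (\<lambda>x. (u i x) ^ 4) \<le> K * (1 / R + real (Suc N) * bint (2 * R) (gsq (u i)))" for i
    using Cu[of i] fourth_power_integral[OF su _ _ S(1)] by blast
  then obtain A where A: "\<And>i. A i > 0" "\<And>i R N. R \<ge> 1 \<Longrightarrow> 2 ^ N \<ge> R\<^sup>2 \<Longrightarrow> bint R (\<lambda>x. (u i x) ^ 4) \<le> A i * (1 / R + real (Suc N) * bint (2 * R) (gsq (u i)))"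
    by metis
  have "\<exists>K>0. \<forall>R N. R \<ge> 1 \<longrightarrow> 2 ^ N \<ge> R\<^sup>2 \<longrightarrow> bint R (\<lambda>x. (h i x) ^ 4) \<le> K * (1 / R + real (Suc N) * bint (2 * R) (gsq (h i)))" for i
    using Ch[of i] fourth_power_integral[OF sh _ _ S(2)] by blast
  then obtain B where B: "\<And>i. B i > 0" "\<And>i R N. R \<ge> 1 \<Longrightarrow> 2 ^ N \<ge> R\<^sup>2 \<Longrightarrow> bint R (\<lambda>x. (h i x) ^ 4) \<le> B i * (1 / R + real (Suc N) * bint (2 * R) (gsq (h i)))"
    by metis
  \<comment> \<open>The constants differ from component to component, and their sum serves all six
    at once. In \<open>K\<close> below, 396 = 6 * 66, with 6 from \<open>mod_sq_square_le\<close>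
    and 66 from \<open>dyadic_scale\<close>.\<close>
  define M where "M = (\<Sum>i\<in>UNIV. A i + B i)"
  have M: "M > 0" unfolding M_def using A(1) B(1) by (intro sum_pos add_pos_pos) auto
  define K where "K = 396 * M"
  have K: "K > 0" using M by (simp add: K_def)
  show ?thesis
  proof (intro exI[of _ K] conjI K allI impI)
    fix R :: real assume R: "R \<ge> 1"
    obtain N :: nat where N: "2 ^ N \<ge> R\<^sup>2" "real (Suc N) \<le> 66 * R powr (1 / 16)" by (rule dyadic_scale[OF R])
    define E where "E = bint (2 * R) (grad_sq u h)"
    note co = smooth_continuous[OF su] smooth_continuous[OF sh]
    have sg: "smooth (grad_sq u h)" unfolding grad_sq_def[abs_def] by (intro smooth_rules su sh)
    have sq: "smooth (mod_sq u h)" unfolding mod_sq_def[abs_def] by (intro smooth_rules su sh)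
    have E0: "E \<ge> 0" unfolding E_def by (rule bint_nonneg) (rule grad_sq_nonneg)
    have g: "bint (2 * R) (gsq (u i)) \<le> E" "bint (2 * R) (gsq (h i)) \<le> E" for i
    proof -
      have *: "gsq (u i) x + gsq (h i) x \<le> grad_sq u h x" for x
        using member_le_sum[of i UNIV "\<lambda>i. \<Sum>j\<in>UNIV. (pd j (u i) x)\<^sup>2 + (pd j (h i) x)\<^sup>2"]
        by (simp add: grad_sq_def gsq_def sum.distrib sum_nonneg add_nonneg_nonneg)
      show "bint (2 * R) (gsq (u i)) \<le> E" "bint (2 * R) (gsq (h i)) \<le> E"
        unfolding E_def
        by (intro bint_mono smooth_continuous smooth_gsq su sh sg order_trans[OF _ *], simp add: gsq_nonneg)+
    qed
    define T where "T = 1 / R + real (Suc N) * E"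
    have T: "1 / R + real (Suc N) * b \<le> T" if "b \<le> E" for b
      unfolding T_def using that by (intro add_left_mono mult_left_mono) auto
    have "bint R (\<lambda>x. (mod_sq u h x)\<^sup>2) \<le> bint R (\<lambda>x. 6 * (\<Sum>i\<in>UNIV. (u i x) ^ 4 + (h i x) ^ 4))"
      by (intro bint_mono mod_sq_square_le) (intro smooth_continuous smooth_rules sq su sh)+
    also have "\<dots> = 6 * (\<Sum>i\<in>UNIV. bint R (\<lambda>x. (u i x) ^ 4) + bint R (\<lambda>x. (h i x) ^ 4))"
      unfolding bint_cmult by (subst bint_sum) (intro continuous_intros co | simp add: bint_add continuous_intros co)+
    also have "\<dots> \<le> 6 * (\<Sum>i\<in>UNIV. A i * T + B i * T)"
    proof (intro mult_left_mono sum_mono add_mono)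
      fix i
      have "bint R (\<lambda>x. (u i x) ^ 4) \<le> A i * (1 / R + real (Suc N) * bint (2 * R) (gsq (u i)))" by (rule A(2)[OF R N(1)])
      also have "\<dots> \<le> A i * T" by (intro mult_left_mono T g less_imp_le[OF A(1)])
      finally show "bint R (\<lambda>x. (u i x) ^ 4) \<le> A i * T" .
      have "bint R (\<lambda>x. (h i x) ^ 4) \<le> B i * (1 / R + real (Suc N) * bint (2 * R) (gsq (h i)))" by (rule B(2)[OF R N(1)])
      also have "\<dots> \<le> B i * T" by (intro mult_left_mono T g less_imp_le[OF B(1)])
      finally show "bint R (\<lambda>x. (h i x) ^ 4) \<le> B i * T" .
    qed simp
    also have "\<dots> = 6 * M * T" by (simp add: M_def sum_distrib_right sum_distrib_left distrib_right distrib_left sum.distrib mult.assoc)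
    also have "\<dots> \<le> 6 * M * (66 * (1 / R) + (66 * R powr (1 / 16)) * E)"
      unfolding T_def using M E0 N(2) R by (intro mult_left_mono add_mono mult_right_mono) (auto intro: divide_right_mono)
    also have "\<dots> = K * (1 / R + R powr (1 / 16) * E)" by (simp add: K_def algebra_simps)
    finally show "bint R (\<lambda>x. (mod_sq u h x)\<^sup>2) \<le> K * (1 / R + R powr (1 / 16) * bint (2 * R) (grad_sq u h))"
      by (simp add: E_def)
  qed
qed

lemma mem_L6_component:
  assumes v: "smooth_field v" and L: "mem_Lp 6 v"
  shows "\<exists>S. \<forall>i R. bint R (\<lambda>x. (v x $ i) ^ 6) \<le> S"
proof -
  have cv: "continuous_on UNIV (\<lambda>x. v x $ i)" for i
    using v by (auto simp: smooth_field_def intro: smooth_continuous)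
  then have "continuous_on UNIV (\<lambda>x. \<chi> i. v x $ i)" by (intro continuous_on_vec_lambda)
  then have cv: "continuous_on UNIV v" unfolding vec_lambda_eta .
  then have [measurable]: "v \<in> borel_measurable borel" by (rule borel_measurable_continuous_onI)
  have "integrable lebesgue (\<lambda>x. norm (v x) ^ 6)"
    using L by (simp add: mem_Lp_def)
  then have i: "integrable lborel (\<lambda>x. norm (v x) ^ 6)"
    by (subst (asm) integrable_completion) auto
  show ?thesis
  proof (intro exI[of _ "LBINT x. norm (v x) ^ 6"] allI)
    fix i R
    show "bint R (\<lambda>x. (v x $ i) ^ 6) \<le> (LBINT x. norm (v x) ^ 6)"
      unfolding bint_def
    proof (intro integral_mono i integrable_indicator_cball continuous_intros cv)
      fix x
      have "\<bar>v x $ i\<bar> ^ 6 \<le> norm (v x) ^ 6" by (intro power_mono component_le_norm_cart) simp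
      then show "indicator (cball 0 R) x * (v x $ i) ^ 6 \<le> norm (v x) ^ 6"
        by (auto simp: indicator_def power_even_abs)
    qed
  qed
qed

lemma bint_vanishing:
  fixes f :: "'a::euclidean_space \<Rightarrow> real"
  assumes f: "continuous_on UNIV f" "\<And>x. f x \<ge> 0" and z: "\<And>R. bint R f \<le> 0"
  shows "f x = 0"
proof (rule ccontr)
  assume "f x \<noteq> 0"
  then have c: "f x > 0" using f(2)[of x] by simp
  have "isCont f x" using f(1) by (simp add: continuous_on_eq_continuous_at)
  then obtain d where d: "d > 0" "\<And>y. dist y x < d \<Longrightarrow> dist (f y) (f x) < f x / 2"
    using c unfolding continuous_at_eps_delta by (metis half_gt_zero)
  have "0 < f x / 2 * measure lborel (ball x d)"
    using c d by (simp add: content_ball_pos)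
  also have "\<dots> = (LBINT y. (f x / 2) * indicator (ball x d) y)" by simp
  also have "\<dots> \<le> bint (norm x + d) f"
    unfolding bint_def
  proof (rule integral_mono)
    show "integrable lborel (\<lambda>y. (f x / 2) * indicator (ball x d) y)"
      by (intro integrable_mult_right integrable_real_indicator) (use emeasure_lborel_ball_finite[of x d] in auto)
    show "integrable lborel (\<lambda>y. indicator (cball 0 (norm x + d)) y * f y)" by (rule integrable_indicator_cball[OF f(1)])
    fix y
    show "(f x / 2) * indicator (ball x d) y \<le> indicator (cball 0 (norm x + d)) y * f y"
    proof (cases "y \<in> ball x d")
      case True
      then have "dist y x < d" by (simp add: dist_commute)
      then have "f x / 2 \<le> f y" using d(2)[of y] unfolding dist_real_def by linarith
      moreover have "norm y \<le> norm x + d"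
        using True norm_triangle_ineq2[of y x] by (simp add: dist_norm norm_minus_commute)
      ultimately show ?thesis using True by simp
    qed (use f(2)[of y] in \<open>auto simp: indicator_def\<close>)
  qed
  finally show False using z[of "norm x + d"] by simp
qed

lemma smooth_gradient_zero_imp_zero:
  fixes v :: "real^3 \<Rightarrow> real"
  assumes v: "smooth v" and d: "\<And>j x. pd j v x = 0" and S: "\<And>R. bint R (\<lambda>x. (v x) ^ 6) \<le> S"
  shows "v x = 0"
proof -
  have "\<forall>y\<in>UNIV. (v has_derivative (\<lambda>h. 0)) (at y within UNIV)"
    using has_derivative_partials[OF smooth_differentiable_at[OF v]] by (simp add: d)
  then obtain c where c: "\<And>y. v y = c"
    using has_derivative_zero_constant[of UNIV v] by auto
  define V where "V = unit_ball_vol (3::real)"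
  have V: "V > 0" by (simp add: V_def)
  have le: "c ^ 6 * V * R ^ 3 \<le> S" if "R \<ge> 0" for R
    using S[of R] bint_const[OF that, of "c ^ 6", where 'a="real^3"] by (simp add: c V_def)
  have "c = 0"
  proof (rule ccontr)
    assume "c \<noteq> 0"
    define q where "q = c ^ 6 * V"
    have q: "q > 0" unfolding q_def using V \<open>c \<noteq> 0\<close> by (intro mult_pos_pos) (auto simp: zero_less_power_eq)
    \<comment> \<open>Large enough that \<open>q * R\<close> exceeds |S|; as \<open>R\<close> is at
      least 1, its cube is larger still, and the sixth-power integral of a nonzero constant breaks
      the bound.\<close>
    define R where "R = \<bar>S\<bar> / q + 1"
    have R: "R \<ge> 1" using q by (simp add: R_def)
    have "\<bar>S\<bar> < q * R" using q by (simp add: R_def field_simps)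
    also have "\<dots> \<le> q * R ^ 3"
      using q R power_increasing[of 1 3 R] by (intro mult_left_mono) auto
    finally show False using le[of R] R unfolding q_def by linarith
  qed
  then show ?thesis using c by simp
qed

theorem theorem5:
  fixes u H :: "real^3 \<Rightarrow> real^3"
  assumes "smooth_MHD_solution u H"
    and "BMO_inv u" and "BMO_inv H"
    and "mem_Lp 6 u" and "mem_Lp 6 H"
  shows "(\<forall>x. u x = 0) \<and> (\<forall>x. H x = 0)"
proof -
  obtain p where uf: "smooth_field u" and Hf: "smooth_field H" and sp: "smooth p" and eq: "stationary_MHD u H p"
    using assms(1) unfolding smooth_MHD_solution_def by blast
  define v where "v = (\<lambda>i x. u x $ i)"
  define h where "h = (\<lambda>i x. H x $ i)"
  have sv: "smooth (v i)" and sh: "smooth (h i)" for i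
    using uf Hf by (auto simp: v_def h_def smooth_field_def)
  have mhd: "mhd v h p"
    unfolding mhd_def
  proof (intro conjI allI sv sh sp)
    fix x i
    have e: "divergence u x = 0" "advect u u x - laplacian u x + gradient p x = advect H H x"
      "divergence H x = 0" "advect u H x - advect H u x = laplacian H x"
      using eq unfolding stationary_MHD_def by auto
    show "dvg v x = 0" "dvg h x = 0"
      using e(1,3) by (simp_all add: divergence_def v_def h_def)
    have "(advect u u x - laplacian u x + gradient p x) $ i = advect H H x $ i" using e(2) by simp
    then show "lap (v i) x =
       (\<Sum>j\<in>UNIV. v j x * pd j (v i) x) - (\<Sum>j\<in>UNIV. h j x * pd j (h i) x) + pd i p x"
      by (simp add: advect_def laplacian_def gradient_def v_def h_def)
    have "(advect u H x - advect H u x) $ i = laplacian H x $ i" using e(4) by simp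
    then show "lap (h i) x =
       (\<Sum>j\<in>UNIV. v j x * pd j (h i) x) - (\<Sum>j\<in>UNIV. h j x * pd j (v i) x)"
      by (simp add: advect_def laplacian_def v_def h_def)
  qed
  obtain Su where Su: "\<And>i R. bint R (\<lambda>x. (v i x) ^ 6) \<le> Su"
    using mem_L6_component[OF uf assms(4)] unfolding v_def by blast
  obtain Sh where Sh: "\<And>i R. bint R (\<lambda>x. (h i x) ^ 6) \<le> Sh"
    using mem_L6_component[OF Hf assms(5)] unfolding h_def by blast
  define S where "S = max Su Sh"
  have S: "bint R (\<lambda>x. (v i x) ^ 6) \<le> S" "bint R (\<lambda>x. (h i x) ^ 6) \<le> S" for i R
    using Su[of R i] Sh[of R i] by (auto simp: S_def)
  have S0: "S \<ge> 0" using S(1)[of 0 1] bint_nonneg[of 0 "\<lambda>x. (v 1 x) ^ 6"] by (simp add: order_trans)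
  have Cv: "\<exists>C>0. \<forall>x t. t > 0 \<longrightarrow> \<bar>avg t (v i) x\<bar> \<le> C / t" for i
    unfolding v_def by (rule BMO_inv_avg_bound[OF _ assms(2)]) (use sv in \<open>simp add: v_def\<close>)
  have Ch: "\<exists>C>0. \<forall>x t. t > 0 \<longrightarrow> \<bar>avg t (h i) x\<bar> \<le> C / t" for i
    unfolding h_def by (rule BMO_inv_avg_bound[OF _ assms(3)]) (use sh in \<open>simp add: h_def\<close>)
  define Q where "Q = mod_sq v h"
  have sQ: "smooth Q" unfolding Q_def by (rule smooth_mod_sq[OF mhd])
  have sE: "smooth (grad_sq v h)" by (rule smooth_grad_sq[OF mhd])
  define V where "V = unit_ball_vol (3::real)"
  have V: "V \<ge> 0" by (simp add: V_def)
  have c1: "bint R (\<lambda>x::real^3. c) = c * V * R ^ 3" if "R \<ge> 0" for R c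
    using bint_const[OF that, where 'a="real^3"] by (simp add: V_def)
  obtain C where C: "C > 0" and en: "\<forall>u h p s R. mhd u h p \<longrightarrow> s > 0 \<longrightarrow> R > 0 \<longrightarrow>
     bint R (grad_sq u h) \<le> C * (s * bint (8 * R) (\<lambda>x. (mod_sq u h x)\<^sup>2) + (1 + 1 / s) * (bint (8 * R) (mod_sq u h) / R\<^sup>2))"
    using energy_estimate by (elim exE conjE)
  have C2: "bint R (grad_sq v h) \<le> C * (s * bint (8 * R) (\<lambda>x. (Q x)\<^sup>2) + (1 + 1 / s) * (bint (8 * R) Q / R\<^sup>2))"
    if "s > 0" "R > 0" for s R
    using en mhd that unfolding Q_def by blast
  obtain D where D: "D > 0" and D2: "\<forall>R\<ge>1. bint R (\<lambda>x. (mod_sq v h x)\<^sup>2) \<le> D * (1 / R + R powr (1 / 16) * bint (2 * R) (grad_sq v h))"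
    using fourth_power_mhd[of v h S, OF sv sh Cv Ch S] by (elim exE conjE)
  have D3: "bint R (\<lambda>x. (Q x)\<^sup>2) \<le> D * (1 / R + R powr (1 / 16) * bint (2 * R) (grad_sq v h))" if "R \<ge> 1" for R
    using D2 that unfolding Q_def by blast
  \<comment> \<open>36 = 6 * 3 * 2: the factor of \<open>mod_sq_square_le\<close>, three components,
    and the two fields. The summand 1 ensures positivity.\<close>
  define K where "K = 36 * (S + V) + 1"
  have K: "K > 0" using S0 V by (simp add: K_def)
  have E: "bint R (grad_sq v h) \<le> 0" for R
  proof (rule bootstrap_vanish[where E="\<lambda>R. bint R (grad_sq v h)" and ?X4.0="\<lambda>R. bint R (\<lambda>x. (Q x)\<^sup>2)" and ?X2.0="\<lambda>R. bint R Q"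
      and C=C and D=D and K=K and V=V, OF C2 C _ V D3 D _ K])
    \<comment> \<open>Young's inequality with a free weight \<open>d\<close> takes the place of
      Hoelder's bound of the second power by R^(3/2) times the root of the fourth; the optimal
      \<open>d\<close> is inserted in \<open>bootstrap_energy\<close>.\<close>
    fix d R :: real assume d: "d > 0" and R: "R > 0"
    have "bint R Q \<le> bint R (\<lambda>x. d * (Q x)\<^sup>2 + 1 / d)"
    proof (intro bint_mono smooth_continuous smooth_rules sQ)
      fix x show "Q x \<le> d * (Q x)\<^sup>2 + 1 / d" using young_mult[OF d, of "Q x" 1] by simp
    qed
    also have "\<dots> = d * bint R (\<lambda>x. (Q x)\<^sup>2) + V * R ^ 3 / d"
      using R by (subst bint_add) (auto intro!: smooth_continuous smooth_power smooth_mult sQ simp: bint_cmult c1)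
    finally show "bint R Q \<le> d * bint R (\<lambda>x. (Q x)\<^sup>2) + V * R ^ 3 / d" .
  next
    fix R :: real assume R: "R \<ge> 1"
    \<comment> \<open>Splitting at w^2 = 1/R gives both terms the same growth after integration over
      the ball: the first yields at most R S, the second the volume V R^3 divided by R^2. This is
      the linear growth from which the bootstrap starts.\<close>
    have f: "w ^ 4 \<le> R * w ^ 6 + 1 / R\<^sup>2" for w :: real
    proof (cases "w\<^sup>2 \<le> 1 / R")
      case True
      have "(w\<^sup>2)\<^sup>2 \<le> (1 / R)\<^sup>2" by (intro power_mono True) simp
      then have "w ^ 4 \<le> 1 / R\<^sup>2" by (simp add: power_divide flip: power_mult)
      moreover have "0 \<le> R * w ^ 6" using R by simp
      ultimately show ?thesis by linarith
    next
      case False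
      then have "1 \<le> R * w\<^sup>2" using R by (simp add: field_simps)
      then have "w ^ 4 * 1 \<le> w ^ 4 * (R * w\<^sup>2)" by (intro mult_left_mono) auto
      also have "\<dots> = R * w ^ 6" by (simp flip: power_add)
      finally have "w ^ 4 \<le> R * w ^ 6" by simp
      moreover have "0 \<le> 1 / R\<^sup>2" by simp
      ultimately show ?thesis by linarith
    qed
    have b4: "bint R (\<lambda>x. (w x) ^ 4) \<le> (S + V) * R" if w: "smooth w" and Sw: "bint R (\<lambda>x. (w x) ^ 6) \<le> S" for w :: "real^3 \<Rightarrow> real"
    proof -
      have "bint R (\<lambda>x. (w x) ^ 4) \<le> bint R (\<lambda>x. R * (w x) ^ 6 + 1 / R\<^sup>2)"
        by (intro bint_mono f) (intro smooth_continuous smooth_rules w)+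
      also have "\<dots> = R * bint R (\<lambda>x. (w x) ^ 6) + V * R"
        using R by (subst bint_add)
          (auto intro!: smooth_continuous smooth_power smooth_mult w simp: bint_cmult c1 power2_eq_square power3_eq_cube)
      also have "\<dots> \<le> R * S + V * R" using R Sw by simp
      finally show ?thesis by (simp add: algebra_simps)
    qed
    have "bint R (\<lambda>x. (Q x)\<^sup>2) \<le> bint R (\<lambda>x. 6 * (\<Sum>i\<in>UNIV. (v i x) ^ 4 + (h i x) ^ 4))"
      unfolding Q_def by (intro bint_mono mod_sq_square_le) (intro smooth_continuous smooth_rules sQ[unfolded Q_def] sv sh)+
    also have "\<dots> = 6 * (\<Sum>i\<in>UNIV. bint R (\<lambda>x. (v i x) ^ 4) + bint R (\<lambda>x. (h i x) ^ 4))"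
      unfolding bint_cmult
      by (subst bint_sum) (intro continuous_intros smooth_continuous sv sh | simp add: bint_add continuous_intros smooth_continuous sv sh)+
    also have "\<dots> \<le> 6 * (\<Sum>i\<in>(UNIV::3 set). (S + V) * R + (S + V) * R)"
      by (intro mult_left_mono sum_mono add_mono b4 sv sh S) simp
    also have "\<dots> = 36 * (S + V) * R" by simp
    also have "\<dots> \<le> K * R" using R by (intro mult_right_mono) (auto simp: K_def)
    finally show "bint R (\<lambda>x. (Q x)\<^sup>2) \<le> K * R" .
  next
    fix R T :: real assume "R \<le> T"
    then show "bint R (grad_sq v h) \<le> bint T (grad_sq v h)"
      by (intro bint_mono_radius smooth_continuous sE grad_sq_nonneg)
  qed
  have "grad_sq v h x = 0" for x
    by (rule bint_vanishing[OF smooth_continuous[OF sE] grad_sq_nonneg E])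
  then have z: "pd j (v i) x = 0 \<and> pd j (h i) x = 0" for i j x
  proof -
    have "(pd j (v i) x)\<^sup>2 + (pd j (h i) x)\<^sup>2 \<le> (\<Sum>j\<in>UNIV. (pd j (v i) x)\<^sup>2 + (pd j (h i) x)\<^sup>2)"
      by (rule member_le_sum[of j UNIV "\<lambda>j. (pd j (v i) x)\<^sup>2 + (pd j (h i) x)\<^sup>2"]) auto
    also have "\<dots> \<le> grad_sq v h x" unfolding grad_sq_def
      by (rule member_le_sum[of i UNIV "\<lambda>i. \<Sum>j\<in>UNIV. (pd j (v i) x)\<^sup>2 + (pd j (h i) x)\<^sup>2"]) (auto intro: sum_nonneg)
    also have "\<dots> = 0" by fact
    finally show ?thesis by (simp add: sum_power2_le_zero_iff)
  qed
  have "v i x = 0" "h i x = 0" for i x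
    using smooth_gradient_zero_imp_zero[OF sv conjunct1[OF z] S(1)]
      smooth_gradient_zero_imp_zero[OF sh conjunct2[OF z] S(2)] by auto
  then show ?thesis by (simp add: v_def h_def vec_eq_iff)
qed

end
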